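(* Let $R$ be a commutative unital ring, let $\underline{C}$ be a small $R$-linear triangulated category, and let $E\subset \operatorname{Obj}\underline{C}$ be an extension-closed Karoubi-closed subset. Then for any $Y\in \operatorname{Obj}\underline{C}\setminus E$ there exists an $R$-linear cohomological functor $F^Y:\underline{C}^{op}\to R\text{-}\mathrm{mod}$ such that $F^Y(e)=\{0\}$ for all $e\in E$ and $F^Y(Y)\neq\{0\}$.
   Context: A cohomological functor $F:\underline{C}^{op}\to\underline{A}$ (with $\underline{A}$ abelian) is a contravariant functor on $\underline{C}$ that sends distinguished triangles of $\underline{C}$ into long exact sequences. $R\text{-}\mathrm{mod}$ is the category of all $R$-modules. For $A,B,C\in\operatorname{Obj}\underline{C}$, $C$ is an extension of $B$ by $A$ if there is a distinguished triangle $A\to C\to B\to A[1]$. A class $E\subset\operatorname{Obj}\underline{C}$ is extension-closed if it contains $0$ and is closed with respect to extensions. An object $X$ is a retract of $Y$ if $\operatorname{id}_X$ factors through $Y$; $E$ is Karoubi-closed in $\underline{C}$ if it contains all $\underline{C}$-retracts of its elements. *)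

theory Defs
  imports Complex_Main "HOL-Algebra.AbelCoset" "HOL-Algebra.Module"
begin

section \<open>Linear categories\<close>

text \<open>
  A small category whose Hom-sets are \<open>R\<close>-modules. The \<open>mult\<close> and \<open>one\<close> components which the record
  type \<^type>\<open>module\<close> inherits from rings are not used. Composition is written in the usual
  order (\<open>g \<cdot> f\<close> is \<open>g\<close> after \<open>f\<close>) and is meaningful for composable arrows only.
\<close>

record ('r, 'o, 'm) lin_cat =
  Obj :: "'o set"
  Hom :: "'o \<Rightarrow> 'o \<Rightarrow> ('r, 'm) module"
  Ident :: "'o \<Rightarrow> 'm"
  Comp :: "'m \<Rightarrow> 'm \<Rightarrow> 'm"  (infixl "\<cdot>\<index>" 70)

abbreviation homs :: "('r, 'o, 'm, 'z) lin_cat_scheme \<Rightarrow> 'o \<Rightarrow> 'o \<Rightarrow> 'm set"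
  where "homs C X Y \<equiv> carrier (Hom C X Y)"

text \<open>
  As usual, an arrow determines its source and its target (\<open>hom_disjoint\<close>).
\<close>

locale linear_category = cring R for R :: "('r, 'a) ring_scheme" (structure)
    and C :: "('r, 'o, 'm, 'z) lin_cat_scheme" (structure) +
  assumes hom_disjoint:
      "\<lbrakk>X \<in> Obj C; Y \<in> Obj C; X' \<in> Obj C; Y' \<in> Obj C; f \<in> homs C X Y; f \<in> homs C X' Y'\<rbrakk>
        \<Longrightarrow> X = X' \<and> Y = Y'"
    and hom_module: "\<lbrakk>X \<in> Obj C; Y \<in> Obj C\<rbrakk> \<Longrightarrow> module R (Hom C X Y)"
    and ident_closed: "X \<in> Obj C \<Longrightarrow> Ident C X \<in> homs C X X"
    and comp_closed:
      "\<lbrakk>X \<in> Obj C; Y \<in> Obj C; Z \<in> Obj C; f \<in> homs C X Y; g \<in> homs C Y Z\<rbrakk>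
        \<Longrightarrow> g \<cdot>\<^bsub>C\<^esub> f \<in> homs C X Z"
    and comp_ident_right:
      "\<lbrakk>X \<in> Obj C; Y \<in> Obj C; f \<in> homs C X Y\<rbrakk> \<Longrightarrow> f \<cdot>\<^bsub>C\<^esub> Ident C X = f"
    and comp_ident_left:
      "\<lbrakk>X \<in> Obj C; Y \<in> Obj C; f \<in> homs C X Y\<rbrakk> \<Longrightarrow> Ident C Y \<cdot>\<^bsub>C\<^esub> f = f"
    and comp_assoc:
      "\<lbrakk>W \<in> Obj C; X \<in> Obj C; Y \<in> Obj C; Z \<in> Obj C;
        f \<in> homs C W X; g \<in> homs C X Y; h \<in> homs C Y Z\<rbrakk>
        \<Longrightarrow> (h \<cdot>\<^bsub>C\<^esub> g) \<cdot>\<^bsub>C\<^esub> f = h \<cdot>\<^bsub>C\<^esub> (g \<cdot>\<^bsub>C\<^esub> f)"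
    and comp_add_right:
      "\<lbrakk>X \<in> Obj C; Y \<in> Obj C; Z \<in> Obj C; f \<in> homs C X Y; f' \<in> homs C X Y; g \<in> homs C Y Z\<rbrakk>
        \<Longrightarrow> g \<cdot>\<^bsub>C\<^esub> (f \<oplus>\<^bsub>Hom C X Y\<^esub> f') = (g \<cdot>\<^bsub>C\<^esub> f) \<oplus>\<^bsub>Hom C X Z\<^esub> (g \<cdot>\<^bsub>C\<^esub> f')"
    and comp_add_left:
      "\<lbrakk>X \<in> Obj C; Y \<in> Obj C; Z \<in> Obj C; f \<in> homs C X Y; g \<in> homs C Y Z; g' \<in> homs C Y Z\<rbrakk>
        \<Longrightarrow> (g \<oplus>\<^bsub>Hom C Y Z\<^esub> g') \<cdot>\<^bsub>C\<^esub> f = (g \<cdot>\<^bsub>C\<^esub> f) \<oplus>\<^bsub>Hom C X Z\<^esub> (g' \<cdot>\<^bsub>C\<^esub> f)"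
    and comp_smult_right:
      "\<lbrakk>X \<in> Obj C; Y \<in> Obj C; Z \<in> Obj C; r \<in> carrier R; f \<in> homs C X Y; g \<in> homs C Y Z\<rbrakk>
        \<Longrightarrow> g \<cdot>\<^bsub>C\<^esub> (r \<odot>\<^bsub>Hom C X Y\<^esub> f) = r \<odot>\<^bsub>Hom C X Z\<^esub> (g \<cdot>\<^bsub>C\<^esub> f)"
    and comp_smult_left:
      "\<lbrakk>X \<in> Obj C; Y \<in> Obj C; Z \<in> Obj C; r \<in> carrier R; f \<in> homs C X Y; g \<in> homs C Y Z\<rbrakk>
        \<Longrightarrow> (r \<odot>\<^bsub>Hom C Y Z\<^esub> g) \<cdot>\<^bsub>C\<^esub> f = r \<odot>\<^bsub>Hom C X Z\<^esub> (g \<cdot>\<^bsub>C\<^esub> f)"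

definition is_zero_object :: "('r, 'o, 'm, 'z) lin_cat_scheme \<Rightarrow> 'o \<Rightarrow> bool" where
  "is_zero_object C Z \<longleftrightarrow> Z \<in> Obj C \<and>
     (\<forall>X\<in>Obj C. (\<exists>!f. f \<in> homs C X Z) \<and> (\<exists>!f. f \<in> homs C Z X))"

definition is_iso :: "('r, 'o, 'm, 'z) lin_cat_scheme \<Rightarrow> 'o \<Rightarrow> 'o \<Rightarrow> 'm \<Rightarrow> bool" where
  "is_iso C X Y f \<longleftrightarrow> f \<in> homs C X Y \<and>
     (\<exists>g\<in>homs C Y X. g \<cdot>\<^bsub>C\<^esub> f = Ident C X \<and> f \<cdot>\<^bsub>C\<^esub> g = Ident C Y)"

definition is_biproduct ::
    "('r, 'o, 'm, 'z) lin_cat_scheme \<Rightarrow> 'o \<Rightarrow> 'o \<Rightarrow> 'o \<Rightarrow> 'm \<Rightarrow> 'm \<Rightarrow> 'm \<Rightarrow> 'm \<Rightarrow> bool" where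
  "is_biproduct C X Y S i j p q \<longleftrightarrow> S \<in> Obj C \<and>
     i \<in> homs C X S \<and> j \<in> homs C Y S \<and> p \<in> homs C S X \<and> q \<in> homs C S Y \<and>
     p \<cdot>\<^bsub>C\<^esub> i = Ident C X \<and> q \<cdot>\<^bsub>C\<^esub> j = Ident C Y \<and>
     q \<cdot>\<^bsub>C\<^esub> i = \<zero>\<^bsub>Hom C X Y\<^esub> \<and> p \<cdot>\<^bsub>C\<^esub> j = \<zero>\<^bsub>Hom C Y X\<^esub> \<and>
     (i \<cdot>\<^bsub>C\<^esub> p) \<oplus>\<^bsub>Hom C S S\<^esub> (j \<cdot>\<^bsub>C\<^esub> q) = Ident C S"

locale additive_linear_category = linear_category +
  assumes zero_object_exists: "\<exists>Z. is_zero_object C Z"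
    and biproduct_exists:
      "\<lbrakk>X \<in> Obj C; Y \<in> Obj C\<rbrakk> \<Longrightarrow> \<exists>S i j p q. is_biproduct C X Y S i j p q"

section \<open>Triangulated categories\<close>

text \<open>
  The translations \<open>[n]\<close> form an action of the integers by \<open>R\<close>-linear functors; in particular
  \<open>[1]\<close> is an automorphism with inverse \<open>[-1]\<close>. Since arrows determine their ends, a triangle
  \<open>X \<rightarrow> Y \<rightarrow> Z \<rightarrow> X[1]\<close> can be recorded as its triple of arrows.
\<close>

record ('r, 'o, 'm) tri_cat = "('r, 'o, 'm) lin_cat" +
  ShO :: "int \<Rightarrow> 'o \<Rightarrow> 'o"
  ShA :: "int \<Rightarrow> 'm \<Rightarrow> 'm"
  Dist :: "('m \<times> 'm \<times> 'm) set"

definition triangle ::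
    "('r, 'o, 'm, 'z) tri_cat_scheme \<Rightarrow> 'o \<Rightarrow> 'o \<Rightarrow> 'o \<Rightarrow> 'm \<Rightarrow> 'm \<Rightarrow> 'm \<Rightarrow> bool" where
  "triangle C X Y Z f g h \<longleftrightarrow> X \<in> Obj C \<and> Y \<in> Obj C \<and> Z \<in> Obj C \<and>
     f \<in> homs C X Y \<and> g \<in> homs C Y Z \<and> h \<in> homs C Z (ShO C 1 X)"

definition dist_triangle ::
    "('r, 'o, 'm, 'z) tri_cat_scheme \<Rightarrow> 'o \<Rightarrow> 'o \<Rightarrow> 'o \<Rightarrow> 'm \<Rightarrow> 'm \<Rightarrow> 'm \<Rightarrow> bool" where
  "dist_triangle C X Y Z f g h \<longleftrightarrow> triangle C X Y Z f g h \<and> (f, g, h) \<in> Dist C"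

locale linear_category_with_shift = additive_linear_category R C
    for R :: "('r, 'a) ring_scheme" (structure)
    and C :: "('r, 'o, 'm, 'z) tri_cat_scheme" (structure) +
  assumes ShO_closed: "X \<in> Obj C \<Longrightarrow> ShO C n X \<in> Obj C"
    and ShO_zero: "X \<in> Obj C \<Longrightarrow> ShO C 0 X = X"
    and ShO_add: "X \<in> Obj C \<Longrightarrow> ShO C (m + n) X = ShO C m (ShO C n X)"
    and ShA_closed:
      "\<lbrakk>X \<in> Obj C; Y \<in> Obj C; f \<in> homs C X Y\<rbrakk> \<Longrightarrow> ShA C n f \<in> homs C (ShO C n X) (ShO C n Y)"
    and ShA_zero: "\<lbrakk>X \<in> Obj C; Y \<in> Obj C; f \<in> homs C X Y\<rbrakk> \<Longrightarrow> ShA C 0 f = f"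
    and ShA_add:
      "\<lbrakk>X \<in> Obj C; Y \<in> Obj C; f \<in> homs C X Y\<rbrakk> \<Longrightarrow> ShA C (m + n) f = ShA C m (ShA C n f)"
    and ShA_ident: "X \<in> Obj C \<Longrightarrow> ShA C n (Ident C X) = Ident C (ShO C n X)"
    and ShA_comp:
      "\<lbrakk>X \<in> Obj C; Y \<in> Obj C; Z \<in> Obj C; f \<in> homs C X Y; g \<in> homs C Y Z\<rbrakk>
        \<Longrightarrow> ShA C n (g \<cdot>\<^bsub>C\<^esub> f) = ShA C n g \<cdot>\<^bsub>C\<^esub> ShA C n f"
    and ShA_plus:
      "\<lbrakk>X \<in> Obj C; Y \<in> Obj C; f \<in> homs C X Y; f' \<in> homs C X Y\<rbrakk>
        \<Longrightarrow> ShA C n (f \<oplus>\<^bsub>Hom C X Y\<^esub> f') = ShA C n f \<oplus>\<^bsub>Hom C (ShO C n X) (ShO C n Y)\<^esub> ShA C n f'"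
    and ShA_smult:
      "\<lbrakk>X \<in> Obj C; Y \<in> Obj C; r \<in> carrier R; f \<in> homs C X Y\<rbrakk>
        \<Longrightarrow> ShA C n (r \<odot>\<^bsub>Hom C X Y\<^esub> f) = r \<odot>\<^bsub>Hom C (ShO C n X) (ShO C n Y)\<^esub> ShA C n f"

text \<open>
  Verdier's axioms. In \<open>TR4\<close> (the octahedral axiom) the three given triangles are cones of \<open>f\<close>,
  of \<open>g \<cdot> f\<close> and of \<open>g\<close>; the last four equations say that \<open>(id, g, a)\<close> and \<open>(f, id, b)\<close>
  are morphisms of triangles.
\<close>

locale linear_triangulated_category = linear_category_with_shift +
  assumes TR1_iso:
      "\<lbrakk>dist_triangle C X Y Z f g h; triangle C X' Y' Z' f' g' h';
        is_iso C X X' a; is_iso C Y Y' b; is_iso C Z Z' c;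
        b \<cdot>\<^bsub>C\<^esub> f = f' \<cdot>\<^bsub>C\<^esub> a; c \<cdot>\<^bsub>C\<^esub> g = g' \<cdot>\<^bsub>C\<^esub> b; ShA C 1 a \<cdot>\<^bsub>C\<^esub> h = h' \<cdot>\<^bsub>C\<^esub> c\<rbrakk>
        \<Longrightarrow> dist_triangle C X' Y' Z' f' g' h'"
    and TR1_ident:
      "\<lbrakk>X \<in> Obj C; is_zero_object C Z\<rbrakk>
        \<Longrightarrow> dist_triangle C X X Z (Ident C X) \<zero>\<^bsub>Hom C X Z\<^esub> \<zero>\<^bsub>Hom C Z (ShO C 1 X)\<^esub>"
    and TR1_cone:
      "\<lbrakk>X \<in> Obj C; Y \<in> Obj C; f \<in> homs C X Y\<rbrakk> \<Longrightarrow> \<exists>Z g h. dist_triangle C X Y Z f g h"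
    and TR2:
      "triangle C X Y Z f g h \<Longrightarrow>
        dist_triangle C X Y Z f g h \<longleftrightarrow>
        dist_triangle C Y Z (ShO C 1 X) g h (\<ominus>\<^bsub>Hom C (ShO C 1 X) (ShO C 1 Y)\<^esub> ShA C 1 f)"
    and TR3:
      "\<lbrakk>dist_triangle C X Y Z f g h; dist_triangle C X' Y' Z' f' g' h';
        a \<in> homs C X X'; b \<in> homs C Y Y'; b \<cdot>\<^bsub>C\<^esub> f = f' \<cdot>\<^bsub>C\<^esub> a\<rbrakk>
        \<Longrightarrow> \<exists>c\<in>homs C Z Z'. c \<cdot>\<^bsub>C\<^esub> g = g' \<cdot>\<^bsub>C\<^esub> b \<and> ShA C 1 a \<cdot>\<^bsub>C\<^esub> h = h' \<cdot>\<^bsub>C\<^esub> c"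
    and TR4:
      "\<lbrakk>dist_triangle C X Y U f p\<^sub>1 d\<^sub>1; dist_triangle C X Z V (g \<cdot>\<^bsub>C\<^esub> f) p\<^sub>2 d\<^sub>2;
        dist_triangle C Y Z W g p\<^sub>3 d\<^sub>3\<rbrakk>
        \<Longrightarrow> \<exists>a b. dist_triangle C U V W a b (ShA C 1 p\<^sub>1 \<cdot>\<^bsub>C\<^esub> d\<^sub>3) \<and>
              a \<cdot>\<^bsub>C\<^esub> p\<^sub>1 = p\<^sub>2 \<cdot>\<^bsub>C\<^esub> g \<and> d\<^sub>2 \<cdot>\<^bsub>C\<^esub> a = d\<^sub>1 \<and>
              b \<cdot>\<^bsub>C\<^esub> p\<^sub>2 = p\<^sub>3 \<and> d\<^sub>3 \<cdot>\<^bsub>C\<^esub> b = ShA C 1 f \<cdot>\<^bsub>C\<^esub> d\<^sub>2"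

section \<open>Classes of objects\<close>

definition is_extension :: "('r, 'o, 'm, 'z) tri_cat_scheme \<Rightarrow> 'o \<Rightarrow> 'o \<Rightarrow> 'o \<Rightarrow> bool" where
  "is_extension C X B A \<longleftrightarrow> (\<exists>f g h. dist_triangle C A X B f g h)"

text \<open>
  The object \<open>0\<close> is determined up to isomorphism only. A class closed under extensions that contains
  one zero object contains all of them, so the choice is immaterial.
\<close>

definition extension_closed :: "('r, 'o, 'm, 'z) tri_cat_scheme \<Rightarrow> 'o set \<Rightarrow> bool" where
  "extension_closed C E \<longleftrightarrow> (\<exists>Z\<in>E. is_zero_object C Z) \<and>
     (\<forall>A\<in>E. \<forall>B\<in>E. \<forall>X\<in>Obj C. is_extension C X B A \<longrightarrow> X \<in> E)"

definition is_retract :: "('r, 'o, 'm, 'z) lin_cat_scheme \<Rightarrow> 'o \<Rightarrow> 'o \<Rightarrow> bool" where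
  "is_retract C X Y \<longleftrightarrow> (\<exists>i\<in>homs C X Y. \<exists>p\<in>homs C Y X. p \<cdot>\<^bsub>C\<^esub> i = Ident C X)"

definition karoubi_closed :: "('r, 'o, 'm, 'z) lin_cat_scheme \<Rightarrow> 'o set \<Rightarrow> bool" where
  "karoubi_closed C E \<longleftrightarrow> (\<forall>Y\<in>E. \<forall>X\<in>Obj C. is_retract C X Y \<longrightarrow> X \<in> E)"

section \<open>Linear contravariant functors to modules\<close>

definition linear_maps ::
    "('r, 'a) ring_scheme \<Rightarrow> ('r, 'v, 'b) module_scheme \<Rightarrow> ('r, 'w, 'c) module_scheme
      \<Rightarrow> ('v \<Rightarrow> 'w) set" where
  "linear_maps R M N = {u. u \<in> carrier M \<rightarrow> carrier N \<and>
     (\<forall>x\<in>carrier M. \<forall>y\<in>carrier M. u (x \<oplus>\<^bsub>M\<^esub> y) = u x \<oplus>\<^bsub>N\<^esub> u y) \<and>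
     (\<forall>r\<in>carrier R. \<forall>x\<in>carrier M. u (r \<odot>\<^bsub>M\<^esub> x) = r \<odot>\<^bsub>N\<^esub> u x)}"

text \<open>
  HOL has no type of all \<open>R\<close>-modules, so the values of a functor are modules whose carriers are
  arbitrary subsets of one type \<open>'v\<close>; an existence claim has to name that type. For functors on a
  category with arrows of type \<open>'m\<close> the choice \<open>'v = 'm \<Rightarrow> 'm \<Rightarrow> real\<close> leaves room for products, over
  families of arrows, of the character groups \<open>Hom(Hom(Z, X), \<real>/\<int>)\<close>.
\<close>

record ('r, 'o, 'm, 'v) mod_functor =
  FO :: "'o \<Rightarrow> ('r, 'v) module"
  FA :: "'m \<Rightarrow> 'v \<Rightarrow> 'v"

locale linear_contravariant_functor = linear_category R C
    for R :: "('r, 'a) ring_scheme" (structure)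
    and C :: "('r, 'o, 'm, 'z) lin_cat_scheme" (structure)
    and F :: "('r, 'o, 'm, 'v) mod_functor" +
  assumes FO_module: "X \<in> Obj C \<Longrightarrow> module R (FO F X)"
    and FA_closed:
      "\<lbrakk>X \<in> Obj C; Y \<in> Obj C; f \<in> homs C X Y\<rbrakk> \<Longrightarrow> FA F f \<in> linear_maps R (FO F Y) (FO F X)"
    and FA_ident: "\<lbrakk>X \<in> Obj C; x \<in> carrier (FO F X)\<rbrakk> \<Longrightarrow> FA F (Ident C X) x = x"
    and FA_comp:
      "\<lbrakk>X \<in> Obj C; Y \<in> Obj C; Z \<in> Obj C; f \<in> homs C X Y; g \<in> homs C Y Z; x \<in> carrier (FO F Z)\<rbrakk>
        \<Longrightarrow> FA F (g \<cdot>\<^bsub>C\<^esub> f) x = FA F f (FA F g x)"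
    and FA_add:
      "\<lbrakk>X \<in> Obj C; Y \<in> Obj C; f \<in> homs C X Y; f' \<in> homs C X Y; x \<in> carrier (FO F Y)\<rbrakk>
        \<Longrightarrow> FA F (f \<oplus>\<^bsub>Hom C X Y\<^esub> f') x = FA F f x \<oplus>\<^bsub>FO F X\<^esub> FA F f' x"
    and FA_smult:
      "\<lbrakk>X \<in> Obj C; Y \<in> Obj C; r \<in> carrier R; f \<in> homs C X Y; x \<in> carrier (FO F Y)\<rbrakk>
        \<Longrightarrow> FA F (r \<odot>\<^bsub>Hom C X Y\<^esub> f) x = r \<odot>\<^bsub>FO F X\<^esub> FA F f x"

definition exact_at ::
    "('r, 'v) module \<Rightarrow> ('v \<Rightarrow> 'v) \<Rightarrow> ('r, 'v) module \<Rightarrow> ('v \<Rightarrow> 'v) \<Rightarrow> ('r, 'v) module \<Rightarrow> bool" where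
  "exact_at L u M v N \<longleftrightarrow> u ` carrier L = a_kernel M N v"

text \<open>
  A triangle \<open>X \<rightarrow> Y \<rightarrow> Z \<rightarrow> X[1]\<close> with arrows \<open>f, g, h\<close> yields the sequence, infinite in both
  directions,
  \<open>\<dots> \<rightarrow> F(X[n+1]) \<rightarrow> F(Z[n]) \<rightarrow> F(Y[n]) \<rightarrow> F(X[n]) \<rightarrow> F(Z[n-1]) \<rightarrow> \<dots>\<close>
  with maps \<open>F(h[n]), F(g[n]), F(f[n]), F(h[n-1])\<close>. The signs that usually accompany the shifted
  arrows do not affect exactness.
\<close>

locale linear_cohomological_functor =
  linear_triangulated_category R C + linear_contravariant_functor R C F
    for R :: "('r, 'a) ring_scheme" (structure)
    and C :: "('r, 'o, 'm, 'z) tri_cat_scheme" (structure)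
    and F :: "('r, 'o, 'm, 'v) mod_functor" +
  assumes exact_Z:
      "dist_triangle C X Y Z f g h \<Longrightarrow>
        exact_at (FO F (ShO C (n + 1) X)) (FA F (ShA C n h))
          (FO F (ShO C n Z)) (FA F (ShA C n g)) (FO F (ShO C n Y))"
    and exact_Y:
      "dist_triangle C X Y Z f g h \<Longrightarrow>
        exact_at (FO F (ShO C n Z)) (FA F (ShA C n g))
          (FO F (ShO C n Y)) (FA F (ShA C n f)) (FO F (ShO C n X))"
    and exact_X:
      "dist_triangle C X Y Z f g h \<Longrightarrow>
        exact_at (FO F (ShO C n Y)) (FA F (ShA C n f))
          (FO F (ShO C n X)) (FA F (ShA C (n - 1) h)) (FO F (ShO C (n - 1) Z))"

end

theory Submission
  imports Defs "HOL-Library.Function_Algebras"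
begin

text \<open>
  Let \<open>I\<close> be the class of arrows that factor through an object of \<open>E\<close>. Since \<open>E\<close> is Karoubi-closed,
  \<open>id\<^sub>Y\<close> is not in \<open>I\<close>, so the class of \<open>id\<^sub>Y\<close> is a nonzero element of \<open>M(Y)\<close>, where \<open>M\<close> is the
  quotient \<open>Hom(-, Y)/I\<close>. The functor \<open>F\<^sup>Y\<close> is the injective hull of \<open>M\<close> in the category of additive
  contravariant functors. An injective functor \<open>F\<close> is cohomological: \<open>Hom(-, F)\<close> turns the exact
  sequences of representable functors \<open>Hom(-, X) \<rightarrow> Hom(-, Y) \<rightarrow> Hom(-, Z)\<close> of a triangle into exact
  sequences, and by the Yoneda lemma it sends \<open>Hom(-, X)\<close> to \<open>F(X)\<close>.

  The hull is an essential extension, so if it had a nonzero element \<open>k\<close> at some \<open>e\<close> in \<open>E\<close>, then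
  some \<open>h : X \<rightarrow> e\<close> would take \<open>k\<close> to a nonzero element of \<open>M(X)\<close>, the class of an arrow
  \<open>v : X \<rightarrow> Y\<close>. This \<open>v\<close> is not in \<open>I\<close>, but \<open>v \<cdot> w\<close> is in \<open>I\<close> for every \<open>w\<close> with \<open>h \<cdot> w = 0\<close>. Such a \<open>v\<close>
  does not exist (\<open>factors_through_extension\<close>); here closedness under extensions is used, through a
  pushout of the triangle on \<open>h\<close>.

  The hull is built inside the injective functor \<open>P(X) = \<Prod>\<^sub>u Hom(Hom(Z, X), \<real>/\<int>)\<close>, the product
  over all arrows \<open>u : Z \<rightarrow> S\<close>. That \<open>P\<close> is injective, exact on triangles and large enough to contain
  \<open>M\<close> are three consequences of the divisibility of \<open>\<real>/\<int>\<close>, that is, of the extension of characters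
  (\<open>char_prod_injective_functor\<close>, \<open>char_prod_exact\<close>, \<open>representable_quotient_embeds\<close>). Two
  applications of Zorn's lemma then produce an essential extension of \<open>M\<close> that is a direct summand of
  \<open>P\<close> (\<open>essential_summand\<close>). A summand inherits the exactness of \<open>P\<close>, and its elements are families
  of characters indexed by arrows, hence functions \<open>'m \<Rightarrow> 'm \<Rightarrow> real\<close> after choosing representatives
  of \<open>\<real>/\<int>\<close>.
\<close>

section \<open>Characters of abelian groups\<close>

text \<open>
  The group \<open>\<real>/\<int>\<close>. As a type of class \<^class>\<open>ab_group_add\<close> it makes every function type with values
  in it an abelian group as well, so that the products of character groups below need no
  carrier-relative algebra.
\<close>

quotient_type circle = real / "\<lambda>x y. x - y \<in> \<int>"
proof (rule equivpI)
  show "reflp (\<lambda>x y. x - y \<in> (\<int>::real set))" by (rule reflpI) simp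
  show "symp (\<lambda>x y. x - y \<in> (\<int>::real set))" by (rule sympI) (metis Ints_minus minus_diff_eq)
  show "transp (\<lambda>x y. x - y \<in> (\<int>::real set))"
    by (rule transpI) (metis Ints_add diff_add_cancel add_diff_eq)
qed

instantiation circle :: ab_group_add
begin

lift_definition zero_circle :: circle is "0::real" .

lift_definition plus_circle :: "circle \<Rightarrow> circle \<Rightarrow> circle" is "(+)"
  by (metis Ints_add add_diff_add)

lift_definition uminus_circle :: "circle \<Rightarrow> circle" is "uminus"
  by (metis Ints_minus minus_diff_minus)

lift_definition minus_circle :: "circle \<Rightarrow> circle \<Rightarrow> circle" is "(-)"
  by (metis Ints_diff diff_diff_eq2 add_diff_eq diff_add_eq diff_diff_eq)

instance by standard (transfer; simp add: algebra_simps)+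

end

lemma abs_circle_add: "abs_circle (x + y) = abs_circle x + abs_circle y"
  by (simp add: plus_circle.abs_eq)

lemma abs_circle_uminus: "abs_circle (- x) = - abs_circle x"
  by (simp add: uminus_circle.abs_eq)

lemma abs_circle_eq_0_iff: "abs_circle x = 0 \<longleftrightarrow> x \<in> \<int>"
  unfolding zero_circle_def by (simp add: circle.abs_eq_iff)

lemma abs_circle_rep_circle: "abs_circle (rep_circle x) = x"
  by (meson Quotient_circle Quotient_abs_rep)

definition characters :: "('a, 'b) ring_scheme \<Rightarrow> ('a \<Rightarrow> circle) set" where
  "characters G = {\<chi>. \<forall>a\<in>carrier G. \<forall>b\<in>carrier G. \<chi> (a \<oplus>\<^bsub>G\<^esub> b) = \<chi> a + \<chi> b}"

lemma characters_add:
  "\<lbrakk>\<chi> \<in> characters G; a \<in> carrier G; b \<in> carrier G\<rbrakk> \<Longrightarrow> \<chi> (a \<oplus>\<^bsub>G\<^esub> b) = \<chi> a + \<chi> b"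
  by (simp add: characters_def)

lemma (in abelian_group) characters_zero:
  assumes "\<chi> \<in> characters G"
  shows "\<chi> \<zero> = 0"
  using characters_add[OF assms, of \<zero> \<zero>] by simp

text \<open>
  A character of a subgroup, given by its graph. For a subgroup of a product, being the graph of a
  function is a condition at zero only, and a maximality argument does not have to carry a domain
  along.
\<close>

definition partial_character :: "('a, 'b) ring_scheme \<Rightarrow> ('a \<times> circle) set \<Rightarrow> bool" where
  "partial_character G \<Gamma> \<longleftrightarrow> \<Gamma> \<subseteq> carrier G \<times> UNIV \<and> (\<zero>\<^bsub>G\<^esub>, 0) \<in> \<Gamma> \<and>
     (\<forall>a c b d. (a, c) \<in> \<Gamma> \<longrightarrow> (b, d) \<in> \<Gamma> \<longrightarrow> (a \<oplus>\<^bsub>G\<^esub> b, c + d) \<in> \<Gamma>) \<and>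
     (\<forall>a c. (a, c) \<in> \<Gamma> \<longrightarrow> (\<ominus>\<^bsub>G\<^esub> a, - c) \<in> \<Gamma>) \<and>
     (\<forall>c. (\<zero>\<^bsub>G\<^esub>, c) \<in> \<Gamma> \<longrightarrow> c = 0)"

context abelian_group
begin

lemma partial_character_multiple:
  assumes \<Gamma>: "partial_character G \<Gamma>" and at: "(a, abs_circle t) \<in> \<Gamma>"
  shows "(add_pow G (n::int) a, abs_circle (of_int n * t)) \<in> \<Gamma>"
proof -
  have a: "a \<in> carrier G" using \<Gamma> at by (auto simp: partial_character_def)
  have nonneg: "(add_pow G (int m) a, abs_circle (real m * t)) \<in> \<Gamma>" for m
  proof (induction m)
    case 0
    then show ?case
      using \<Gamma> by (simp add: partial_character_def add_pow_int_ge zero_circle_def)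
  next
    case (Suc m)
    have "add_pow G (int (Suc m)) a = add_pow G (int m) a \<oplus> a"
      using a by (simp add: add_pow_int_ge nat_add_distrib)
    moreover have "abs_circle (real (Suc m) * t) = abs_circle (real m * t) + abs_circle t"
      by (simp add: abs_circle_add[symmetric] algebra_simps)
    ultimately show ?case
      using Suc at \<Gamma> by (simp add: partial_character_def del: of_nat_Suc)
  qed
  show ?thesis
  proof (cases "n \<ge> 0")
    case True
    then show ?thesis using nonneg[of "nat n"] by simp
  next
    case False
    define m where "m = nat (- n)"
    have n: "n = - int m" using False by (simp add: m_def)
    have "(\<ominus> (add_pow G (int m) a), - abs_circle (real m * t)) \<in> \<Gamma>"
      using nonneg[of m] \<Gamma> by (simp add: partial_character_def)
    then show ?thesis
      using a by (simp add: n add.int_pow_neg abs_circle_uminus[symmetric])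
  qed
qed

text \<open>
  Divisibility of the circle: the value at a new element \<open>x\<close> is constrained only through the least
  positive multiple \<open>[k] \<cdot> x\<close> in the domain, and dividing by \<open>k \<ge> 2\<close> leaves at least two choices, one
  of which is nonzero; without such a multiple every value is admissible. The nonzero choice is what
  later separates \<open>x\<close> from the domain.
\<close>

lemma partial_character_value_at_new_element:
  assumes \<Gamma>: "partial_character G \<Gamma>" and x: "x \<in> carrier G" "x \<notin> Domain \<Gamma>"
  obtains t where "abs_circle t \<noteq> 0"
    and "\<And>(n::int) c. (add_pow G n x, c) \<in> \<Gamma> \<Longrightarrow> c = abs_circle (of_int n * t)"
proof (cases "\<exists>k::nat. 0 < k \<and> add_pow G (int k) x \<in> Domain \<Gamma>")
  case False
  have "c = abs_circle (of_int n * (1/2))" if "(add_pow G n x, c) \<in> \<Gamma>" for n :: int and c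
  proof -
    have "\<not> 0 < n"
    proof
      assume "0 < n"
      then obtain k where "0 < k" "n = int k" using zero_less_imp_eq_int by metis
      then show False using False that by blast
    qed
    moreover
    have neg: "(add_pow G (- n) x, - c) \<in> \<Gamma>"
      using that \<Gamma> x by (simp add: partial_character_def add.int_pow_neg)
    have "\<not> 0 < - n"
    proof
      assume "0 < - n"
      then obtain k where "0 < k" "- n = int k" using zero_less_imp_eq_int by metis
      then show False using False neg by (metis DomainI)
    qed
    ultimately have "n = 0" by simp
    then show ?thesis using that \<Gamma>
      by (simp add: partial_character_def add_pow_int_ge zero_circle_def[symmetric])
  qed
  moreover have "abs_circle (1/2) \<noteq> 0"
  proof
    assume "abs_circle (1/2) = 0"
    then obtain i :: int where "1/2 = real_of_int i"
      unfolding abs_circle_eq_0_iff by (elim Ints_cases)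
    then have "1 = 2 * i" by linarith
    then show False by presburger
  qed
  ultimately show ?thesis using that by blast
next
  case True
  define k where "k = (LEAST k::nat. 0 < k \<and> add_pow G (int k) x \<in> Domain \<Gamma>)"
  have k: "0 < k" "add_pow G (int k) x \<in> Domain \<Gamma>"
    using LeastI_ex[OF True] by (simp_all add: k_def)
  have least: "\<not> (0 < j \<and> add_pow G (int j) x \<in> Domain \<Gamma>)" if "j < k" for j
    using not_less_Least that unfolding k_def by blast
  have "k \<noteq> 1" using k x by auto
  then have "k \<ge> 2" using k by simp
  obtain s where s: "(add_pow G (int k) x, abs_circle s) \<in> \<Gamma>"
    using k by (metis DomainE abs_circle_rep_circle)
  have compat: "c = abs_circle (of_int n * t)"
    if n: "(add_pow G n x, c) \<in> \<Gamma>" and t: "abs_circle (real k * t) = abs_circle s" for n :: int and c t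
  proof -
    define q r where "q = n div int k" and "r = n mod int k"
    have nqr: "n = int k * q + r" and r: "0 \<le> r" "r < int k"
      using k by (simp_all add: q_def r_def)
    have kt: "(add_pow G (int k) x, abs_circle (real k * t)) \<in> \<Gamma>" using s t by simp
    have q: "(add_pow G (int k * q) x, abs_circle (of_int q * (real k * t))) \<in> \<Gamma>"
      using partial_character_multiple[OF \<Gamma> kt, of q] x by (simp add: add.int_pow_pow)
    have "(add_pow G n x \<oplus> \<ominus> (add_pow G (int k * q) x), c + - abs_circle (of_int q * (real k * t))) \<in> \<Gamma>"
      using n q \<Gamma> unfolding partial_character_def by blast
    moreover have "add_pow G n x \<oplus> \<ominus> (add_pow G (int k * q) x) = add_pow G r x"
      using x nqr by (simp add: add.int_pow_diff[symmetric])
    ultimately have rx: "(add_pow G r x, c - abs_circle (of_int q * (real k * t))) \<in> \<Gamma>" by simp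
    have "nat r < k" using r by linarith
    from least[OF this] have "r = 0" using r rx by auto
    then have "c = abs_circle (of_int q * (real k * t))"
      using rx \<Gamma> unfolding partial_character_def by (metis add_pow_int_ge add.nat_pow_0 nat_0 order_refl right_minus_eq)
    then show ?thesis using nqr \<open>r = 0\<close> by (simp add: mult.assoc mult.left_commute)
  qed
  have t1: "abs_circle (real k * (s / real k)) = abs_circle s" using k by simp
  have t2: "abs_circle (real k * ((s + 1) / real k)) = abs_circle s"
    using k abs_circle_eq_0_iff[of 1] by (simp add: abs_circle_add)
  have "abs_circle (s / real k) \<noteq> 0 \<or> abs_circle ((s + 1) / real k) \<noteq> 0"
  proof (rule ccontr)
    assume "\<not> ?thesis"
    then have "s / real k \<in> \<int>" "(s + 1) / real k \<in> \<int>" by (simp_all add: abs_circle_eq_0_iff)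
    then have "(s + 1) / real k - s / real k \<in> \<int>" by (rule Ints_diff[rotated])
    moreover have "(s + 1) / real k - s / real k = 1 / real k"
      by (simp add: add_divide_distrib)
    ultimately obtain i :: int where i: "1 / real k = of_int i" by (auto elim: Ints_cases)
    have "0 < 1 / real k" "1 / real k < 1" using \<open>k \<ge> 2\<close> by simp_all
    then have "0 < i" "i < 1" unfolding i by simp_all
    then show False by simp
  qed
  then show ?thesis using that compat t1 t2 by blast
qed

lemma partial_character_adjoin:
  assumes \<Gamma>: "partial_character G \<Gamma>" and x: "x \<in> carrier G"
    and t: "\<And>(n::int) c. (add_pow G n x, c) \<in> \<Gamma> \<Longrightarrow> c = abs_circle (of_int n * t)"
  obtains \<Gamma>' where "partial_character G \<Gamma>'" "\<Gamma> \<subseteq> \<Gamma>'" "(x, abs_circle t) \<in> \<Gamma>'"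
proof -
  define \<Gamma>' where
    "\<Gamma>' = {(a \<oplus> add_pow G n x, c + abs_circle (of_int n * t)) | a c (n::int). (a, c) \<in> \<Gamma>}"
  have memI: "(b, d) \<in> \<Gamma>'"
    if "(a, c) \<in> \<Gamma>" "b = a \<oplus> add_pow G n x" "d = c + abs_circle (of_int n * t)" for a b c d and n :: int
    using that unfolding \<Gamma>'_def by blast
  have memE: "\<exists>a c (n::int). (a, c) \<in> \<Gamma> \<and> a \<in> carrier G \<and> b = a \<oplus> add_pow G n x \<and>
      d = c + abs_circle (of_int n * t)" if "(b, d) \<in> \<Gamma>'" for b d
    using that \<Gamma> unfolding \<Gamma>'_def partial_character_def by blast
  have zero: "(\<zero>, 0) \<in> \<Gamma>" using \<Gamma> by (simp add: partial_character_def)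
  have sub: "\<Gamma> \<subseteq> \<Gamma>'"
  proof (rule subrelI)
    fix a c assume ac: "(a, c) \<in> \<Gamma>"
    have "a \<in> carrier G" using ac \<Gamma> by (auto simp: partial_character_def)
    then show "(a, c) \<in> \<Gamma>'"
      by (intro memI[OF ac, of _ 0]) (simp_all add: add_pow_int_ge abs_circle_eq_0_iff)
  qed
  have new: "(x, abs_circle t) \<in> \<Gamma>'"
    using x by (intro memI[OF zero, of _ 1]) simp_all
  have "partial_character G \<Gamma>'"
    unfolding partial_character_def
  proof (intro conjI allI impI)
    show "\<Gamma>' \<subseteq> carrier G \<times> UNIV"
      using \<Gamma> x unfolding \<Gamma>'_def partial_character_def by auto
    show "(\<zero>, 0) \<in> \<Gamma>'" using sub zero by blast
  next
    fix a c b d assume "(a, c) \<in> \<Gamma>'" "(b, d) \<in> \<Gamma>'"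
    then obtain a0 c0 b0 d0 and n m :: int
      where a: "(a0, c0) \<in> \<Gamma>" "a0 \<in> carrier G" "a = a0 \<oplus> add_pow G n x" "c = c0 + abs_circle (of_int n * t)"
        and b: "(b0, d0) \<in> \<Gamma>" "b0 \<in> carrier G" "b = b0 \<oplus> add_pow G m x" "d = d0 + abs_circle (of_int m * t)"
      using memE by metis
    have "(a0 \<oplus> b0, c0 + d0) \<in> \<Gamma>" using \<Gamma> a b by (simp add: partial_character_def)
    then show "(a \<oplus> b, c + d) \<in> \<Gamma>'"
      by (rule memI[of _ _ _ "n + m"])
        (use a b x in \<open>simp_all add: add.int_pow_mult a_ac abs_circle_add distrib_right add_ac\<close>)
  next
    fix a c assume "(a, c) \<in> \<Gamma>'"
    then obtain a0 c0 and n :: int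
      where a: "(a0, c0) \<in> \<Gamma>" "a0 \<in> carrier G" "a = a0 \<oplus> add_pow G n x" "c = c0 + abs_circle (of_int n * t)"
      using memE by metis
    have "(\<ominus> a0, - c0) \<in> \<Gamma>" using \<Gamma> a by (simp add: partial_character_def)
    then show "(\<ominus> a, - c) \<in> \<Gamma>'"
      by (rule memI[of _ _ _ "- n"])
        (use a x in \<open>simp_all add: minus_add add.int_pow_neg abs_circle_uminus\<close>)
  next
    fix c assume "(\<zero>, c) \<in> \<Gamma>'"
    then obtain a0 c0 and n :: int
      where a: "(a0, c0) \<in> \<Gamma>" "a0 \<in> carrier G" "\<zero> = a0 \<oplus> add_pow G n x" "c = c0 + abs_circle (of_int n * t)"
      using memE by metis
    have "a0 = \<ominus> (add_pow G n x)" using a x by (metis add.int_pow_closed minus_equality)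
    then have "(add_pow G (- n) x, c0) \<in> \<Gamma>" using a x by (simp add: add.int_pow_neg)
    from t[OF this] show "c = 0" using a by (simp add: abs_circle_uminus)
  qed
  then show ?thesis using that sub new by blast
qed

text \<open>The circle is an injective abelian group.\<close>

lemma partial_character_extends:
  assumes \<Gamma>: "partial_character G \<Gamma>"
  obtains \<chi> where "\<chi> \<in> characters G" and "\<And>a c. (a, c) \<in> \<Gamma> \<Longrightarrow> \<chi> a = c"
proof -
  define \<A> where "\<A> = {\<Delta>. partial_character G \<Delta> \<and> \<Gamma> \<subseteq> \<Delta>}"
  have "\<exists>\<Delta>\<in>\<A>. \<forall>\<Delta>'\<in>\<A>. \<Delta> \<subseteq> \<Delta>' \<longrightarrow> \<Delta>' = \<Delta>"
  proof (rule subset_Zorn_nonempty)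
    show "\<A> \<noteq> {}" using \<Gamma> by (auto simp: \<A>_def)
  next
    fix \<C> assume ne: "\<C> \<noteq> {}" and chain: "subset.chain \<A> \<C>"
    have mem: "partial_character G \<Delta>" "\<Gamma> \<subseteq> \<Delta>" if "\<Delta> \<in> \<C>" for \<Delta>
      using chain that by (auto simp: subset_chain_def \<A>_def)
    have two: "\<exists>\<Delta>\<in>\<C>. p \<in> \<Delta> \<and> q \<in> \<Delta>" if pq: "p \<in> \<Union>\<C>" "q \<in> \<Union>\<C>" for p q
    proof -
      obtain \<Delta> \<Delta>' where "\<Delta> \<in> \<C>" "p \<in> \<Delta>" "\<Delta>' \<in> \<C>" "q \<in> \<Delta>'" using pq by (elim UnionE)
      moreover from this have "\<Delta> \<subseteq> \<Delta>' \<or> \<Delta>' \<subseteq> \<Delta>" using chain by (auto simp: subset_chain_def)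
      ultimately show ?thesis by blast
    qed
    have "partial_character G (\<Union>\<C>)"
      unfolding partial_character_def
    proof (intro conjI allI impI)
      show "\<Union>\<C> \<subseteq> carrier G \<times> UNIV" using mem(1) unfolding partial_character_def by blast
      show "(\<zero>, 0) \<in> \<Union>\<C>" using ne mem(1) by (auto simp: partial_character_def)
      show "(a \<oplus> b, c + d) \<in> \<Union>\<C>" if "(a, c) \<in> \<Union>\<C>" "(b, d) \<in> \<Union>\<C>" for a b c d
        using two[OF that] mem(1) unfolding partial_character_def by blast
      show "(\<ominus> a, - c) \<in> \<Union>\<C>" if "(a, c) \<in> \<Union>\<C>" for a c
        using that mem(1) unfolding partial_character_def by blast
      show "c = 0" if "(\<zero>, c) \<in> \<Union>\<C>" for c
        using that mem(1) unfolding partial_character_def by blast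
    qed
    then show "\<Union>\<C> \<in> \<A>" using ne mem(2) by (auto simp: \<A>_def)
  qed
  then obtain \<Delta> where \<Delta>_mem: "\<Delta> \<in> \<A>" and \<Delta>_max: "\<forall>\<Delta>'\<in>\<A>. \<Delta> \<subseteq> \<Delta>' \<longrightarrow> \<Delta>' = \<Delta>" by (rule bexE)
  have \<Delta>: "partial_character G \<Delta>" "\<Gamma> \<subseteq> \<Delta>" using \<Delta>_mem by (simp_all add: \<A>_def)
  have max: "\<Delta>' = \<Delta>" if "partial_character G \<Delta>'" "\<Delta> \<subseteq> \<Delta>'" for \<Delta>'
  proof -
    have "\<Delta>' \<in> \<A>" using that \<Delta>(2) by (simp add: \<A>_def)
    then show ?thesis using \<Delta>_max that(2) by simp
  qed
  have total: "\<exists>c. (x, c) \<in> \<Delta>" if x: "x \<in> carrier G" for x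
  proof (rule ccontr)
    assume "\<nexists>c. (x, c) \<in> \<Delta>"
    then have notin: "x \<notin> Domain \<Delta>" by blast
    obtain t where t: "\<And>(n::int) c. (add_pow G n x, c) \<in> \<Delta> \<Longrightarrow> c = abs_circle (of_int n * t)"
      using partial_character_value_at_new_element[OF \<Delta>(1) x notin] by metis
    obtain \<Delta>' where "partial_character G \<Delta>'" "\<Delta> \<subseteq> \<Delta>'" "(x, abs_circle t) \<in> \<Delta>'"
      using partial_character_adjoin[OF \<Delta>(1) x t] by metis
    then show False using max notin by blast
  qed
  have unique: "c = d" if "(a, c) \<in> \<Delta>" "(a, d) \<in> \<Delta>" for a c d
  proof -
    have "(a \<oplus> \<ominus> a, c + - d) \<in> \<Delta>" using \<Delta> that unfolding partial_character_def by blast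
    moreover have "a \<in> carrier G" using \<Delta> that by (auto simp: partial_character_def)
    ultimately have "c + - d = 0" using \<Delta>(1) unfolding partial_character_def by (metis r_neg)
    then show ?thesis by simp
  qed
  define \<chi> where "\<chi> a = (THE c. (a, c) \<in> \<Delta>)" for a
  have \<chi>: "\<chi> a = c" if "(a, c) \<in> \<Delta>" for a c
    unfolding \<chi>_def using that unique by blast
  have "\<chi> (a \<oplus> b) = \<chi> a + \<chi> b" if "a \<in> carrier G" "b \<in> carrier G" for a b
  proof -
    obtain c d where "(a, c) \<in> \<Delta>" "(b, d) \<in> \<Delta>" using total \<open>a \<in> carrier G\<close> \<open>b \<in> carrier G\<close> by blast
    moreover from this have "(a \<oplus> b, c + d) \<in> \<Delta>" using \<Delta> unfolding partial_character_def by blast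
    ultimately show ?thesis by (simp add: \<chi>)
  qed
  then have "\<chi> \<in> characters G" by (simp add: characters_def)
  moreover have "\<chi> a = c" if "(a, c) \<in> \<Gamma>" for a c using \<chi> \<Delta>(2) that by blast
  ultimately show ?thesis using that by blast
qed

lemma character_separating_from_subgroup:
  assumes H: "H \<subseteq> carrier G" "\<zero> \<in> H" "\<And>a b. \<lbrakk>a \<in> H; b \<in> H\<rbrakk> \<Longrightarrow> a \<oplus> b \<in> H" "\<And>a. a \<in> H \<Longrightarrow> \<ominus> a \<in> H"
    and x: "x \<in> carrier G" "x \<notin> H"
  obtains \<chi> where "\<chi> \<in> characters G" "\<And>a. a \<in> H \<Longrightarrow> \<chi> a = 0" "\<chi> x \<noteq> 0"
proof -
  have \<Gamma>: "partial_character G (H \<times> {0})"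
    using H by (auto simp: partial_character_def)
  have notin: "x \<notin> Domain (H \<times> {0})" using x by blast
  obtain t where t: "abs_circle t \<noteq> 0"
    "\<And>(n::int) c. (add_pow G n x, c) \<in> H \<times> {0} \<Longrightarrow> c = abs_circle (of_int n * t)"
    using partial_character_value_at_new_element[OF \<Gamma> x(1) notin] by metis
  obtain \<Gamma>' where \<Gamma>': "partial_character G \<Gamma>'" "H \<times> {0} \<subseteq> \<Gamma>'" "(x, abs_circle t) \<in> \<Gamma>'"
    using partial_character_adjoin[OF \<Gamma> x(1) t(2)] by metis
  obtain \<chi> where \<chi>: "\<chi> \<in> characters G" "\<And>a c. (a, c) \<in> \<Gamma>' \<Longrightarrow> \<chi> a = c"
    using partial_character_extends[OF \<Gamma>'(1)] by metis
  have "\<chi> a = 0" if "a \<in> H" for a using \<Gamma>'(2) that by (intro \<chi>(2)) blast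
  moreover have "\<chi> x \<noteq> 0" using \<chi>(2)[OF \<Gamma>'(3)] t(1) by simp
  ultimately show ?thesis using that \<chi>(1) by blast
qed

end

section \<open>Exactness of the representable functors\<close>

context linear_category
begin

lemma hom_abelian_group: "\<lbrakk>X \<in> Obj C; Y \<in> Obj C\<rbrakk> \<Longrightarrow> abelian_group (Hom C X Y)"
  using hom_module by (simp add: module_def)

lemma hom_zero_closed: "\<lbrakk>X \<in> Obj C; Y \<in> Obj C\<rbrakk> \<Longrightarrow> \<zero>\<^bsub>Hom C X Y\<^esub> \<in> homs C X Y"
  using abelian_groupE(2)[OF hom_abelian_group] by blast

lemma hom_add_closed:
  "\<lbrakk>X \<in> Obj C; Y \<in> Obj C; f \<in> homs C X Y; g \<in> homs C X Y\<rbrakk> \<Longrightarrow> f \<oplus>\<^bsub>Hom C X Y\<^esub> g \<in> homs C X Y"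
  using abelian_groupE(1)[OF hom_abelian_group] by blast

lemma hom_neg_closed:
  "\<lbrakk>X \<in> Obj C; Y \<in> Obj C; f \<in> homs C X Y\<rbrakk> \<Longrightarrow> \<ominus>\<^bsub>Hom C X Y\<^esub> f \<in> homs C X Y"
  using abelian_group.a_inv_closed[OF hom_abelian_group] by blast

lemma hom_add_neg:
  "\<lbrakk>X \<in> Obj C; Y \<in> Obj C; f \<in> homs C X Y\<rbrakk>
    \<Longrightarrow> f \<oplus>\<^bsub>Hom C X Y\<^esub> \<ominus>\<^bsub>Hom C X Y\<^esub> f = \<zero>\<^bsub>Hom C X Y\<^esub>"
  using abelian_group.r_neg[OF hom_abelian_group] by blast

lemma hom_neg_neg:
  "\<lbrakk>X \<in> Obj C; Y \<in> Obj C; f \<in> homs C X Y\<rbrakk> \<Longrightarrow> \<ominus>\<^bsub>Hom C X Y\<^esub> (\<ominus>\<^bsub>Hom C X Y\<^esub> f) = f"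
  using abelian_group.minus_minus[OF hom_abelian_group] by blast

lemma hom_add_zero:
  "\<lbrakk>X \<in> Obj C; Y \<in> Obj C; f \<in> homs C X Y\<rbrakk> \<Longrightarrow> f \<oplus>\<^bsub>Hom C X Y\<^esub> \<zero>\<^bsub>Hom C X Y\<^esub> = f"
  "\<lbrakk>X \<in> Obj C; Y \<in> Obj C; f \<in> homs C X Y\<rbrakk> \<Longrightarrow> \<zero>\<^bsub>Hom C X Y\<^esub> \<oplus>\<^bsub>Hom C X Y\<^esub> f = f"
  using abelian_monoid.r_zero abelian_monoid.l_zero abelian_group.axioms(1)[OF hom_abelian_group]
  by metis+

lemma hom_eq_zero_if_idem:
  assumes "X \<in> Obj C" "Y \<in> Obj C" "f \<in> homs C X Y" "f \<oplus>\<^bsub>Hom C X Y\<^esub> f = f"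
  shows "f = \<zero>\<^bsub>Hom C X Y\<^esub>"
proof -
  interpret H: abelian_group "Hom C X Y" using assms hom_abelian_group by blast
  show ?thesis using assms by (metis H.add.r_cancel_one')
qed

lemma comp_zero_right:
  assumes "X \<in> Obj C" "Y \<in> Obj C" "Z \<in> Obj C" "g \<in> homs C Y Z"
  shows "g \<cdot>\<^bsub>C\<^esub> \<zero>\<^bsub>Hom C X Y\<^esub> = \<zero>\<^bsub>Hom C X Z\<^esub>"
proof -
  note z = hom_zero_closed[OF assms(1,2)]
  show ?thesis
    using comp_add_right[OF assms(1-3) z z assms(4)] hom_add_zero(1)[OF assms(1,2) z]
    by (intro hom_eq_zero_if_idem comp_closed[OF assms(1-3) z]) (simp_all add: assms)
qed

lemma comp_zero_left:
  assumes "X \<in> Obj C" "Y \<in> Obj C" "Z \<in> Obj C" "f \<in> homs C X Y"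
  shows "\<zero>\<^bsub>Hom C Y Z\<^esub> \<cdot>\<^bsub>C\<^esub> f = \<zero>\<^bsub>Hom C X Z\<^esub>"
proof -
  note z = hom_zero_closed[OF assms(2,3)]
  show ?thesis
    using comp_add_left[OF assms(1-4) z z] hom_add_zero(1)[OF assms(2,3) z]
    by (intro hom_eq_zero_if_idem comp_closed[OF assms(1-4) z]) (simp_all add: assms)
qed

lemma hom_neg_unique:
  assumes "X \<in> Obj C" "Y \<in> Obj C" "f \<in> homs C X Y" "g \<in> homs C X Y"
    and "f \<oplus>\<^bsub>Hom C X Y\<^esub> g = \<zero>\<^bsub>Hom C X Y\<^esub>"
  shows "\<ominus>\<^bsub>Hom C X Y\<^esub> f = g"
proof -
  interpret H: abelian_group "Hom C X Y" using assms hom_abelian_group by blast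
  show ?thesis using assms by (metis H.a_comm H.minus_equality)
qed

lemma hom_neg_zero:
  "\<lbrakk>X \<in> Obj C; Y \<in> Obj C\<rbrakk> \<Longrightarrow> \<ominus>\<^bsub>Hom C X Y\<^esub> \<zero>\<^bsub>Hom C X Y\<^esub> = \<zero>\<^bsub>Hom C X Y\<^esub>"
  by (intro hom_neg_unique) (simp_all add: hom_zero_closed hom_add_zero)

lemma comp_neg_right:
  assumes "X \<in> Obj C" "Y \<in> Obj C" "Z \<in> Obj C" "f \<in> homs C X Y" "g \<in> homs C Y Z"
  shows "g \<cdot>\<^bsub>C\<^esub> (\<ominus>\<^bsub>Hom C X Y\<^esub> f) = \<ominus>\<^bsub>Hom C X Z\<^esub> (g \<cdot>\<^bsub>C\<^esub> f)"
proof -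
  note n = hom_neg_closed[OF assms(1,2,4)]
  have "(g \<cdot>\<^bsub>C\<^esub> f) \<oplus>\<^bsub>Hom C X Z\<^esub> (g \<cdot>\<^bsub>C\<^esub> (\<ominus>\<^bsub>Hom C X Y\<^esub> f)) = \<zero>\<^bsub>Hom C X Z\<^esub>"
    using comp_add_right[OF assms(1-3,4) n assms(5)] hom_add_neg[OF assms(1,2,4)]
      comp_zero_right[OF assms(1-3,5)] by simp
  then show ?thesis
    using hom_neg_unique[OF assms(1,3) comp_closed[OF assms(1-5)] comp_closed[OF assms(1-3) n assms(5)]]
    by simp
qed

lemma comp_neg_left:
  assumes "X \<in> Obj C" "Y \<in> Obj C" "Z \<in> Obj C" "f \<in> homs C X Y" "g \<in> homs C Y Z"
  shows "(\<ominus>\<^bsub>Hom C Y Z\<^esub> g) \<cdot>\<^bsub>C\<^esub> f = \<ominus>\<^bsub>Hom C X Z\<^esub> (g \<cdot>\<^bsub>C\<^esub> f)"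
proof -
  note n = hom_neg_closed[OF assms(2,3,5)]
  have "(g \<cdot>\<^bsub>C\<^esub> f) \<oplus>\<^bsub>Hom C X Z\<^esub> ((\<ominus>\<^bsub>Hom C Y Z\<^esub> g) \<cdot>\<^bsub>C\<^esub> f) = \<zero>\<^bsub>Hom C X Z\<^esub>"
    using comp_add_left[OF assms(1-5) n] hom_add_neg[OF assms(2,3,5)]
      comp_zero_left[OF assms(1-4)] by simp
  then show ?thesis
    using hom_neg_unique[OF assms(1,3) comp_closed[OF assms(1-5)] comp_closed[OF assms(1-4) n]]
    by simp
qed

text \<open>
  Exactness of all \<open>Hom(T, -)\<close> at the middle object. The character functors built below turn it into
  exactness, and unlike being two consecutive arrows of a distinguished triangle it is stable under
  shifts and indifferent to signs.
\<close>

definition hom_exact :: "'o \<Rightarrow> 'o \<Rightarrow> 'o \<Rightarrow> 'm \<Rightarrow> 'm \<Rightarrow> bool" where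
  "hom_exact X Y Z f g \<longleftrightarrow> X \<in> Obj C \<and> Y \<in> Obj C \<and> Z \<in> Obj C \<and>
     f \<in> homs C X Y \<and> g \<in> homs C Y Z \<and> g \<cdot>\<^bsub>C\<^esub> f = \<zero>\<^bsub>Hom C X Z\<^esub> \<and>
     (\<forall>T\<in>Obj C. \<forall>y\<in>homs C T Y. g \<cdot>\<^bsub>C\<^esub> y = \<zero>\<^bsub>Hom C T Z\<^esub> \<longrightarrow> (\<exists>x\<in>homs C T X. y = f \<cdot>\<^bsub>C\<^esub> x))"

lemma hom_exact_neg_right:
  assumes "hom_exact X Y Z f (\<ominus>\<^bsub>Hom C Y Z\<^esub> g)" "g \<in> homs C Y Z"
  shows "hom_exact X Y Z f g"
proof -
  have obj: "X \<in> Obj C" "Y \<in> Obj C" "Z \<in> Obj C" "f \<in> homs C X Y"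
    using assms by (simp_all add: hom_exact_def)
  have "(\<ominus>\<^bsub>Hom C Y Z\<^esub> g) \<cdot>\<^bsub>C\<^esub> y = \<zero>\<^bsub>Hom C T Z\<^esub> \<longleftrightarrow> g \<cdot>\<^bsub>C\<^esub> y = \<zero>\<^bsub>Hom C T Z\<^esub>"
    if "T \<in> Obj C" "y \<in> homs C T Y" for T y
  proof -
    have gy: "g \<cdot>\<^bsub>C\<^esub> y \<in> homs C T Z" using that obj assms(2) comp_closed by blast
    show ?thesis
      unfolding comp_neg_left[OF that(1) obj(2,3) that(2) assms(2)]
      using hom_neg_neg[OF that(1) obj(3) gy] hom_neg_zero[OF that(1) obj(3)] by metis
  qed
  then show ?thesis using assms obj by (simp add: hom_exact_def)
qed

end

context linear_category_with_shift
begin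

lemma ShO_inverse:
  assumes "X \<in> Obj C"
  shows "ShO C n (ShO C (- n) X) = X" "ShO C (- n) (ShO C n X) = X"
  using assms by (metis ShO_add ShO_zero add.right_inverse add.left_inverse)+

lemma ShA_inverse:
  assumes "X \<in> Obj C" "Y \<in> Obj C" "f \<in> homs C X Y"
  shows "ShA C n (ShA C (- n) f) = f" "ShA C (- n) (ShA C n f) = f"
  using assms by (metis ShA_add ShA_zero add.right_inverse add.left_inverse)+

lemma ShA_hom_zero:
  assumes "X \<in> Obj C" "Y \<in> Obj C"
  shows "ShA C n \<zero>\<^bsub>Hom C X Y\<^esub> = \<zero>\<^bsub>Hom C (ShO C n X) (ShO C n Y)\<^esub>"
proof -
  note z = hom_zero_closed[OF assms]
  show ?thesis
    using ShA_plus[OF assms z z, of n] hom_add_zero(1)[OF assms z]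
    by (intro hom_eq_zero_if_idem ShO_closed ShA_closed[OF assms z] assms) simp
qed

lemma ShA_neg:
  assumes "X \<in> Obj C" "Y \<in> Obj C" "f \<in> homs C X Y"
  shows "ShA C n (\<ominus>\<^bsub>Hom C X Y\<^esub> f) = \<ominus>\<^bsub>Hom C (ShO C n X) (ShO C n Y)\<^esub> ShA C n f"
proof -
  note n = hom_neg_closed[OF assms]
  have "ShA C n f \<oplus>\<^bsub>Hom C (ShO C n X) (ShO C n Y)\<^esub> ShA C n (\<ominus>\<^bsub>Hom C X Y\<^esub> f)
      = \<zero>\<^bsub>Hom C (ShO C n X) (ShO C n Y)\<^esub>"
    using ShA_plus[OF assms n, of n] hom_add_neg[OF assms] ShA_hom_zero[OF assms(1,2)] by simp
  then show ?thesis
    using hom_neg_unique[OF ShO_closed[OF assms(1)] ShO_closed[OF assms(2)]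
        ShA_closed[OF assms] ShA_closed[OF assms(1,2) n]] by simp
qed

lemma ShA_surj:
  assumes "X \<in> Obj C" "Y \<in> Obj C" "f \<in> homs C (ShO C n X) (ShO C n Y)"
  obtains f' where "f' \<in> homs C X Y" "f = ShA C n f'"
proof
  show "ShA C (- n) f \<in> homs C X Y"
    using ShA_closed[OF _ _ assms(3), of "- n"] assms(1,2) by (simp add: ShO_closed ShO_inverse)
  show "f = ShA C n (ShA C (- n) f)"
    using ShA_inverse(1)[OF _ _ assms(3), of n] assms(1,2) by (simp add: ShO_closed)
qed

lemma hom_exact_shift:
  assumes "hom_exact X Y Z f g"
  shows "hom_exact (ShO C n X) (ShO C n Y) (ShO C n Z) (ShA C n f) (ShA C n g)"
proof -
  have obj: "X \<in> Obj C" "Y \<in> Obj C" "Z \<in> Obj C" and f: "f \<in> homs C X Y" and g: "g \<in> homs C Y Z"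
    and gf: "g \<cdot>\<^bsub>C\<^esub> f = \<zero>\<^bsub>Hom C X Z\<^esub>"
    and ex: "\<And>T y. \<lbrakk>T \<in> Obj C; y \<in> homs C T Y; g \<cdot>\<^bsub>C\<^esub> y = \<zero>\<^bsub>Hom C T Z\<^esub>\<rbrakk>
      \<Longrightarrow> \<exists>x\<in>homs C T X. y = f \<cdot>\<^bsub>C\<^esub> x"
    using assms by (auto simp: hom_exact_def)
  have comp0: "ShA C n g \<cdot>\<^bsub>C\<^esub> ShA C n f = \<zero>\<^bsub>Hom C (ShO C n X) (ShO C n Z)\<^esub>"
    using ShA_comp[OF obj f g] gf ShA_hom_zero obj by metis
  have lift: "\<exists>x\<in>homs C T (ShO C n X). y = ShA C n f \<cdot>\<^bsub>C\<^esub> x"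
    if T: "T \<in> Obj C" and y: "y \<in> homs C T (ShO C n Y)"
      and gy: "ShA C n g \<cdot>\<^bsub>C\<^esub> y = \<zero>\<^bsub>Hom C T (ShO C n Z)\<^esub>" for T y
  proof -
    define T' where "T' = ShO C (- n) T"
    have T': "T' \<in> Obj C" "T = ShO C n T'" using T by (simp_all add: T'_def ShO_closed ShO_inverse)
    obtain y' where y': "y' \<in> homs C T' Y" "y = ShA C n y'"
      using ShA_surj y T' obj by metis
    have gy': "g \<cdot>\<^bsub>C\<^esub> y' \<in> homs C T' Z" using y' T' obj g comp_closed by blast
    have "ShA C n (g \<cdot>\<^bsub>C\<^esub> y') = \<zero>\<^bsub>Hom C T (ShO C n Z)\<^esub>"
      using ShA_comp[OF T'(1) obj(2,3) y'(1) g] gy y' by simp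
    then have "ShA C n (g \<cdot>\<^bsub>C\<^esub> y') = ShA C n \<zero>\<^bsub>Hom C T' Z\<^esub>" using ShA_hom_zero T' obj by simp
    then have "g \<cdot>\<^bsub>C\<^esub> y' = \<zero>\<^bsub>Hom C T' Z\<^esub>"
      using ShA_inverse(2) gy' T' obj hom_zero_closed by metis
    then obtain x where "x \<in> homs C T' X" "y' = f \<cdot>\<^bsub>C\<^esub> x" using ex T' y' by blast
    then show ?thesis using ShA_comp[of T' X Y x f n] ShA_closed[of T' X x n] obj f T' y' by metis
  qed
  show ?thesis
    unfolding hom_exact_def using obj f g comp0 lift by (blast intro: ShO_closed ShA_closed)
qed

end

context linear_triangulated_category
begin

lemma dist_triangleD:
  assumes "dist_triangle C X Y Z f g h"
  shows "X \<in> Obj C" "Y \<in> Obj C" "Z \<in> Obj C" "ShO C 1 X \<in> Obj C"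
    and "f \<in> homs C X Y" "g \<in> homs C Y Z" "h \<in> homs C Z (ShO C 1 X)"
  using assms ShO_closed by (auto simp: dist_triangle_def triangle_def)

lemma rotate:
  assumes "dist_triangle C X Y Z f g h"
  shows "dist_triangle C Y Z (ShO C 1 X) g h (\<ominus>\<^bsub>Hom C (ShO C 1 X) (ShO C 1 Y)\<^esub> ShA C 1 f)"
  using assms TR2[of X Y Z f g h] unfolding dist_triangle_def by blast

lemma rotate_back:
  assumes "dist_triangle C Y Z (ShO C 1 X) g h (\<ominus>\<^bsub>Hom C (ShO C 1 X) (ShO C 1 Y)\<^esub> ShA C 1 f)"
    and "X \<in> Obj C" "f \<in> homs C X Y"
  shows "dist_triangle C X Y Z f g h"
proof -
  have "triangle C X Y Z f g h"
    using assms dist_triangleD[OF assms(1)] by (simp add: triangle_def)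
  then show ?thesis using TR2 assms(1) by blast
qed

lemma dist_triangle_comp_zero:
  assumes t: "dist_triangle C X Y Z f g h"
  shows "g \<cdot>\<^bsub>C\<^esub> f = \<zero>\<^bsub>Hom C X Z\<^esub>"
proof -
  note d = dist_triangleD[OF t]
  obtain O' where O': "is_zero_object C O'" using zero_object_exists by blast
  then have obj: "O' \<in> Obj C" by (simp add: is_zero_object_def)
  \<comment> \<open>Compare with the triangle \<open>X \<rightarrow> X \<rightarrow> 0\<close>: the composite \<open>g \<cdot> f\<close> passes through \<open>0\<close>.\<close>
  have "f \<cdot>\<^bsub>C\<^esub> Ident C X = f \<cdot>\<^bsub>C\<^esub> Ident C X" ..
  from TR3[OF TR1_ident[OF d(1) O'] t ident_closed[OF d(1)] d(5) this]
  obtain c where c: "c \<in> homs C O' Z" "c \<cdot>\<^bsub>C\<^esub> \<zero>\<^bsub>Hom C X O'\<^esub> = g \<cdot>\<^bsub>C\<^esub> f" by blast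
  then show ?thesis using comp_zero_right d obj by metis
qed

lemma dist_triangle_hom_exact:
  assumes t: "dist_triangle C X Y Z f g h"
  shows "hom_exact X Y Z f g"
proof -
  note d = dist_triangleD[OF t]
  have lift: "\<exists>x\<in>homs C T X. y = f \<cdot>\<^bsub>C\<^esub> x"
    if T: "T \<in> Obj C" and y: "y \<in> homs C T Y" and gy: "g \<cdot>\<^bsub>C\<^esub> y = \<zero>\<^bsub>Hom C T Z\<^esub>" for T y
  proof -
    obtain O' where O': "is_zero_object C O'" using zero_object_exists by blast
    then have obj: "O' \<in> Obj C" by (simp add: is_zero_object_def)
    have "\<zero>\<^bsub>Hom C O' Z\<^esub> \<cdot>\<^bsub>C\<^esub> \<zero>\<^bsub>Hom C T O'\<^esub> = g \<cdot>\<^bsub>C\<^esub> y"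
      using gy comp_zero_right T obj d hom_zero_closed by metis
    \<comment> \<open>Map the rotation of \<open>T \<rightarrow> T \<rightarrow> 0\<close> to the rotation of the given triangle.\<close>
    from TR3[OF rotate[OF TR1_ident[OF T O']] rotate[OF t] y hom_zero_closed[OF obj d(3)] this]
    obtain c where c: "c \<in> homs C (ShO C 1 T) (ShO C 1 X)"
      and eq: "ShA C 1 y \<cdot>\<^bsub>C\<^esub> (\<ominus>\<^bsub>Hom C (ShO C 1 T) (ShO C 1 T)\<^esub> ShA C 1 (Ident C T))
        = (\<ominus>\<^bsub>Hom C (ShO C 1 X) (ShO C 1 Y)\<^esub> ShA C 1 f) \<cdot>\<^bsub>C\<^esub> c"
      by blast
    obtain x where x: "x \<in> homs C T X" "c = ShA C 1 x" using ShA_surj c T d by metis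
    have sh: "ShO C 1 T \<in> Obj C" "ShO C 1 X \<in> Obj C" "ShO C 1 Y \<in> Obj C"
      "ShA C 1 y \<in> homs C (ShO C 1 T) (ShO C 1 Y)" "ShA C 1 f \<in> homs C (ShO C 1 X) (ShO C 1 Y)"
      using T d y by (auto intro: ShO_closed ShA_closed)
    have fx: "f \<cdot>\<^bsub>C\<^esub> x \<in> homs C T Y" using x d T comp_closed by blast
    have "\<ominus>\<^bsub>Hom C (ShO C 1 T) (ShO C 1 Y)\<^esub> ShA C 1 y
        = \<ominus>\<^bsub>Hom C (ShO C 1 T) (ShO C 1 Y)\<^esub> ShA C 1 (f \<cdot>\<^bsub>C\<^esub> x)"
    proof -
      have "ShA C 1 y \<cdot>\<^bsub>C\<^esub> (\<ominus>\<^bsub>Hom C (ShO C 1 T) (ShO C 1 T)\<^esub> ShA C 1 (Ident C T))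
        = \<ominus>\<^bsub>Hom C (ShO C 1 T) (ShO C 1 Y)\<^esub> ShA C 1 y"
        using sh T by (simp add: ShA_ident comp_neg_right ident_closed comp_ident_right)
      moreover have "(\<ominus>\<^bsub>Hom C (ShO C 1 X) (ShO C 1 Y)\<^esub> ShA C 1 f) \<cdot>\<^bsub>C\<^esub> c
        = \<ominus>\<^bsub>Hom C (ShO C 1 T) (ShO C 1 Y)\<^esub> ShA C 1 (f \<cdot>\<^bsub>C\<^esub> x)"
        using comp_neg_left[OF sh(1,2,3) c sh(5)] x ShA_comp[OF T d(1,2) x(1) d(5)] by simp
      ultimately show ?thesis using eq by simp
    qed
    then have "ShA C 1 y = ShA C 1 (f \<cdot>\<^bsub>C\<^esub> x)"
      using hom_neg_neg[OF sh(1,3)] sh(4) ShA_closed[OF T d(2) fx, of 1] by metis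
    then have "y = f \<cdot>\<^bsub>C\<^esub> x" using ShA_inverse(2) T d y fx by metis
    then show ?thesis using x by blast
  qed
  then show ?thesis using d dist_triangle_comp_zero[OF t] by (auto simp: hom_exact_def)
qed

text \<open>
  The other variance: \<open>Hom(-, V)\<close> is exact at \<open>Y\<close>. The fill-in axiom supplies only a third map, so
  the triangle to compare with has to end in \<open>V = V\<close>.
\<close>

lemma dist_triangle_extend:
  assumes t: "dist_triangle C X Y Z f g h" and V: "V \<in> Obj C" and v: "v \<in> homs C Y V"
    and vf: "v \<cdot>\<^bsub>C\<^esub> f = \<zero>\<^bsub>Hom C X V\<^esub>"
  obtains s where "s \<in> homs C Z V" "v = s \<cdot>\<^bsub>C\<^esub> g"
proof -
  note d = dist_triangleD[OF t]
  obtain O' where O': "is_zero_object C O'" using zero_object_exists by blast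
  then have "O' \<in> Obj C" by (simp add: is_zero_object_def)
  define W where "W = ShO C (- 1) O'"
  have W: "W \<in> Obj C" "ShO C 1 W = O'"
    using \<open>O' \<in> Obj C\<close> by (simp_all add: W_def ShO_closed ShO_inverse(1))
  \<comment> \<open>The triangle \<open>0 \<rightarrow> V \<rightarrow> V\<close>, obtained by rotating \<open>V \<rightarrow> V \<rightarrow> 0\<close> back.\<close>
  have "\<ominus>\<^bsub>Hom C (ShO C 1 W) (ShO C 1 V)\<^esub> ShA C 1 \<zero>\<^bsub>Hom C W V\<^esub> = \<zero>\<^bsub>Hom C O' (ShO C 1 V)\<^esub>"
    using W V ShO_closed[OF V] \<open>O' \<in> Obj C\<close> by (simp add: ShA_hom_zero hom_neg_zero)
  then have "dist_triangle C V V (ShO C 1 W) (Ident C V) \<zero>\<^bsub>Hom C V O'\<^esub>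
      (\<ominus>\<^bsub>Hom C (ShO C 1 W) (ShO C 1 V)\<^esub> ShA C 1 \<zero>\<^bsub>Hom C W V\<^esub>)"
    using TR1_ident[OF V O'] W(2) by metis
  from rotate_back[OF this W(1) hom_zero_closed[OF W(1) V]]
  have t': "dist_triangle C W V V \<zero>\<^bsub>Hom C W V\<^esub> (Ident C V) \<zero>\<^bsub>Hom C V O'\<^esub>" .
  have "v \<cdot>\<^bsub>C\<^esub> f = \<zero>\<^bsub>Hom C W V\<^esub> \<cdot>\<^bsub>C\<^esub> \<zero>\<^bsub>Hom C X W\<^esub>"
    using vf comp_zero_right d V W hom_zero_closed by metis
  from TR3[OF t t' hom_zero_closed[OF d(1) W(1)] v this]
  obtain c where "c \<in> homs C Z V" "c \<cdot>\<^bsub>C\<^esub> g = Ident C V \<cdot>\<^bsub>C\<^esub> v" by blast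
  then show ?thesis using that comp_ident_left d V v by metis
qed

lemma dist_triangle_hom_exact_connecting:
  assumes t: "dist_triangle C X Y Z f g h"
  shows "hom_exact Z (ShO C 1 X) (ShO C 1 Y) h (ShA C 1 f)"
  using hom_exact_neg_right[OF dist_triangle_hom_exact[OF rotate[OF rotate[OF t]]]]
    ShA_closed dist_triangleD[OF t] by blast

text \<open>
  A cone completes a given first arrow and the fill-in axiom gives the third component of a morphism;
  the following lemmas move both to the other positions. Each rotation brings in a sign and a shift,
  and the signs are absorbed into the arrows that are to be found.
\<close>

lemma dist_triangle_with_second_arrow:
  assumes "Y \<in> Obj C" "Z \<in> Obj C" "g \<in> homs C Y Z"
  obtains X f h where "dist_triangle C X Y Z f g h"
proof -
  obtain V a b where t: "dist_triangle C Y Z V g a b" using TR1_cone assms by blast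
  note d = dist_triangleD[OF t]
  define X where "X = ShO C (- 1) V"
  have X: "X \<in> Obj C" "ShO C 1 X = V" using d by (simp_all add: X_def ShO_closed ShO_inverse)
  obtain f where f: "f \<in> homs C X Y" "b = ShA C 1 f" using ShA_surj d X by metis
  note nf = hom_neg_closed[OF X(1) d(1) f(1)]
  have "\<ominus>\<^bsub>Hom C (ShO C 1 X) (ShO C 1 Y)\<^esub> ShA C 1 (\<ominus>\<^bsub>Hom C X Y\<^esub> f) = b"
    using ShA_neg[OF X(1) d(1) nf, of 1] hom_neg_neg[OF X(1) d(1) f(1)] f(2) by simp
  then have "dist_triangle C Y Z (ShO C 1 X) g a
      (\<ominus>\<^bsub>Hom C (ShO C 1 X) (ShO C 1 Y)\<^esub> ShA C 1 (\<ominus>\<^bsub>Hom C X Y\<^esub> f))"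
    using t X(2) by simp
  from rotate_back[OF this X(1) nf] show ?thesis by (rule that)
qed

lemma dist_triangle_with_third_arrow:
  assumes "X \<in> Obj C" "Z \<in> Obj C" "h \<in> homs C Z (ShO C 1 X)"
  obtains Y f g where "dist_triangle C X Y Z f g h"
proof -
  obtain Y g k where t: "dist_triangle C Y Z (ShO C 1 X) g h k"
    using dist_triangle_with_second_arrow assms ShO_closed by metis
  note d = dist_triangleD[OF t]
  obtain f where f: "f \<in> homs C X Y" "k = ShA C 1 f" using ShA_surj d assms by metis
  note nf = hom_neg_closed[OF assms(1) d(1) f(1)]
  have "\<ominus>\<^bsub>Hom C (ShO C 1 X) (ShO C 1 Y)\<^esub> ShA C 1 (\<ominus>\<^bsub>Hom C X Y\<^esub> f) = k"
    using ShA_neg[OF assms(1) d(1) nf, of 1] hom_neg_neg[OF assms(1) d(1) f(1)] f(2) by simp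
  then have "dist_triangle C Y Z (ShO C 1 X) g h
      (\<ominus>\<^bsub>Hom C (ShO C 1 X) (ShO C 1 Y)\<^esub> ShA C 1 (\<ominus>\<^bsub>Hom C X Y\<^esub> f))"
    using t by simp
  from rotate_back[OF this assms(1) nf] show ?thesis by (rule that)
qed

lemma ShA_eqD:
  assumes "X \<in> Obj C" "Y \<in> Obj C" "f \<in> homs C X Y" "g \<in> homs C X Y" "ShA C n f = ShA C n g"
  shows "f = g"
  using ShA_inverse(2)[OF assms(1,2,3)] ShA_inverse(2)[OF assms(1,2,4)] assms(5) by metis

lemma hom_neg_eqD:
  assumes "X \<in> Obj C" "Y \<in> Obj C" "f \<in> homs C X Y" "g \<in> homs C X Y"
    and "\<ominus>\<^bsub>Hom C X Y\<^esub> f = \<ominus>\<^bsub>Hom C X Y\<^esub> g"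
  shows "f = g"
  using hom_neg_neg[OF assms(1,2,3)] hom_neg_neg[OF assms(1,2,4)] assms(5) by metis

lemma dist_triangle_middle_map:
  assumes t: "dist_triangle C X Y Z f g h" and t': "dist_triangle C X' Y' Z' f' g' h'"
    and a: "a \<in> homs C X X'" and c: "c \<in> homs C Z Z'" and ac: "ShA C 1 a \<cdot>\<^bsub>C\<^esub> h = h' \<cdot>\<^bsub>C\<^esub> c"
  obtains b where "b \<in> homs C Y Y'" "b \<cdot>\<^bsub>C\<^esub> f = f' \<cdot>\<^bsub>C\<^esub> a" "c \<cdot>\<^bsub>C\<^esub> g = g' \<cdot>\<^bsub>C\<^esub> b"
proof -
  note d = dist_triangleD[OF t] and d' = dist_triangleD[OF t']
  note sX = ShO_closed[OF d(1), of 1] and sY = ShO_closed[OF d(2), of 1]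
    and sZ = ShO_closed[OF d(3), of 1] and sX' = ShO_closed[OF d'(1), of 1]
    and sY' = ShO_closed[OF d'(2), of 1] and sZ' = ShO_closed[OF d'(3), of 1]
  note sa = ShA_closed[OF d(1) d'(1) a, of 1] and sc = ShA_closed[OF d(3) d'(3) c, of 1]
    and sf = ShA_closed[OF d(1,2,5), of 1] and sg = ShA_closed[OF d(2,3,6), of 1]
    and sf' = ShA_closed[OF d'(1,2,5), of 1] and sg' = ShA_closed[OF d'(2,3,6), of 1]
  from TR3[OF rotate[OF rotate[OF t]] rotate[OF rotate[OF t']] c sa ac]
  obtain k where k: "k \<in> homs C (ShO C 1 Y) (ShO C 1 Y')"
    and k1: "k \<cdot>\<^bsub>C\<^esub> (\<ominus>\<^bsub>Hom C (ShO C 1 X) (ShO C 1 Y)\<^esub> ShA C 1 f)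
      = (\<ominus>\<^bsub>Hom C (ShO C 1 X') (ShO C 1 Y')\<^esub> ShA C 1 f') \<cdot>\<^bsub>C\<^esub> ShA C 1 a"
    and k2: "ShA C 1 c \<cdot>\<^bsub>C\<^esub> (\<ominus>\<^bsub>Hom C (ShO C 1 Y) (ShO C 1 Z)\<^esub> ShA C 1 g)
      = (\<ominus>\<^bsub>Hom C (ShO C 1 Y') (ShO C 1 Z')\<^esub> ShA C 1 g') \<cdot>\<^bsub>C\<^esub> k"
    by blast
  obtain b where b: "b \<in> homs C Y Y'" "k = ShA C 1 b" using ShA_surj[OF d(2) d'(2) k] by metis
  note k1 = k1[unfolded comp_neg_right[OF sX sY sY' sf k] comp_neg_left[OF sX sX' sY' sa sf']]
    and k2 = k2[unfolded comp_neg_right[OF sY sZ sZ' sg sc] comp_neg_left[OF sY sY' sZ' k sg']]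
  have "ShA C 1 (b \<cdot>\<^bsub>C\<^esub> f) = ShA C 1 (f' \<cdot>\<^bsub>C\<^esub> a)"
    using hom_neg_eqD[OF sX sY' comp_closed[OF sX sY sY' sf k] comp_closed[OF sX sX' sY' sa sf'] k1]
      ShA_comp[OF d(1,2) d'(2) d(5) b(1)] ShA_comp[OF d(1) d'(1,2) a d'(5)] b(2) by simp
  then have "b \<cdot>\<^bsub>C\<^esub> f = f' \<cdot>\<^bsub>C\<^esub> a"
    using ShA_eqD[OF d(1) d'(2) comp_closed[OF d(1,2) d'(2) d(5) b(1)]
        comp_closed[OF d(1) d'(1,2) a d'(5)]] by blast
  moreover have "ShA C 1 (c \<cdot>\<^bsub>C\<^esub> g) = ShA C 1 (g' \<cdot>\<^bsub>C\<^esub> b)"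
    using hom_neg_eqD[OF sY sZ' comp_closed[OF sY sZ sZ' sg sc] comp_closed[OF sY sY' sZ' k sg'] k2]
      ShA_comp[OF d(2,3) d'(3) d(6) c] ShA_comp[OF d(2) d'(2,3) b(1) d'(6)] b(2) by simp
  then have "c \<cdot>\<^bsub>C\<^esub> g = g' \<cdot>\<^bsub>C\<^esub> b"
    using ShA_eqD[OF d(2) d'(3) comp_closed[OF d(2,3) d'(3) d(6) c]
        comp_closed[OF d(2) d'(2,3) b(1) d'(6)]] by blast
  ultimately show ?thesis using that b(1) by blast
qed

text \<open>The obstruction to extending \<open>v\<close> along \<open>f\<close> is the composite of \<open>v\<close> with the fibre of \<open>f\<close>, which is
  \<open>h[-1]\<close> up to sign; shifting by one avoids naming it.\<close>

lemma dist_triangle_extend_first: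
  assumes t: "dist_triangle C X Y Z f g h" and V: "V \<in> Obj C" and v: "v \<in> homs C X V"
    and vh: "ShA C 1 v \<cdot>\<^bsub>C\<^esub> h = \<zero>\<^bsub>Hom C Z (ShO C 1 V)\<^esub>"
  obtains s where "s \<in> homs C Y V" "v = s \<cdot>\<^bsub>C\<^esub> f"
proof -
  note d = dist_triangleD[OF t]
  note sX = ShO_closed[OF d(1), of 1] and sY = ShO_closed[OF d(2), of 1] and sV = ShO_closed[OF V, of 1]
  note sv = ShA_closed[OF d(1) V v, of 1] and sf = ShA_closed[OF d(1,2,5), of 1]
  obtain k where k: "k \<in> homs C (ShO C 1 Y) (ShO C 1 V)"
    "ShA C 1 v = k \<cdot>\<^bsub>C\<^esub> (\<ominus>\<^bsub>Hom C (ShO C 1 X) (ShO C 1 Y)\<^esub> ShA C 1 f)"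
    using dist_triangle_extend[OF rotate[OF rotate[OF t]] sV sv vh] by metis
  obtain s where s: "s \<in> homs C Y V" "k = ShA C 1 s" using ShA_surj[OF d(2) V k(1)] by metis
  note nf = hom_neg_closed[OF d(1,2,5)]
  have "ShA C 1 v = ShA C 1 (s \<cdot>\<^bsub>C\<^esub> (\<ominus>\<^bsub>Hom C X Y\<^esub> f))"
    using k(2) s(2) ShA_neg[OF d(1,2,5), of 1] ShA_comp[OF d(1,2) V nf s(1)] by simp
  then have "v = s \<cdot>\<^bsub>C\<^esub> (\<ominus>\<^bsub>Hom C X Y\<^esub> f)"
    using ShA_eqD[OF d(1) V v comp_closed[OF d(1,2) V nf s(1)]] by blast
  then have "v = (\<ominus>\<^bsub>Hom C Y V\<^esub> s) \<cdot>\<^bsub>C\<^esub> f"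
    using comp_neg_right[OF d(1,2) V d(5) s(1)] comp_neg_left[OF d(1,2) V d(5) s(1)] by simp
  then show ?thesis using that hom_neg_closed[OF d(2) V s(1)] by blast
qed

end

section \<open>Arrows factoring through an extension-closed class\<close>

definition factors_through ::
    "('r, 'o, 'm, 'z) lin_cat_scheme \<Rightarrow> 'o set \<Rightarrow> 'o \<Rightarrow> 'o \<Rightarrow> 'm \<Rightarrow> bool" where
  "factors_through C E X Y u \<longleftrightarrow> (\<exists>e\<in>E. \<exists>a\<in>homs C X e. \<exists>b\<in>homs C e Y. u = b \<cdot>\<^bsub>C\<^esub> a)"

lemma (in linear_category) factors_through_closed:
  assumes "E \<subseteq> Obj C" "X \<in> Obj C" "Y \<in> Obj C" "factors_through C E X Y u"
  shows "u \<in> homs C X Y"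
  using assms comp_closed unfolding factors_through_def by blast

lemma (in linear_category) factors_through_comp:
  assumes E: "E \<subseteq> Obj C" and obj: "W \<in> Obj C" "X \<in> Obj C" "Y \<in> Obj C"
    and u: "factors_through C E X Y u" and w: "w \<in> homs C W X"
  shows "factors_through C E W Y (u \<cdot>\<^bsub>C\<^esub> w)"
proof -
  obtain e a b where e: "e \<in> E" "a \<in> homs C X e" "b \<in> homs C e Y" "u = b \<cdot>\<^bsub>C\<^esub> a"
    using u by (auto simp: factors_through_def)
  then have "e \<in> Obj C" using E by blast
  then have "u \<cdot>\<^bsub>C\<^esub> w = b \<cdot>\<^bsub>C\<^esub> (a \<cdot>\<^bsub>C\<^esub> w)" "a \<cdot>\<^bsub>C\<^esub> w \<in> homs C W e"
    using comp_assoc[of W X e Y w a b] comp_closed[of W X e w a] obj e w by simp_all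
  then show ?thesis using e by (auto simp: factors_through_def)
qed

lemma factors_through_ident_iff:
  assumes "karoubi_closed C E" "E \<subseteq> Obj C" "linear_category R C" "Y \<in> Obj C"
  shows "factors_through C E Y Y (Ident C Y) \<longleftrightarrow> Y \<in> E"
proof
  assume "factors_through C E Y Y (Ident C Y)"
  then obtain e where "e \<in> E" "is_retract C Y e"
    unfolding factors_through_def is_retract_def by metis
  then show "Y \<in> E" using assms by (auto simp: karoubi_closed_def)
next
  assume "Y \<in> E"
  moreover have "Ident C Y \<in> homs C Y Y" "Ident C Y \<cdot>\<^bsub>C\<^esub> Ident C Y = Ident C Y"
    using assms(3,4) linear_category.ident_closed linear_category.comp_ident_left by metis+
  ultimately show "factors_through C E Y Y (Ident C Y)" unfolding factors_through_def by metis
qed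

context linear_triangulated_category
begin

text \<open>
  Write \<open>I\<close> for the arrows that factor through \<open>E\<close>. In terms of functors: a map
  \<open>Hom(-, X) \<rightarrow> Hom(-, Y)/I\<close> that factors through the image of \<open>Hom(-, X) \<rightarrow> Hom(-, e)\<close> is zero.

  Let \<open>w\<close> be the fibre of \<open>h\<close> and \<open>u \<cdot> w = \<beta> \<cdot> \<alpha>\<close> with \<open>\<alpha> : W \<rightarrow> e'\<close>. Pushing the triangle
  \<open>W \<rightarrow> X \<rightarrow> e\<close> out along \<open>\<alpha>\<close> gives a triangle \<open>e' \<rightarrow> Q \<rightarrow> e\<close>, so \<open>Q\<close> is in \<open>E\<close>. The arrow \<open>\<beta>\<close>
  extends to \<open>Q\<close>, and what remains of \<open>u\<close> vanishes on \<open>W\<close>, hence passes through \<open>h\<close> and again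
  through \<open>Q\<close>.
\<close>

lemma factors_through_extension:
  assumes E: "E \<subseteq> Obj C" "extension_closed C E"
    and X: "X \<in> Obj C" and Y: "Y \<in> Obj C" and u: "u \<in> homs C X Y"
    and e: "e \<in> E" and h: "h \<in> homs C X e"
    and fib: "\<And>W w. \<lbrakk>W \<in> Obj C; w \<in> homs C W X; h \<cdot>\<^bsub>C\<^esub> w = \<zero>\<^bsub>Hom C W e\<^esub>\<rbrakk>
      \<Longrightarrow> factors_through C E W Y (u \<cdot>\<^bsub>C\<^esub> w)"
  shows "factors_through C E X Y u"
proof -
  have eO: "e \<in> Obj C" using E e by blast
  obtain W w \<delta> where t: "dist_triangle C W X e w h \<delta>"
    using dist_triangle_with_second_arrow[OF X eO h] by metis
  note d = dist_triangleD[OF t]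
  have "factors_through C E W Y (u \<cdot>\<^bsub>C\<^esub> w)"
    by (rule fib[OF d(1,5) dist_triangle_comp_zero[OF t]])
  then obtain e' \<alpha> \<beta> where e': "e' \<in> E" and \<alpha>: "\<alpha> \<in> homs C W e'" and \<beta>: "\<beta> \<in> homs C e' Y"
    and uw: "u \<cdot>\<^bsub>C\<^esub> w = \<beta> \<cdot>\<^bsub>C\<^esub> \<alpha>"
    unfolding factors_through_def by blast
  have eO': "e' \<in> Obj C" using E e' by blast
  note sW = ShO_closed[OF d(1), of 1] and sX = ShO_closed[OF X, of 1]
    and sY = ShO_closed[OF Y, of 1] and se' = ShO_closed[OF eO', of 1]
  note s\<alpha> = ShA_closed[OF d(1) eO' \<alpha>, of 1] and s\<beta> = ShA_closed[OF eO' Y \<beta>, of 1]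
    and sw = ShA_closed[OF d(1,2,5), of 1] and su = ShA_closed[OF X Y u, of 1]
  define \<kappa> where "\<kappa> = ShA C 1 \<alpha> \<cdot>\<^bsub>C\<^esub> \<delta>"
  have \<kappa>: "\<kappa> \<in> homs C e (ShO C 1 e')"
    unfolding \<kappa>_def by (rule comp_closed[OF eO sW se' d(7) s\<alpha>])
  obtain Q j q where t': "dist_triangle C e' Q e j q \<kappa>"
    using dist_triangle_with_third_arrow[OF eO' eO \<kappa>] by metis
  note d' = dist_triangleD[OF t']
  have "is_extension C Q e e'" using t' by (auto simp: is_extension_def)
  then have Q: "Q \<in> E" using E(2) e e' d'(2) unfolding extension_closed_def by blast
  have "ShA C 1 \<alpha> \<cdot>\<^bsub>C\<^esub> \<delta> = \<kappa> \<cdot>\<^bsub>C\<^esub> Ident C e"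
    using comp_ident_right[OF eO se' \<kappa>] by (simp add: \<kappa>_def)
  then obtain m where m: "m \<in> homs C X Q" "m \<cdot>\<^bsub>C\<^esub> w = j \<cdot>\<^bsub>C\<^esub> \<alpha>" "Ident C e \<cdot>\<^bsub>C\<^esub> h = q \<cdot>\<^bsub>C\<^esub> m"
    using dist_triangle_middle_map[OF t t' \<alpha> ident_closed[OF eO]] by metis
  have hqm: "h = q \<cdot>\<^bsub>C\<^esub> m" using m(3) comp_ident_left[OF X eO h] by simp

  have "ShA C 1 \<beta> \<cdot>\<^bsub>C\<^esub> \<kappa> = ShA C 1 u \<cdot>\<^bsub>C\<^esub> (ShA C 1 w \<cdot>\<^bsub>C\<^esub> \<delta>)"
    unfolding \<kappa>_def
    using comp_assoc[OF eO sW se' sY d(7) s\<alpha> s\<beta>] comp_assoc[OF eO sW sX sY d(7) sw su]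
      ShA_comp[OF d(1) eO' Y \<alpha> \<beta>, of 1] ShA_comp[OF d(1) X Y d(5) u, of 1] uw by simp
  also have "\<dots> = \<zero>\<^bsub>Hom C e (ShO C 1 Y)\<^esub>"
    using dist_triangle_hom_exact_connecting[OF t] comp_zero_right[OF eO sX sY su]
    by (simp add: hom_exact_def)
  finally obtain \<beta>' where \<beta>': "\<beta>' \<in> homs C Q Y" "\<beta> = \<beta>' \<cdot>\<^bsub>C\<^esub> j"
    using dist_triangle_extend_first[OF t' Y \<beta>] by metis

  note bm = comp_closed[OF X d'(2) Y m(1) \<beta>'(1)]
  note nbm = hom_neg_closed[OF X Y bm]
  note ubm = hom_add_closed[OF X Y u nbm]
  have "(\<beta>' \<cdot>\<^bsub>C\<^esub> m) \<cdot>\<^bsub>C\<^esub> w = u \<cdot>\<^bsub>C\<^esub> w"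
    using comp_assoc[OF d(1) X d'(2) Y d(5) m(1) \<beta>'(1)] m(2)
      comp_assoc[OF d(1) eO' d'(2) Y \<alpha> d'(5) \<beta>'(1)] \<beta>'(2) uw by simp
  then have "(u \<oplus>\<^bsub>Hom C X Y\<^esub> \<ominus>\<^bsub>Hom C X Y\<^esub> (\<beta>' \<cdot>\<^bsub>C\<^esub> m)) \<cdot>\<^bsub>C\<^esub> w = \<zero>\<^bsub>Hom C W Y\<^esub>"
    using comp_add_left[OF d(1) X Y d(5) u nbm] comp_neg_left[OF d(1) X Y d(5) bm]
      hom_add_neg[OF d(1) Y comp_closed[OF d(1) X Y d(5) u]] by simp
  then obtain s where s: "s \<in> homs C e Y"
    "u \<oplus>\<^bsub>Hom C X Y\<^esub> \<ominus>\<^bsub>Hom C X Y\<^esub> (\<beta>' \<cdot>\<^bsub>C\<^esub> m) = s \<cdot>\<^bsub>C\<^esub> h"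
    using dist_triangle_extend[OF t Y ubm] by metis

  note sq = comp_closed[OF d'(2) eO Y d'(6) s(1)]
  interpret H: abelian_group "Hom C X Y" by (rule hom_abelian_group[OF X Y])
  have "u = (s \<cdot>\<^bsub>C\<^esub> h) \<oplus>\<^bsub>Hom C X Y\<^esub> (\<beta>' \<cdot>\<^bsub>C\<^esub> m)"
    using s(2)[symmetric] u bm by (simp add: H.a_assoc H.l_neg)
  also have "\<dots> = ((s \<cdot>\<^bsub>C\<^esub> q) \<oplus>\<^bsub>Hom C Q Y\<^esub> \<beta>') \<cdot>\<^bsub>C\<^esub> m"
    using comp_add_left[OF X d'(2) Y m(1) sq \<beta>'(1)] comp_assoc[OF X d'(2) eO Y m(1) d'(6) s(1)] hqm
    by simp
  finally show ?thesis
    using Q m(1) hom_add_closed[OF d'(2) Y sq \<beta>'(1)] unfolding factors_through_def by blast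
qed

lemma factors_through_zero:
  assumes E: "E \<subseteq> Obj C" "extension_closed C E" and obj: "X \<in> Obj C" "Y \<in> Obj C"
  shows "factors_through C E X Y \<zero>\<^bsub>Hom C X Y\<^esub>"
proof -
  obtain Z where Z: "Z \<in> E" using E(2) by (auto simp: extension_closed_def)
  then have "Z \<in> Obj C" using E(1) by blast
  then show ?thesis
    using Z comp_zero_right[of X Z Y "\<zero>\<^bsub>Hom C Z Y\<^esub>"] hom_zero_closed obj
    unfolding factors_through_def by metis
qed

lemma factors_through_neg:
  assumes E: "E \<subseteq> Obj C" and obj: "X \<in> Obj C" "Y \<in> Obj C" and u: "factors_through C E X Y u"
  shows "factors_through C E X Y (\<ominus>\<^bsub>Hom C X Y\<^esub> u)"
proof -
  obtain e a b where e: "e \<in> E" "a \<in> homs C X e" "b \<in> homs C e Y" "u = b \<cdot>\<^bsub>C\<^esub> a"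
    using u by (auto simp: factors_through_def)
  then have eO: "e \<in> Obj C" using E by blast
  have "\<ominus>\<^bsub>Hom C X Y\<^esub> u = (\<ominus>\<^bsub>Hom C e Y\<^esub> b) \<cdot>\<^bsub>C\<^esub> a"
    using comp_neg_left[OF obj(1) eO obj(2) e(2,3)] e(4) by simp
  then show ?thesis using e hom_neg_closed[OF eO obj(2) e(3)] unfolding factors_through_def by blast
qed

text \<open>
  On the fibre of the first factor of \<open>u\<close> the sum \<open>u + v\<close> agrees with \<open>v\<close>, so the previous lemma
  takes the place of a direct sum of the two intermediate objects.
\<close>

lemma factors_through_add:
  assumes E: "E \<subseteq> Obj C" "extension_closed C E" and obj: "X \<in> Obj C" "Y \<in> Obj C"
    and u: "factors_through C E X Y u" and v: "factors_through C E X Y v"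
  shows "factors_through C E X Y (u \<oplus>\<^bsub>Hom C X Y\<^esub> v)"
proof -
  note uc = factors_through_closed[OF E(1) obj u] and vc = factors_through_closed[OF E(1) obj v]
  obtain e a b where e: "e \<in> E" "a \<in> homs C X e" "b \<in> homs C e Y" "u = b \<cdot>\<^bsub>C\<^esub> a"
    using u by (auto simp: factors_through_def)
  then have eO: "e \<in> Obj C" using E by blast
  have "factors_through C E W Y ((u \<oplus>\<^bsub>Hom C X Y\<^esub> v) \<cdot>\<^bsub>C\<^esub> w)"
    if W: "W \<in> Obj C" and w: "w \<in> homs C W X" and aw: "a \<cdot>\<^bsub>C\<^esub> w = \<zero>\<^bsub>Hom C W e\<^esub>" for W w
  proof -
    have "u \<cdot>\<^bsub>C\<^esub> w = \<zero>\<^bsub>Hom C W Y\<^esub>"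
      using comp_assoc[OF W obj(1) eO obj(2) w e(2,3)] aw e(4) comp_zero_right[OF W eO obj(2) e(3)]
      by simp
    then have "(u \<oplus>\<^bsub>Hom C X Y\<^esub> v) \<cdot>\<^bsub>C\<^esub> w = v \<cdot>\<^bsub>C\<^esub> w"
      using comp_add_left[OF W obj w uc vc] hom_add_zero(2)[OF W obj(2) comp_closed[OF W obj w vc]]
      by simp
    then show ?thesis using factors_through_comp[OF E(1) W obj v w] by simp
  qed
  then show ?thesis
    using factors_through_extension[OF E obj hom_add_closed[OF obj uc vc] e(1,2)] by blast
qed

end

section \<open>Injective functors and essential extensions\<close>

text \<open>
  An additive contravariant functor with values in subgroups of one abelian group \<open>'g\<close>, encoded by
  the set of the pairs \<open>(X, p)\<close> with \<open>p\<close> in the value at \<open>X\<close>. Its subfunctors are then subsets, and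
  Zorn's lemma applies to them directly.
\<close>

locale additive_functor = linear_category R C
  for R :: "('r, 'a) ring_scheme" (structure)
    and C :: "('r, 'o, 'm, 'z) lin_cat_scheme" (structure) +
  fixes P :: "('o \<times> 'g::ab_group_add) set"
    and act :: "'m \<Rightarrow> 'g \<Rightarrow> 'g"
  assumes P_obj: "(X, p) \<in> P \<Longrightarrow> X \<in> Obj C"
    and P_zero: "X \<in> Obj C \<Longrightarrow> (X, 0) \<in> P"
    and P_add: "\<lbrakk>(X, p) \<in> P; (X, q) \<in> P\<rbrakk> \<Longrightarrow> (X, p + q) \<in> P"
    and P_neg: "(X, p) \<in> P \<Longrightarrow> (X, - p) \<in> P"
    and P_act: "\<lbrakk>X \<in> Obj C; Y \<in> Obj C; f \<in> homs C X Y; (Y, p) \<in> P\<rbrakk> \<Longrightarrow> (X, act f p) \<in> P"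
    and act_ident: "(X, p) \<in> P \<Longrightarrow> act (Ident C X) p = p"
    and act_comp:
      "\<lbrakk>X \<in> Obj C; Y \<in> Obj C; Z \<in> Obj C; f \<in> homs C X Y; g \<in> homs C Y Z; (Z, p) \<in> P\<rbrakk>
        \<Longrightarrow> act (g \<cdot>\<^bsub>C\<^esub> f) p = act f (act g p)"
    and act_add:
      "\<lbrakk>X \<in> Obj C; Y \<in> Obj C; f \<in> homs C X Y; (Y, p) \<in> P; (Y, q) \<in> P\<rbrakk>
        \<Longrightarrow> act f (p + q) = act f p + act f q"
    and act_hom_add:
      "\<lbrakk>X \<in> Obj C; Y \<in> Obj C; f \<in> homs C X Y; g \<in> homs C X Y; (Y, p) \<in> P\<rbrakk>
        \<Longrightarrow> act (f \<oplus>\<^bsub>Hom C X Y\<^esub> g) p = act f p + act g p"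
begin

lemma act_zero:
  assumes "X \<in> Obj C" "Y \<in> Obj C" "f \<in> homs C X Y"
  shows "act f 0 = 0"
  using act_add[OF assms P_zero[OF assms(2)] P_zero[OF assms(2)]] by simp

lemma act_hom_zero:
  assumes "X \<in> Obj C" "(Y, p) \<in> P"
  shows "act \<zero>\<^bsub>Hom C X Y\<^esub> p = 0"
proof -
  note Y = P_obj[OF assms(2)]
  note z = hom_zero_closed[OF assms(1) Y]
  show ?thesis
    using act_hom_add[OF assms(1) Y z z assms(2)] hom_add_zero(1)[OF assms(1) Y z] by simp
qed

lemma act_hom_neg:
  assumes "X \<in> Obj C" "f \<in> homs C X Y" "(Y, p) \<in> P"
  shows "act (\<ominus>\<^bsub>Hom C X Y\<^esub> f) p = - act f p"
proof -
  note Y = P_obj[OF assms(3)]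
  have "act f p + act (\<ominus>\<^bsub>Hom C X Y\<^esub> f) p = 0"
    using act_hom_add[OF assms(1) Y assms(2) hom_neg_closed[OF assms(1) Y assms(2)] assms(3)]
      hom_add_neg[OF assms(1) Y assms(2)] act_hom_zero[OF assms(1,3)] by simp
  then show ?thesis by (metis neg_eq_iff_add_eq_0)
qed

definition subfunctor :: "('o \<times> 'g) set \<Rightarrow> bool" where
  "subfunctor A \<longleftrightarrow> A \<subseteq> P \<and> (\<forall>X\<in>Obj C. (X, 0) \<in> A) \<and>
     (\<forall>X p q. (X, p) \<in> A \<longrightarrow> (X, q) \<in> A \<longrightarrow> (X, p + q) \<in> A) \<and>
     (\<forall>X p. (X, p) \<in> A \<longrightarrow> (X, - p) \<in> A) \<and>
     (\<forall>X\<in>Obj C. \<forall>Y\<in>Obj C. \<forall>f\<in>homs C X Y. \<forall>p. (Y, p) \<in> A \<longrightarrow> (X, act f p) \<in> A)"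

lemma subfunctorD:
  assumes "subfunctor A"
  shows "(X, p) \<in> A \<Longrightarrow> (X, p) \<in> P"
    and "(X, p) \<in> A \<Longrightarrow> X \<in> Obj C"
    and "X \<in> Obj C \<Longrightarrow> (X, 0) \<in> A"
    and "\<lbrakk>(X, p) \<in> A; (X, q) \<in> A\<rbrakk> \<Longrightarrow> (X, p + q) \<in> A"
    and "(X, p) \<in> A \<Longrightarrow> (X, - p) \<in> A"
    and "\<lbrakk>(X, p) \<in> A; (X, q) \<in> A\<rbrakk> \<Longrightarrow> (X, p - q) \<in> A"
    and "\<lbrakk>X \<in> Obj C; Y \<in> Obj C; f \<in> homs C X Y; (Y, p) \<in> A\<rbrakk> \<Longrightarrow> (X, act f p) \<in> A"
proof -
  show "(X, p) \<in> A \<Longrightarrow> (X, p) \<in> P" using assms unfolding subfunctor_def by blast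
  then show "(X, p) \<in> A \<Longrightarrow> X \<in> Obj C" using P_obj by blast
  show "X \<in> Obj C \<Longrightarrow> (X, 0) \<in> A" using assms unfolding subfunctor_def by blast
  show add: "(X, p + q) \<in> A" if "(X, p) \<in> A" "(X, q) \<in> A" for p q
    using assms that unfolding subfunctor_def by blast
  show neg: "(X, - p) \<in> A" if "(X, p) \<in> A" for p using assms that unfolding subfunctor_def by blast
  show "\<lbrakk>(X, p) \<in> A; (X, q) \<in> A\<rbrakk> \<Longrightarrow> (X, p - q) \<in> A" using add[OF _ neg, of p q] by simp
  show "\<lbrakk>X \<in> Obj C; Y \<in> Obj C; f \<in> homs C X Y; (Y, p) \<in> A\<rbrakk> \<Longrightarrow> (X, act f p) \<in> A"
    using assms unfolding subfunctor_def by blast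
qed

lemma subfunctorI:
  assumes "\<And>X p. (X, p) \<in> A \<Longrightarrow> (X, p) \<in> P"
    and "\<And>X. X \<in> Obj C \<Longrightarrow> (X, 0) \<in> A"
    and "\<And>X p q. \<lbrakk>(X, p) \<in> A; (X, q) \<in> A\<rbrakk> \<Longrightarrow> (X, p + q) \<in> A"
    and "\<And>X p. (X, p) \<in> A \<Longrightarrow> (X, - p) \<in> A"
    and "\<And>X Y f p. \<lbrakk>X \<in> Obj C; Y \<in> Obj C; f \<in> homs C X Y; (Y, p) \<in> A\<rbrakk> \<Longrightarrow> (X, act f p) \<in> A"
  shows "subfunctor A"
  unfolding subfunctor_def using assms by auto

definition disjoint :: "('o \<times> 'g) set \<Rightarrow> ('o \<times> 'g) set \<Rightarrow> bool" where
  "disjoint A B \<longleftrightarrow> (\<forall>X p. (X, p) \<in> A \<longrightarrow> (X, p) \<in> B \<longrightarrow> p = 0)"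

definition maximal_disjoint :: "('o \<times> 'g) set \<Rightarrow> ('o \<times> 'g) set \<Rightarrow> bool" where
  "maximal_disjoint A B \<longleftrightarrow> subfunctor A \<and> disjoint A B \<and>
     (\<forall>A'. subfunctor A' \<longrightarrow> disjoint A' B \<longrightarrow> A \<subseteq> A' \<longrightarrow> A' = A)"

lemma maximal_disjoint_exists:
  assumes A: "subfunctor A" "disjoint A B"
  obtains A' where "A \<subseteq> A'" "maximal_disjoint A' B"
proof -
  define \<A> where "\<A> = {A'. subfunctor A' \<and> disjoint A' B \<and> A \<subseteq> A'}"
  have "\<exists>A'\<in>\<A>. \<forall>A''\<in>\<A>. A' \<subseteq> A'' \<longrightarrow> A'' = A'"
  proof (rule subset_Zorn_nonempty)
    show "\<A> \<noteq> {}" using A by (auto simp: \<A>_def)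
  next
    fix \<C> assume ne: "\<C> \<noteq> {}" and chain: "subset.chain \<A> \<C>"
    have sub: "subfunctor A'" and dis: "disjoint A' B" and sup: "A \<subseteq> A'" if "A' \<in> \<C>" for A'
      using chain that by (auto simp: subset_chain_def \<A>_def)
    have two: "\<exists>A'\<in>\<C>. p \<in> A' \<and> q \<in> A'" if pq: "p \<in> \<Union>\<C>" "q \<in> \<Union>\<C>" for p q
    proof -
      obtain A1 A2 where "A1 \<in> \<C>" "p \<in> A1" "A2 \<in> \<C>" "q \<in> A2" using pq by (elim UnionE)
      moreover from this have "A1 \<subseteq> A2 \<or> A2 \<subseteq> A1" using chain by (auto simp: subset_chain_def)
      ultimately show ?thesis by blast
    qed
    have "subfunctor (\<Union>\<C>)"
    proof (rule subfunctorI)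
      show "(X, p) \<in> P" if "(X, p) \<in> \<Union>\<C>" for X p using that subfunctorD(1)[OF sub] by blast
      show "(X, 0) \<in> \<Union>\<C>" if "X \<in> Obj C" for X using that ne subfunctorD(3)[OF sub] by blast
      show "(X, p + q) \<in> \<Union>\<C>" if "(X, p) \<in> \<Union>\<C>" "(X, q) \<in> \<Union>\<C>" for X p q
        using two[OF that] subfunctorD(4)[OF sub] by blast
      show "(X, - p) \<in> \<Union>\<C>" if "(X, p) \<in> \<Union>\<C>" for X p using that subfunctorD(5)[OF sub] by blast
      show "(X, act f p) \<in> \<Union>\<C>"
        if "X \<in> Obj C" "Y \<in> Obj C" "f \<in> homs C X Y" "(Y, p) \<in> \<Union>\<C>" for X Y f p
        using that(4) subfunctorD(7)[OF sub that(1-3)] by blast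
    qed
    moreover have "disjoint (\<Union>\<C>) B" using dis unfolding disjoint_def by blast
    moreover have "A \<subseteq> \<Union>\<C>" using sup ne by blast
    ultimately show "\<Union>\<C> \<in> \<A>" by (simp add: \<A>_def)
  qed
  then obtain A' where mem: "A' \<in> \<A>" and max: "\<forall>A''\<in>\<A>. A' \<subseteq> A'' \<longrightarrow> A'' = A'" by (rule bexE)
  have "A \<subseteq> A'" using mem by (simp add: \<A>_def)
  moreover have "maximal_disjoint A' B"
    unfolding maximal_disjoint_def
  proof (intro conjI allI impI)
    show "subfunctor A'" "disjoint A' B" using mem by (simp_all add: \<A>_def)
    fix A'' assume *: "subfunctor A''" "disjoint A'' B" "A' \<subseteq> A''"
    with \<open>A \<subseteq> A'\<close> have "A'' \<in> \<A>" by (auto simp: \<A>_def)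
    then show "A'' = A'" using max *(3) by simp
  qed
  ultimately show ?thesis by (rule that)
qed

lemma subfunctor_adjoin:
  assumes A: "subfunctor A" and p: "(X, p) \<in> P"
  shows "subfunctor {(W, a + act h p) | W a h. W \<in> Obj C \<and> (W, a) \<in> A \<and> h \<in> homs C W X}"
    (is "subfunctor ?A")
proof (rule subfunctorI)
  have X: "X \<in> Obj C" using p P_obj by blast
  show "(W, q) \<in> P" if "(W, q) \<in> ?A" for W q
    using that X p subfunctorD(1)[OF A] P_add P_act by blast
  show "(W, 0) \<in> ?A" if W: "W \<in> Obj C" for W
  proof -
    let ?z = "\<zero>\<^bsub>Hom C W X\<^esub>"
    have z: "?z \<in> homs C W X" using W X hom_zero_closed by blast
    have "0 = 0 + act ?z p" using act_hom_zero[OF W p] by simp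
    then show ?thesis using W z subfunctorD(3)[OF A W] by blast
  qed
  show "(W, q1 + q2) \<in> ?A" if q: "(W, q1) \<in> ?A" "(W, q2) \<in> ?A" for W q1 q2
  proof -
    obtain a1 h1 a2 h2 where
      h: "W \<in> Obj C" "(W, a1) \<in> A" "h1 \<in> homs C W X" "q1 = a1 + act h1 p"
      "(W, a2) \<in> A" "h2 \<in> homs C W X" "q2 = a2 + act h2 p" using q by blast
    have "q1 + q2 = (a1 + a2) + act (h1 \<oplus>\<^bsub>Hom C W X\<^esub> h2) p"
      using act_hom_add[OF h(1) X h(3,6) p] h(4,7) by simp
    then show ?thesis using h subfunctorD(4)[OF A] hom_add_closed[OF h(1) X h(3,6)] by blast
  qed
  show "(W, - q) \<in> ?A" if q: "(W, q) \<in> ?A" for W q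
  proof -
    obtain a h where h: "W \<in> Obj C" "(W, a) \<in> A" "h \<in> homs C W X" "q = a + act h p"
      using q by blast
    let ?n = "\<ominus>\<^bsub>Hom C W X\<^esub> h"
    have n: "?n \<in> homs C W X" using hom_neg_closed[OF h(1) X h(3)] .
    have "- q = - a + act ?n p" using h(4) act_hom_neg[OF h(1,3) p] by simp
    then show ?thesis using h(1,2) n subfunctorD(5)[OF A] by blast
  qed
  show "(V, act f q) \<in> ?A" if V: "V \<in> Obj C" "W \<in> Obj C" "f \<in> homs C V W" "(W, q) \<in> ?A" for V W f q
  proof -
    obtain a h where h: "(W, a) \<in> A" "h \<in> homs C W X" "q = a + act h p" using V by blast
    have "act f q = act f a + act (h \<cdot>\<^bsub>C\<^esub> f) p"
      using act_add[OF V(1-3) subfunctorD(1)[OF A h(1)] P_act[OF V(2) X h(2) p]]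
        act_comp[OF V(1,2) X V(3) h(2) p] h(3) by simp
    then show ?thesis
      using V(1) subfunctorD(7)[OF A V(1-3) h(1)] comp_closed[OF V(1,2) X V(3) h(2)] by blast
  qed
qed

text \<open>Adjoining \<open>p\<close> to a maximal \<open>A\<close> must create a nonzero element of \<open>B\<close>, and the adjoined elements
  are the \<open>a + p \<cdot> h\<close>.\<close>

lemma maximal_disjoint_meets:
  assumes A: "maximal_disjoint A B" and p: "(X, p) \<in> P" "(X, p) \<notin> A"
  obtains W a h where "W \<in> Obj C" "h \<in> homs C W X" "(W, a) \<in> A"
    "(W, a + act h p) \<in> B" "a + act h p \<noteq> 0"
proof -
  have sub: "subfunctor A" and max: "\<And>A'. \<lbrakk>subfunctor A'; disjoint A' B; A \<subseteq> A'\<rbrakk> \<Longrightarrow> A' = A"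
    using A by (auto simp: maximal_disjoint_def)
  have X: "X \<in> Obj C" using p P_obj by blast
  define A' where "A' = {(W, a + act h p) | W a h. W \<in> Obj C \<and> (W, a) \<in> A \<and> h \<in> homs C W X}"
  have sub': "subfunctor A'" unfolding A'_def by (rule subfunctor_adjoin[OF sub p(1)])
  have "(X, 0 + act (Ident C X) p) \<in> A'"
    unfolding A'_def using X subfunctorD(3)[OF sub X] ident_closed[OF X] by blast
  then have pA': "(X, p) \<in> A'" using act_ident[OF p(1)] by simp
  have "A \<subseteq> A'"
  proof (rule subrelI)
    fix W a assume a: "(W, a) \<in> A"
    then have W: "W \<in> Obj C" using subfunctorD(2)[OF sub] by blast
    have z: "\<zero>\<^bsub>Hom C W X\<^esub> \<in> homs C W X" using W X hom_zero_closed by blast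
    have "a = a + act \<zero>\<^bsub>Hom C W X\<^esub> p" using act_hom_zero[OF W p(1)] by simp
    then show "(W, a) \<in> A'" unfolding A'_def using W a z by blast
  qed
  then have "\<not> disjoint A' B" using max[OF sub'] pA' p(2) by blast
  then show ?thesis using that unfolding disjoint_def A'_def by blast
qed

definition natural :: "('o \<times> 'g) set \<Rightarrow> ('o \<Rightarrow> 'g \<Rightarrow> 'g) \<Rightarrow> bool" where
  "natural A \<phi> \<longleftrightarrow> (\<forall>X a. (X, a) \<in> A \<longrightarrow> (X, \<phi> X a) \<in> P) \<and>
     (\<forall>X a b. (X, a) \<in> A \<longrightarrow> (X, b) \<in> A \<longrightarrow> \<phi> X (a + b) = \<phi> X a + \<phi> X b) \<and>
     (\<forall>X\<in>Obj C. \<forall>Y\<in>Obj C. \<forall>f\<in>homs C X Y. \<forall>a. (Y, a) \<in> A \<longrightarrow> \<phi> X (act f a) = act f (\<phi> Y a))"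

lemma naturalD:
  assumes "natural A \<phi>"
  shows "(X, a) \<in> A \<Longrightarrow> (X, \<phi> X a) \<in> P"
    and "\<lbrakk>(X, a) \<in> A; (X, b) \<in> A\<rbrakk> \<Longrightarrow> \<phi> X (a + b) = \<phi> X a + \<phi> X b"
    and "\<lbrakk>X \<in> Obj C; Y \<in> Obj C; f \<in> homs C X Y; (Y, a) \<in> A\<rbrakk> \<Longrightarrow> \<phi> X (act f a) = act f (\<phi> Y a)"
  using assms unfolding natural_def by blast+

lemma subfunctor_range:
  assumes "natural P \<phi>"
  shows "subfunctor {(X, \<phi> X p) | X p. (X, p) \<in> P}" (is "subfunctor ?A")
proof (rule subfunctorI)
  note D = naturalD[OF assms]
  have zero: "\<phi> X 0 = 0" if "X \<in> Obj C" for X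
    using D(2)[OF P_zero P_zero, OF that that] by simp
  show "(X, p) \<in> P" if "(X, p) \<in> ?A" for X p using that D(1) by blast
  show "(X, 0) \<in> ?A" if "X \<in> Obj C" for X
    using P_zero[OF that] zero[OF that] by (metis (mono_tags, lifting) mem_Collect_eq)
  show "(X, p + q) \<in> ?A" if "(X, p) \<in> ?A" "(X, q) \<in> ?A" for X p q
  proof -
    obtain p' q' where "(X, p') \<in> P" "p = \<phi> X p'" "(X, q') \<in> P" "q = \<phi> X q'"
      using \<open>(X, p) \<in> ?A\<close> \<open>(X, q) \<in> ?A\<close> by blast
    then have "(X, p' + q') \<in> P" "p + q = \<phi> X (p' + q')" using P_add D(2) by simp_all
    then show ?thesis by blast
  qed
  show "(X, - p) \<in> ?A" if p: "(X, p) \<in> ?A" for X p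
  proof -
    obtain p' where p': "(X, p') \<in> P" "p = \<phi> X p'" using p by blast
    have "\<phi> X p' + \<phi> X (- p') = 0"
      using D(2)[OF p'(1) P_neg[OF p'(1)]] zero[OF P_obj[OF p'(1)]] by simp
    then have "- p = \<phi> X (- p')" using p'(2) by (metis neg_eq_iff_add_eq_0)
    then show ?thesis using P_neg[OF p'(1)] by blast
  qed
  show "(X, act f p) \<in> ?A"
    if f: "X \<in> Obj C" "Y \<in> Obj C" "f \<in> homs C X Y" and p: "(Y, p) \<in> ?A" for X Y f p
  proof -
    obtain p' where p': "(Y, p') \<in> P" "p = \<phi> Y p'" using p by blast
    then have "act f p = \<phi> X (act f p')" using D(3)[OF f p'(1)] by simp
    then show ?thesis using P_act[OF f p'(1)] by blast
  qed
qed

lemma natural_projection: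
  assumes K: "subfunctor K" and L: "subfunctor L" and dis: "disjoint K L"
  obtains A \<phi> where "subfunctor A" "K \<subseteq> A" "L \<subseteq> A" "natural A \<phi>"
    "\<And>X k. (X, k) \<in> K \<Longrightarrow> \<phi> X k = k" "\<And>X l. (X, l) \<in> L \<Longrightarrow> \<phi> X l = 0"
proof -
  define A where "A = {(X, k + l) | X k l. (X, k) \<in> K \<and> (X, l) \<in> L}"
  define \<phi> where "\<phi> X a = (THE k. (X, k) \<in> K \<and> (X, a - k) \<in> L)" for X a
  have \<phi>: "\<phi> X (k + l) = k" if kl: "(X, k) \<in> K" "(X, l) \<in> L" for X k l
    unfolding \<phi>_def
  proof (rule the_equality)
    show "(X, k) \<in> K \<and> (X, k + l - k) \<in> L" using kl by simp
    fix k' assume k': "(X, k') \<in> K \<and> (X, k + l - k') \<in> L"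
    then have "(X, k' - k) \<in> K" using subfunctorD(6)[OF K] kl by blast
    moreover have "(X, l - (k + l - k')) \<in> L" using subfunctorD(6)[OF L] kl k' by blast
    then have "(X, k' - k) \<in> L" by simp
    ultimately have "k' - k = 0" using dis unfolding disjoint_def by blast
    then show "k' = k" by simp
  qed
  have memE: "\<exists>k l. (X, k) \<in> K \<and> (X, l) \<in> L \<and> a = k + l" if "(X, a) \<in> A" for X a
    using that unfolding A_def by blast
  have add: "(X, k1 + l1 + (k2 + l2)) \<in> A \<and> \<phi> X (k1 + l1 + (k2 + l2)) = k1 + k2"
    if "(X, k1) \<in> K" "(X, l1) \<in> L" "(X, k2) \<in> K" "(X, l2) \<in> L" for X k1 l1 k2 l2
  proof -
    have eq: "k1 + l1 + (k2 + l2) = (k1 + k2) + (l1 + l2)" by simp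
    have "(X, k1 + k2) \<in> K" "(X, l1 + l2) \<in> L"
      using that subfunctorD(4)[OF K] subfunctorD(4)[OF L] by blast+
    then show ?thesis unfolding eq using \<phi> unfolding A_def by blast
  qed
  have act: "(X, act f (k + l)) \<in> A \<and> \<phi> X (act f (k + l)) = act f k"
    if f: "X \<in> Obj C" "Y \<in> Obj C" "f \<in> homs C X Y" and kl: "(Y, k) \<in> K" "(Y, l) \<in> L" for X Y f k l
  proof -
    have eq: "act f (k + l) = act f k + act f l"
      using act_add[OF f] subfunctorD(1)[OF K] subfunctorD(1)[OF L] kl by blast
    have "(X, act f k) \<in> K" "(X, act f l) \<in> L"
      using f kl subfunctorD(7)[OF K] subfunctorD(7)[OF L] by blast+
    then show ?thesis unfolding eq using \<phi> unfolding A_def by blast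
  qed
  have KA: "(X, k) \<in> A \<and> \<phi> X k = k" if k: "(X, k) \<in> K" for X k
  proof -
    have "(X, 0) \<in> L" using subfunctorD(2)[OF K k] subfunctorD(3)[OF L] by blast
    then have "(X, k + 0) \<in> A" "\<phi> X (k + 0) = k" using k \<phi> unfolding A_def by blast+
    then show ?thesis by simp
  qed
  have LA: "(X, l) \<in> A \<and> \<phi> X l = 0" if l: "(X, l) \<in> L" for X l
  proof -
    have "(X, 0) \<in> K" using subfunctorD(2)[OF L l] subfunctorD(3)[OF K] by blast
    then have "(X, 0 + l) \<in> A" "\<phi> X (0 + l) = 0" using l \<phi> unfolding A_def by blast+
    then show ?thesis by simp
  qed
  have "subfunctor A"
  proof (rule subfunctorI)
    show "(X, p) \<in> P" if "(X, p) \<in> A" for X p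
      using memE[OF that] P_add subfunctorD(1)[OF K] subfunctorD(1)[OF L] by blast
    show "(X, 0) \<in> A" if "X \<in> Obj C" for X using that KA subfunctorD(3)[OF K] by blast
    show "(X, p + q) \<in> A" if "(X, p) \<in> A" "(X, q) \<in> A" for X p q
      using memE[OF \<open>(X, p) \<in> A\<close>] memE[OF \<open>(X, q) \<in> A\<close>] add by blast
    show "(X, - p) \<in> A" if p: "(X, p) \<in> A" for X p
    proof -
      obtain k l where "(X, k) \<in> K" "(X, l) \<in> L" "p = k + l" using memE[OF p] by blast
      then have "(X, - k) \<in> K" "(X, - l) \<in> L" "- p = - k + - l"
        using subfunctorD(5)[OF K] subfunctorD(5)[OF L] by simp_all
      then show ?thesis unfolding A_def by blast
    qed
    show "(X, act f p) \<in> A"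
      if "X \<in> Obj C" "Y \<in> Obj C" "f \<in> homs C X Y" "(Y, p) \<in> A" for X Y f p
      using memE[OF that(4)] act[OF that(1-3)] by blast
  qed
  moreover have "natural A \<phi>"
    unfolding natural_def
  proof (intro conjI allI ballI impI)
    show "(X, \<phi> X a) \<in> P" if "(X, a) \<in> A" for X a
      using memE[OF that] \<phi> subfunctorD(1)[OF K] by metis
    show "\<phi> X (a + b) = \<phi> X a + \<phi> X b" if "(X, a) \<in> A" "(X, b) \<in> A" for X a b
      using memE[OF \<open>(X, a) \<in> A\<close>] memE[OF \<open>(X, b) \<in> A\<close>] add \<phi> by metis
    show "\<phi> X (act f a) = act f (\<phi> Y a)"
      if "X \<in> Obj C" "Y \<in> Obj C" "f \<in> homs C X Y" "(Y, a) \<in> A" for X Y f a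
      using memE[OF that(4)] act[OF that(1-3)] \<phi> by metis
  qed
  moreover have "K \<subseteq> A" "L \<subseteq> A" using KA LA by (auto intro!: subrelI)
  ultimately show ?thesis using that KA LA by blast
qed

end

locale injective_functor = additive_functor +
  assumes extend_natural:
    "\<lbrakk>subfunctor A; natural A \<phi>\<rbrakk> \<Longrightarrow> \<exists>\<Phi>. natural P \<Phi> \<and> (\<forall>X a. (X, a) \<in> A \<longrightarrow> \<Phi> X a = \<phi> X a)"
begin

text \<open>
  The injective hull of \<open>M\<close> as a direct summand of an injective functor. Choose \<open>L\<close> maximal with
  \<open>L \<inter> M = 0\<close> and \<open>K \<supseteq> M\<close> maximal with \<open>K \<inter> L = 0\<close>, and extend the projection \<open>K + L \<rightarrow> K\<close> to an
  endomorphism \<open>\<pi>\<close>. By maximality of \<open>L\<close>, an element outside \<open>L\<close> has a multiple in \<open>L + m\<close> with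
  \<open>m \<noteq> 0\<close> in \<open>M\<close>, which \<open>\<pi>\<close> sends to \<open>m\<close>. So the image of \<open>\<pi>\<close> still meets \<open>L\<close> only in zero, and
  maximality of \<open>K\<close> makes it equal to \<open>K\<close>.
\<close>

lemma essential_summand:
  assumes M: "subfunctor M"
  obtains K \<pi> where "subfunctor K" "M \<subseteq> K" "natural P \<pi>"
    "\<And>X p. (X, p) \<in> P \<Longrightarrow> (X, \<pi> X p) \<in> K" "\<And>X k. (X, k) \<in> K \<Longrightarrow> \<pi> X k = k"
    "\<And>X k. \<lbrakk>(X, k) \<in> K; k \<noteq> 0\<rbrakk>
      \<Longrightarrow> \<exists>W\<in>Obj C. \<exists>h\<in>homs C W X. (W, act h k) \<in> M \<and> act h k \<noteq> 0"
proof -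
  have zero_sub: "subfunctor {(X, 0) | X. X \<in> Obj C}"
  proof (rule subfunctorI)
    show "(X, act f p) \<in> {(X, 0) | X. X \<in> Obj C}"
      if "X \<in> Obj C" "Y \<in> Obj C" "f \<in> homs C X Y" "(Y, p) \<in> {(X, 0) | X. X \<in> Obj C}" for X Y f p
      using that act_zero[OF that(1-3)] by simp
  qed (auto intro: P_zero)
  moreover have "disjoint {(X, 0) | X. X \<in> Obj C} M" by (auto simp: disjoint_def)
  ultimately obtain L where L: "maximal_disjoint L M" using maximal_disjoint_exists by blast
  have subL: "subfunctor L" using L by (simp add: maximal_disjoint_def)
  have "disjoint M L" using L by (auto simp: maximal_disjoint_def disjoint_def)
  then obtain K where MK: "M \<subseteq> K" and K: "maximal_disjoint K L"
    using maximal_disjoint_exists[OF M] by blast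
  have subK: "subfunctor K" and KL: "disjoint K L" using K by (simp_all add: maximal_disjoint_def)
  obtain A \<phi> where A: "subfunctor A" "K \<subseteq> A" "L \<subseteq> A" "natural A \<phi>"
    and \<phi>: "\<And>X k. (X, k) \<in> K \<Longrightarrow> \<phi> X k = k" "\<And>X l. (X, l) \<in> L \<Longrightarrow> \<phi> X l = 0"
    by (rule natural_projection[OF subK subL KL]) (rule that)
  obtain \<pi> where \<pi>: "natural P \<pi>" "\<And>X a. (X, a) \<in> A \<Longrightarrow> \<pi> X a = \<phi> X a"
    using extend_natural[OF A(1,4)] by blast
  have \<pi>K: "\<pi> X k = k" if "(X, k) \<in> K" for X k using that A(2) \<pi>(2) \<phi>(1) by auto
  have \<pi>L: "\<pi> X l = 0" if "(X, l) \<in> L" for X l using that A(3) \<pi>(2) \<phi>(2) by auto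
  note D = naturalD[OF \<pi>(1)]
  have multiple: "\<exists>W\<in>Obj C. \<exists>h\<in>homs C W X. (W, act h (\<pi> X p)) \<in> M \<and> act h (\<pi> X p) \<noteq> 0"
    if p: "(X, p) \<in> P" "(X, p) \<notin> L" for X p
  proof -
    have X: "X \<in> Obj C" using p P_obj by blast
    obtain W l h where h: "W \<in> Obj C" "h \<in> homs C W X" "(W, l) \<in> L"
      "(W, l + act h p) \<in> M" "l + act h p \<noteq> 0"
      by (rule maximal_disjoint_meets[OF L p])
    have "l + act h p = \<pi> W (l + act h p)" using \<pi>K h(4) MK by auto
    also have "\<dots> = \<pi> W l + \<pi> W (act h p)"
      by (rule D(2)[OF subfunctorD(1)[OF subL h(3)] P_act[OF h(1) X h(2) p(1)]])
    also have "\<dots> = act h (\<pi> X p)" using \<pi>L[OF h(3)] D(3)[OF h(1) X h(2) p(1)] by simp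
    finally show ?thesis using h by auto
  qed
  have range: "(X, \<pi> X p) \<in> K" if Xp: "(X, p) \<in> P" for X p
  proof -
    define K' where "K' = {(X, \<pi> X p) | X p. (X, p) \<in> P}"
    have "K \<subseteq> K'"
      unfolding K'_def using \<pi>K subfunctorD(1)[OF subK] by (force intro!: subrelI)
    moreover have "subfunctor K'" unfolding K'_def by (rule subfunctor_range[OF \<pi>(1)])
    moreover have "disjoint K' L"
      unfolding disjoint_def
    proof (intro allI impI, rule ccontr)
      fix X q assume q: "(X, q) \<in> K'" "(X, q) \<in> L" "q \<noteq> 0"
      obtain p where p: "(X, p) \<in> P" "q = \<pi> X p" using q(1) unfolding K'_def by blast
      then have "(X, p) \<notin> L" using \<pi>L q(3) by blast
      then obtain W h where h: "W \<in> Obj C" "h \<in> homs C W X" "(W, act h q) \<in> M" "act h q \<noteq> 0"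
        using multiple p by blast
      moreover have "(W, act h q) \<in> L" using subfunctorD(7)[OF subL h(1) P_obj[OF p(1)] h(2) q(2)] .
      ultimately show False using L by (auto simp: maximal_disjoint_def disjoint_def)
    qed
    ultimately have "K' = K" using K by (simp add: maximal_disjoint_def)
    then show ?thesis using Xp unfolding K'_def by blast
  qed
  have "\<exists>W\<in>Obj C. \<exists>h\<in>homs C W X. (W, act h k) \<in> M \<and> act h k \<noteq> 0" if k: "(X, k) \<in> K" "k \<noteq> 0" for X k
  proof -
    have "(X, k) \<notin> L" using k KL by (auto simp: disjoint_def)
    then show ?thesis using multiple[OF subfunctorD(1)[OF subK k(1)]] \<pi>K[OF k(1)] by simp
  qed
  then show ?thesis using that[OF subK MK \<pi>(1) range \<pi>K] by blast
qed

end

section \<open>Products of character groups\<close>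

context linear_category
begin

definition span_pair :: "'o \<Rightarrow> 'm \<Rightarrow> 'm \<Rightarrow> bool" where
  "span_pair X u w \<longleftrightarrow> (\<exists>Z\<in>Obj C. (\<exists>Y\<in>Obj C. u \<in> homs C Z Y) \<and> w \<in> homs C Z X)"

lemma span_pair_iff:
  assumes "Z \<in> Obj C" "Y \<in> Obj C" "X \<in> Obj C" "u \<in> homs C Z Y"
  shows "span_pair X u w \<longleftrightarrow> w \<in> homs C Z X"
  unfolding span_pair_def using assms hom_disjoint by metis

text \<open>
  The functor \<open>X \<mapsto> \<Prod>\<^sub>u Hom(Hom(Z, X), \<real>/\<int>)\<close>, where \<open>u\<close> runs over all arrows and \<open>Z\<close> is the
  source of \<open>u\<close>. The families are extended by zero so that equality of families is equality of
  functions.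
\<close>

definition char_prod :: "('o \<times> ('m \<Rightarrow> 'm \<Rightarrow> circle)) set" where
  "char_prod = {(X, p). X \<in> Obj C \<and>
     (\<forall>Z\<in>Obj C. \<forall>Y\<in>Obj C. \<forall>u\<in>homs C Z Y. p u \<in> characters (Hom C Z X)) \<and>
     (\<forall>u w. \<not> span_pair X u w \<longrightarrow> p u w = 0)}"

definition char_act :: "'m \<Rightarrow> ('m \<Rightarrow> 'm \<Rightarrow> circle) \<Rightarrow> 'm \<Rightarrow> 'm \<Rightarrow> circle" where
  "char_act f p u w =
     (if \<exists>X\<in>Obj C. \<exists>Y\<in>Obj C. f \<in> homs C X Y \<and> span_pair X u w then p u (f \<cdot>\<^bsub>C\<^esub> w) else 0)"

lemma char_act_apply:
  assumes "X \<in> Obj C" "Y \<in> Obj C" "f \<in> homs C X Y"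
  shows "char_act f p u w = (if span_pair X u w then p u (f \<cdot>\<^bsub>C\<^esub> w) else 0)"
  unfolding char_act_def using assms hom_disjoint by metis

lemma char_prodD:
  assumes "(X, p) \<in> char_prod"
  shows "X \<in> Obj C"
    and "\<lbrakk>Z \<in> Obj C; Y \<in> Obj C; u \<in> homs C Z Y\<rbrakk> \<Longrightarrow> p u \<in> characters (Hom C Z X)"
    and "\<not> span_pair X u w \<Longrightarrow> p u w = 0"
  using assms by (auto simp: char_prod_def)

lemma char_prodI:
  assumes "X \<in> Obj C"
    and "\<And>Z Y u v w. \<lbrakk>Z \<in> Obj C; Y \<in> Obj C; u \<in> homs C Z Y; v \<in> homs C Z X; w \<in> homs C Z X\<rbrakk>
      \<Longrightarrow> p u (v \<oplus>\<^bsub>Hom C Z X\<^esub> w) = p u v + p u w"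
    and "\<And>u w. \<not> span_pair X u w \<Longrightarrow> p u w = 0"
  shows "(X, p) \<in> char_prod"
  using assms by (auto simp: char_prod_def characters_def)

lemma char_prod_add:
  assumes "(X, p) \<in> char_prod" "Z \<in> Obj C" "Y \<in> Obj C" "u \<in> homs C Z Y"
    "v \<in> homs C Z X" "w \<in> homs C Z X"
  shows "p u (v \<oplus>\<^bsub>Hom C Z X\<^esub> w) = p u v + p u w"
  by (rule characters_add[OF char_prodD(2)[OF assms(1-4)] assms(5,6)])

lemma char_prod_eqI:
  assumes "X \<in> Obj C" "\<And>u w. \<not> span_pair X u w \<Longrightarrow> p u w = q u w"
    and "\<And>Z Y u w. \<lbrakk>Z \<in> Obj C; Y \<in> Obj C; u \<in> homs C Z Y; w \<in> homs C Z X\<rbrakk> \<Longrightarrow> p u w = q u w"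
  shows "p = q"
proof (intro ext)
  fix u w
  show "p u w = q u w"
  proof (cases "span_pair X u w")
    case True
    then show ?thesis using assms(3) unfolding span_pair_def by blast
  qed (rule assms(2))
qed

lemma char_prod_additive_functor: "additive_functor R C char_prod char_act"
proof (intro additive_functor.intro additive_functor_axioms.intro linear_category_axioms)
  fix X p assume p: "(X, p) \<in> char_prod"
  show X: "X \<in> Obj C" by (rule char_prodD(1)[OF p])
  show "(X, - p) \<in> char_prod"
    using char_prodD(3)[OF p] by (intro char_prodI X) (simp_all add: char_prod_add[OF p])
  show "char_act (Ident C X) p = p"
  proof (rule char_prod_eqI[OF X])
    note apply_id = char_act_apply[OF X X ident_closed[OF X]]
    show "char_act (Ident C X) p u w = p u w" if "\<not> span_pair X u w" for u w
      using that char_prodD(3)[OF p] by (simp add: apply_id)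
    show "char_act (Ident C X) p u w = p u w"
      if "Z \<in> Obj C" "Y \<in> Obj C" "u \<in> homs C Z Y" "w \<in> homs C Z X" for Z Y u w
      using that X by (simp add: apply_id span_pair_iff[OF that(1,2) X that(3)] comp_ident_left)
  qed
  fix q assume q: "(X, q) \<in> char_prod"
  show "(X, p + q) \<in> char_prod"
    using char_prodD(3)[OF p] char_prodD(3)[OF q]
    by (intro char_prodI X) (simp_all add: char_prod_add[OF p] char_prod_add[OF q])
next
  fix X assume "X \<in> Obj C"
  then show "(X, 0) \<in> char_prod" by (intro char_prodI) simp_all
next
  fix X Y f p assume f: "X \<in> Obj C" "Y \<in> Obj C" "f \<in> homs C X Y" and p: "(Y, p) \<in> char_prod"
  note apply_f = char_act_apply[OF f]
  show "(X, char_act f p) \<in> char_prod"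
  proof (rule char_prodI[OF f(1)])
    show "char_act f p u (v \<oplus>\<^bsub>Hom C Z X\<^esub> w) = char_act f p u v + char_act f p u w"
      if u: "Z \<in> Obj C" "Y' \<in> Obj C" "u \<in> homs C Z Y'" and vw: "v \<in> homs C Z X" "w \<in> homs C Z X"
      for Z Y' u v w
      using char_prod_add[OF p u comp_closed[OF u(1) f(1,2) vw(1) f(3)]
          comp_closed[OF u(1) f(1,2) vw(2) f(3)]]
        comp_add_right[OF u(1) f(1,2) vw f(3)] hom_add_closed[OF u(1) f(1) vw] vw
      by (simp add: apply_f span_pair_iff[OF u(1,2) f(1) u(3)])
  qed (simp add: apply_f)
  fix q assume q: "(Y, q) \<in> char_prod"
  show "char_act f (p + q) = char_act f p + char_act f q"
    by (intro ext) (simp add: apply_f)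
next
  fix X Y f g p
  assume f: "X \<in> Obj C" "Y \<in> Obj C" "f \<in> homs C X Y" "g \<in> homs C X Y" and p: "(Y, p) \<in> char_prod"
  note fg = hom_add_closed[OF f]
  show "char_act (f \<oplus>\<^bsub>Hom C X Y\<^esub> g) p = char_act f p + char_act g p"
  proof (rule char_prod_eqI[OF f(1)])
    fix Z Y' u w assume u: "Z \<in> Obj C" "Y' \<in> Obj C" "u \<in> homs C Z Y'" and w: "w \<in> homs C Z X"
    show "char_act (f \<oplus>\<^bsub>Hom C X Y\<^esub> g) p u w = (char_act f p + char_act g p) u w"
      using char_prod_add[OF p u comp_closed[OF u(1) f(1,2) w f(3)]
          comp_closed[OF u(1) f(1,2) w f(4)]] comp_add_left[OF u(1) f(1,2) w f(3,4)] w
      by (simp add: char_act_apply[OF f(1,2) fg] char_act_apply[OF f(1,2,3)]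
          char_act_apply[OF f(1,2,4)] span_pair_iff[OF u(1,2) f(1) u(3)])
  qed (simp add: char_act_apply[OF f(1,2) fg] char_act_apply[OF f(1,2,3)] char_act_apply[OF f(1,2,4)])
next
  fix X Y Z f g p
  assume f: "X \<in> Obj C" "Y \<in> Obj C" "Z \<in> Obj C" "f \<in> homs C X Y" "g \<in> homs C Y Z"
    and p: "(Z, p) \<in> char_prod"
  note apply_gf = char_act_apply[OF f(1,3) comp_closed[OF f]]
    char_act_apply[OF f(1,2,4)] char_act_apply[OF f(2,3,5)]
  show "char_act (g \<cdot>\<^bsub>C\<^esub> f) p = char_act f (char_act g p)"
  proof (rule char_prod_eqI[OF f(1)])
    fix T Y' u w assume u: "T \<in> Obj C" "Y' \<in> Obj C" "u \<in> homs C T Y'" and w: "w \<in> homs C T X"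
    show "char_act (g \<cdot>\<^bsub>C\<^esub> f) p u w = char_act f (char_act g p) u w"
      using comp_assoc[OF u(1) f(1-3) w f(4,5)] comp_closed[OF u(1) f(1,2) w f(4)] w
      by (simp add: apply_gf span_pair_iff[OF u(1,2) f(1) u(3)] span_pair_iff[OF u(1,2) f(2) u(3)])
  qed (simp add: apply_gf)
qed

text \<open>
  By the Yoneda lemma for characters, a natural map into the factor at \<open>u : Z \<rightarrow> Y\<close> is one character
  of the value at \<open>Z\<close>, read off at the identity of \<open>Z\<close>, and characters extend.
\<close>

lemma char_prod_injective_functor: "injective_functor R C char_prod char_act"
proof (intro injective_functor.intro injective_functor_axioms.intro char_prod_additive_functor)
  interpret P: additive_functor R C char_prod char_act by (rule char_prod_additive_functor)
  fix A \<phi> assume A: "P.subfunctor A" and \<phi>: "P.natural A \<phi>"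
  define G :: "'o \<Rightarrow> ('m \<Rightarrow> 'm \<Rightarrow> circle) ring" where
    "G Z = \<lparr>carrier = {p. (Z, p) \<in> char_prod}, mult = (\<lambda>p q. p), one = 0, zero = 0, add = (+)\<rparr>" for Z
  have G_simps: "carrier (G Z) = {p. (Z, p) \<in> char_prod}" "add (G Z) = (+)" "zero (G Z) = 0" for Z
    by (simp_all add: G_def)
  have G: "abelian_group (G Z)" if "Z \<in> Obj C" for Z
  proof (rule abelian_groupI)
    fix p assume "p \<in> carrier (G Z)"
    then show "\<exists>q\<in>carrier (G Z). q \<oplus>\<^bsub>G Z\<^esub> p = \<zero>\<^bsub>G Z\<^esub>"
      by (intro bexI[of _ "- p"]) (simp_all add: G_simps P.P_neg)
  qed (use that in \<open>simp_all add: G_simps P.P_add P.P_zero ac_simps\<close>)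
  have "\<exists>\<psi>. \<forall>Z\<in>Obj C. \<forall>Y\<in>Obj C. u \<in> homs C Z Y \<longrightarrow>
      \<psi> \<in> characters (G Z) \<and> (\<forall>a. (Z, a) \<in> A \<longrightarrow> \<psi> a = \<phi> Z a u (Ident C Z))" for u
  proof (cases "\<exists>Z\<in>Obj C. \<exists>Y\<in>Obj C. u \<in> homs C Z Y")
    case True
    then obtain Z Y where u: "Z \<in> Obj C" "Y \<in> Obj C" "u \<in> homs C Z Y" by blast
    interpret GZ: abelian_group "G Z" by (rule G[OF u(1)])
    define \<Gamma> where "\<Gamma> = {(a, \<phi> Z a u (Ident C Z)) | a. (Z, a) \<in> A}"
    have zero: "\<phi> Z 0 = 0"
      using P.naturalD(2)[OF \<phi>, of Z 0 0] P.subfunctorD(3)[OF A u(1)] by simp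
    have neg: "\<phi> Z (- a) = - \<phi> Z a" if "(Z, a) \<in> A" for a
    proof -
      have "\<phi> Z a + \<phi> Z (- a) = 0"
        using P.naturalD(2)[OF \<phi> that P.subfunctorD(5)[OF A that]] zero by simp
      then show ?thesis by (metis neg_eq_iff_add_eq_0)
    qed
    have neg_G: "\<ominus>\<^bsub>G Z\<^esub> a = - a" if "(Z, a) \<in> char_prod" for a
      using GZ.minus_equality[of "- a" a] that P.P_neg by (simp add: G_simps)
    have "partial_character (G Z) \<Gamma>"
      unfolding partial_character_def G_simps
    proof (intro conjI allI impI)
      show "\<Gamma> \<subseteq> {p. (Z, p) \<in> char_prod} \<times> UNIV"
        using P.subfunctorD(1)[OF A] by (auto simp: \<Gamma>_def)
      show "(0, 0) \<in> \<Gamma>" using P.subfunctorD(3)[OF A u(1)] zero by (auto simp: \<Gamma>_def)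
      show "(a + b, c + d) \<in> \<Gamma>" if "(a, c) \<in> \<Gamma>" "(b, d) \<in> \<Gamma>" for a b c d
        using that P.subfunctorD(4)[OF A] P.naturalD(2)[OF \<phi>] by (auto simp: \<Gamma>_def)
      show "(\<ominus>\<^bsub>G Z\<^esub> a, - c) \<in> \<Gamma>" if "(a, c) \<in> \<Gamma>" for a c
        using that P.subfunctorD(1,5)[OF A] neg neg_G by (auto simp: \<Gamma>_def)
      show "c = 0" if "(0, c) \<in> \<Gamma>" for c using that zero by (auto simp: \<Gamma>_def)
    qed
    then obtain \<psi> where \<psi>: "\<psi> \<in> characters (G Z)" "\<And>a c. (a, c) \<in> \<Gamma> \<Longrightarrow> \<psi> a = c"
      using GZ.partial_character_extends by blast
    have "Z' = Z" if "Z' \<in> Obj C" "Y' \<in> Obj C" "u \<in> homs C Z' Y'" for Z' Y'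
      using hom_disjoint[OF that(1,2) u(1,2) that(3) u(3)] by blast
    moreover have "\<psi> a = \<phi> Z a u (Ident C Z)" if "(Z, a) \<in> A" for a
      using \<psi>(2) that by (auto simp: \<Gamma>_def)
    ultimately show ?thesis using \<psi>(1) by blast
  qed blast
  then obtain \<psi> where \<psi>: "\<And>u Z Y. \<lbrakk>Z \<in> Obj C; Y \<in> Obj C; u \<in> homs C Z Y\<rbrakk> \<Longrightarrow> \<psi> u \<in> characters (G Z)"
    "\<And>u Z Y a. \<lbrakk>Z \<in> Obj C; Y \<in> Obj C; u \<in> homs C Z Y; (Z, a) \<in> A\<rbrakk> \<Longrightarrow> \<psi> u a = \<phi> Z a u (Ident C Z)"
    by metis
  define \<Phi> where "\<Phi> X p = (\<lambda>u w. if span_pair X u w then \<psi> u (char_act w p) else 0)" for X p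
  have \<psi>_add: "\<psi> u (p + q) = \<psi> u p + \<psi> u q"
    if "Z \<in> Obj C" "Y \<in> Obj C" "u \<in> homs C Z Y" "(Z, p) \<in> char_prod" "(Z, q) \<in> char_prod" for Z Y u p q
    using characters_add[OF \<psi>(1)[OF that(1-3)], of p q] that(4,5) by (simp add: G_simps)
  have "P.natural char_prod \<Phi>"
    unfolding P.natural_def
  proof (intro conjI allI ballI impI)
    fix X p assume p: "(X, p) \<in> char_prod"
    note X = char_prodD(1)[OF p]
    show "(X, \<Phi> X p) \<in> char_prod"
    proof (rule char_prodI[OF X])
      show "\<Phi> X p u (v \<oplus>\<^bsub>Hom C Z X\<^esub> w) = \<Phi> X p u v + \<Phi> X p u w"
        if u: "Z \<in> Obj C" "Y \<in> Obj C" "u \<in> homs C Z Y" and vw: "v \<in> homs C Z X" "w \<in> homs C Z X"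
        for Z Y u v w
        using \<psi>_add[OF u P.P_act[OF u(1) X vw(1) p] P.P_act[OF u(1) X vw(2) p]]
          P.act_hom_add[OF u(1) X vw p] hom_add_closed[OF u(1) X vw] vw
        by (simp add: \<Phi>_def span_pair_iff[OF u(1,2) X u(3)])
    qed (simp add: \<Phi>_def)
    fix q assume q: "(X, q) \<in> char_prod"
    show "\<Phi> X (p + q) = \<Phi> X p + \<Phi> X q"
    proof (rule char_prod_eqI[OF X])
      fix Z Y u w assume u: "Z \<in> Obj C" "Y \<in> Obj C" "u \<in> homs C Z Y" and w: "w \<in> homs C Z X"
      show "\<Phi> X (p + q) u w = (\<Phi> X p + \<Phi> X q) u w"
        using \<psi>_add[OF u P.P_act[OF u(1) X w p] P.P_act[OF u(1) X w q]] P.act_add[OF u(1) X w p q] w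
        by (simp add: \<Phi>_def span_pair_iff[OF u(1,2) X u(3)])
    qed (simp add: \<Phi>_def)
  next
    fix X Y f p assume f: "X \<in> Obj C" "Y \<in> Obj C" "f \<in> homs C X Y" and p: "(Y, p) \<in> char_prod"
    show "\<Phi> X (char_act f p) = char_act f (\<Phi> Y p)"
    proof (rule char_prod_eqI[OF f(1)])
      fix Z Y' u w assume u: "Z \<in> Obj C" "Y' \<in> Obj C" "u \<in> homs C Z Y'" and w: "w \<in> homs C Z X"
      show "\<Phi> X (char_act f p) u w = char_act f (\<Phi> Y p) u w"
        using P.act_comp[OF u(1) f(1,2) w f(3) p] comp_closed[OF u(1) f(1,2) w f(3)] w
        by (simp add: \<Phi>_def char_act_apply[OF f] span_pair_iff[OF u(1,2) f(1) u(3)]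
            span_pair_iff[OF u(1,2) f(2) u(3)])
    qed (simp add: \<Phi>_def char_act_apply[OF f])
  qed
  moreover have "\<Phi> X a = \<phi> X a" if a: "(X, a) \<in> A" for X a
  proof -
    note X = P.subfunctorD(2)[OF A a] and \<phi>a = P.naturalD(1)[OF \<phi> a]
    show ?thesis
    proof (rule char_prod_eqI[OF X])
      show "\<Phi> X a u w = \<phi> X a u w" if "\<not> span_pair X u w" for u w
        using that char_prodD(3)[OF \<phi>a] by (simp add: \<Phi>_def)
      fix Z Y u w assume u: "Z \<in> Obj C" "Y \<in> Obj C" "u \<in> homs C Z Y" and w: "w \<in> homs C Z X"
      have "\<Phi> X a u w = \<phi> Z (char_act w a) u (Ident C Z)"
        using \<psi>(2)[OF u P.subfunctorD(7)[OF A u(1) X w a]] w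
        by (simp add: \<Phi>_def span_pair_iff[OF u(1,2) X u(3)])
      also have "\<dots> = char_act w (\<phi> X a) u (Ident C Z)"
        using P.naturalD(3)[OF \<phi> u(1) X w a] by simp
      also have "\<dots> = \<phi> X a u w"
        using ident_closed[OF u(1)] comp_ident_right[OF u(1) X w]
        by (simp add: char_act_apply[OF u(1) X w] span_pair_iff[OF u(1,2) u(1) u(3)])
      finally show "\<Phi> X a u w = \<phi> X a u w" .
    qed
  qed
  ultimately show "\<exists>\<Phi>. P.natural char_prod \<Phi> \<and> (\<forall>X a. (X, a) \<in> A \<longrightarrow> \<Phi> X a = \<phi> X a)" by blast
qed

text \<open>
  Duality with values in an injective group reverses the exact sequences \<open>Hom(T, X) \<rightarrow> Hom(T, Y) \<rightarrow>
  Hom(T, Z)\<close>: a character of \<open>Hom(T, Y)\<close> that is trivial on the image of \<open>f\<close> descends to the image of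
  \<open>g\<close> and extends from there.
\<close>

lemma char_prod_exact:
  assumes ex: "hom_exact X Y Z f g" and p: "(Y, p) \<in> char_prod" and fp: "char_act f p = 0"
  obtains q where "(Z, q) \<in> char_prod" "p = char_act g q"
proof -
  have obj: "X \<in> Obj C" "Y \<in> Obj C" "Z \<in> Obj C" and f: "f \<in> homs C X Y" and g: "g \<in> homs C Y Z"
    and lift: "\<And>T y. \<lbrakk>T \<in> Obj C; y \<in> homs C T Y; g \<cdot>\<^bsub>C\<^esub> y = \<zero>\<^bsub>Hom C T Z\<^esub>\<rbrakk>
      \<Longrightarrow> \<exists>x\<in>homs C T X. y = f \<cdot>\<^bsub>C\<^esub> x"
    using ex unfolding hom_exact_def by blast+
  have "\<exists>\<chi>. \<forall>T\<in>Obj C. \<forall>S\<in>Obj C. u \<in> homs C T S \<longrightarrow>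
      \<chi> \<in> characters (Hom C T Z) \<and> (\<forall>y\<in>homs C T Y. \<chi> (g \<cdot>\<^bsub>C\<^esub> y) = p u y)" for u
  proof (cases "\<exists>T\<in>Obj C. \<exists>S\<in>Obj C. u \<in> homs C T S")
    case True
    then obtain T S where u: "T \<in> Obj C" "S \<in> Obj C" "u \<in> homs C T S" by blast
    interpret HY: abelian_group "Hom C T Y" by (rule hom_abelian_group[OF u(1) obj(2)])
    interpret HZ: abelian_group "Hom C T Z" by (rule hom_abelian_group[OF u(1) obj(3)])
    note pu = char_prodD(2)[OF p u]
    define \<Gamma> where "\<Gamma> = {(g \<cdot>\<^bsub>C\<^esub> y, p u y) | y. y \<in> homs C T Y}"
    have "partial_character (Hom C T Z) \<Gamma>"
      unfolding partial_character_def
    proof (intro conjI allI impI)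
      show "\<Gamma> \<subseteq> homs C T Z \<times> UNIV" using comp_closed[OF u(1) obj(2,3) _ g] by (auto simp: \<Gamma>_def)
      show "(\<zero>\<^bsub>Hom C T Z\<^esub>, 0) \<in> \<Gamma>"
        using comp_zero_right[OF u(1) obj(2,3) g] HY.characters_zero[OF pu] HY.zero_closed
        unfolding \<Gamma>_def by (metis (mono_tags, lifting) mem_Collect_eq)
      show "(a \<oplus>\<^bsub>Hom C T Z\<^esub> b, c + d) \<in> \<Gamma>" if ac: "(a, c) \<in> \<Gamma>" and bd: "(b, d) \<in> \<Gamma>" for a b c d
      proof -
        obtain y y' where y: "y \<in> homs C T Y" "a = g \<cdot>\<^bsub>C\<^esub> y" "c = p u y"
          "y' \<in> homs C T Y" "b = g \<cdot>\<^bsub>C\<^esub> y'" "d = p u y'" using ac bd by (auto simp: \<Gamma>_def)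
        then have "a \<oplus>\<^bsub>Hom C T Z\<^esub> b = g \<cdot>\<^bsub>C\<^esub> (y \<oplus>\<^bsub>Hom C T Y\<^esub> y')" "c + d = p u (y \<oplus>\<^bsub>Hom C T Y\<^esub> y')"
          using comp_add_right[OF u(1) obj(2,3) y(1,4) g] characters_add[OF pu y(1,4)] by simp_all
        then show ?thesis using HY.a_closed[OF y(1,4)] unfolding \<Gamma>_def by blast
      qed
      show "(\<ominus>\<^bsub>Hom C T Z\<^esub> a, - c) \<in> \<Gamma>" if ac: "(a, c) \<in> \<Gamma>" for a c
      proof -
        obtain y where y: "y \<in> homs C T Y" "a = g \<cdot>\<^bsub>C\<^esub> y" "c = p u y" using ac by (auto simp: \<Gamma>_def)
        have "c + p u (\<ominus>\<^bsub>Hom C T Y\<^esub> y) = 0"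
          using characters_add[OF pu y(1) HY.a_inv_closed[OF y(1)]] HY.characters_zero[OF pu]
            HY.r_neg[OF y(1)] y(3) by simp
        then have "- c = p u (\<ominus>\<^bsub>Hom C T Y\<^esub> y)" by (metis neg_eq_iff_add_eq_0)
        then show ?thesis
          using comp_neg_right[OF u(1) obj(2,3) y(1) g] y(2) HY.a_inv_closed[OF y(1)]
          unfolding \<Gamma>_def by (metis (mono_tags, lifting) mem_Collect_eq)
      qed
      show "c = 0" if c: "(\<zero>\<^bsub>Hom C T Z\<^esub>, c) \<in> \<Gamma>" for c
      proof -
        obtain y where y: "y \<in> homs C T Y" "g \<cdot>\<^bsub>C\<^esub> y = \<zero>\<^bsub>Hom C T Z\<^esub>" "c = p u y"
          using c unfolding \<Gamma>_def by (smt (verit) Pair_inject mem_Collect_eq)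
        then obtain x where x: "x \<in> homs C T X" "y = f \<cdot>\<^bsub>C\<^esub> x" using lift[OF u(1)] by blast
        have "p u y = char_act f p u x"
          using x by (simp add: char_act_apply[OF obj(1,2) f] span_pair_iff[OF u(1,2) obj(1) u(3)])
        then show ?thesis using fp y(3) by simp
      qed
    qed
    then obtain \<chi> where \<chi>: "\<chi> \<in> characters (Hom C T Z)" "\<And>a c. (a, c) \<in> \<Gamma> \<Longrightarrow> \<chi> a = c"
      using HZ.partial_character_extends by blast
    have "T' = T" if "T' \<in> Obj C" "S' \<in> Obj C" "u \<in> homs C T' S'" for T' S'
      using hom_disjoint[OF that(1,2) u(1,2) that(3) u(3)] by blast
    moreover have "\<chi> (g \<cdot>\<^bsub>C\<^esub> y) = p u y" if "y \<in> homs C T Y" for y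
      using \<chi>(2) that by (auto simp: \<Gamma>_def)
    ultimately show ?thesis using \<chi>(1) by blast
  qed blast
  then obtain \<chi> where \<chi>: "\<And>u T S. \<lbrakk>T \<in> Obj C; S \<in> Obj C; u \<in> homs C T S\<rbrakk> \<Longrightarrow> \<chi> u \<in> characters (Hom C T Z)"
    "\<And>u T S y. \<lbrakk>T \<in> Obj C; S \<in> Obj C; u \<in> homs C T S; y \<in> homs C T Y\<rbrakk> \<Longrightarrow> \<chi> u (g \<cdot>\<^bsub>C\<^esub> y) = p u y"
    by metis
  define q where "q u z = (if span_pair Z u z then \<chi> u z else 0)" for u z
  have "(Z, q) \<in> char_prod"
  proof (rule char_prodI[OF obj(3)])
    show "q u (v \<oplus>\<^bsub>Hom C T Z\<^esub> w) = q u v + q u w"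
      if u: "T \<in> Obj C" "S \<in> Obj C" "u \<in> homs C T S" and vw: "v \<in> homs C T Z" "w \<in> homs C T Z" for T S u v w
      using characters_add[OF \<chi>(1)[OF u] vw] hom_add_closed[OF u(1) obj(3) vw] vw
      by (simp add: q_def span_pair_iff[OF u(1,2) obj(3) u(3)])
  qed (simp add: q_def)
  moreover have "p = char_act g q"
  proof (rule char_prod_eqI[OF obj(2)])
    show "p u w = char_act g q u w" if "\<not> span_pair Y u w" for u w
      using that char_prodD(3)[OF p] by (simp add: char_act_apply[OF obj(2,3) g])
    fix T S u w assume u: "T \<in> Obj C" "S \<in> Obj C" "u \<in> homs C T S" and w: "w \<in> homs C T Y"
    show "p u w = char_act g q u w"
      using \<chi>(2)[OF u w] comp_closed[OF u(1) obj(2,3) w g] w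
      by (simp add: char_act_apply[OF obj(2,3) g] q_def span_pair_iff[OF u(1,2) obj(2) u(3)]
          span_pair_iff[OF u(1,2) obj(3) u(3)])
  qed
  ultimately show ?thesis by (rule that)
qed

text \<open>
  The index set of all arrows is large enough to embed every quotient \<open>Hom(-, Y)/N\<close>: the factor at
  \<open>u : Z \<rightarrow> Y\<close> gets a character of \<open>Hom(Z, Y)\<close> that vanishes on \<open>N\<close> but not at \<open>u\<close>.
\<close>

lemma representable_quotient_embeds:
  assumes Y: "Y \<in> Obj C"
    and N: "\<And>X v. \<lbrakk>X \<in> Obj C; N X v\<rbrakk> \<Longrightarrow> v \<in> homs C X Y"
      "\<And>X. X \<in> Obj C \<Longrightarrow> N X \<zero>\<^bsub>Hom C X Y\<^esub>"
      "\<And>X v w. \<lbrakk>X \<in> Obj C; N X v; N X w\<rbrakk> \<Longrightarrow> N X (v \<oplus>\<^bsub>Hom C X Y\<^esub> w)"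
      "\<And>X v. \<lbrakk>X \<in> Obj C; N X v\<rbrakk> \<Longrightarrow> N X (\<ominus>\<^bsub>Hom C X Y\<^esub> v)"
      "\<And>W X v w. \<lbrakk>W \<in> Obj C; X \<in> Obj C; N X v; w \<in> homs C W X\<rbrakk> \<Longrightarrow> N W (v \<cdot>\<^bsub>C\<^esub> w)"
  obtains \<mu> where "\<And>X v. \<lbrakk>X \<in> Obj C; v \<in> homs C X Y\<rbrakk> \<Longrightarrow> (X, \<mu> v) \<in> char_prod"
    "\<And>X v w. \<lbrakk>X \<in> Obj C; v \<in> homs C X Y; w \<in> homs C X Y\<rbrakk> \<Longrightarrow> \<mu> (v \<oplus>\<^bsub>Hom C X Y\<^esub> w) = \<mu> v + \<mu> w"
    "\<And>W X v w. \<lbrakk>W \<in> Obj C; X \<in> Obj C; v \<in> homs C X Y; w \<in> homs C W X\<rbrakk> \<Longrightarrow> \<mu> (v \<cdot>\<^bsub>C\<^esub> w) = char_act w (\<mu> v)"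
    "\<And>X v. \<lbrakk>X \<in> Obj C; v \<in> homs C X Y\<rbrakk> \<Longrightarrow> \<mu> v = 0 \<longleftrightarrow> N X v"
proof -
  have "\<exists>\<chi>. \<forall>Z\<in>Obj C. u \<in> homs C Z Y \<longrightarrow> \<chi> \<in> characters (Hom C Z Y) \<and>
      (\<forall>v. N Z v \<longrightarrow> \<chi> v = 0) \<and> (\<not> N Z u \<longrightarrow> \<chi> u \<noteq> 0)" for u
  proof (cases "\<exists>Z\<in>Obj C. u \<in> homs C Z Y \<and> \<not> N Z u")
    case True
    then obtain Z where u: "Z \<in> Obj C" "u \<in> homs C Z Y" "\<not> N Z u" by blast
    interpret H: abelian_group "Hom C Z Y" by (rule hom_abelian_group[OF u(1) Y])
    obtain \<chi> where \<chi>: "\<chi> \<in> characters (Hom C Z Y)" "\<And>v. v \<in> {v. N Z v} \<Longrightarrow> \<chi> v = 0" "\<chi> u \<noteq> 0"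
      by (rule H.character_separating_from_subgroup[of "{v. N Z v}" u]) (use N u in auto)
    have "Z' = Z" if "Z' \<in> Obj C" "u \<in> homs C Z' Y" for Z'
      using hom_disjoint[OF that(1) Y u(1) Y that(2) u(2)] by blast
    then show ?thesis using \<chi> by blast
  next
    case False
    have "(\<lambda>_. 0) \<in> characters (Hom C Z Y)" for Z by (simp add: characters_def)
    then show ?thesis using False by (intro exI[of _ "\<lambda>_. 0"]) auto
  qed
  then have "\<exists>\<chi>. \<forall>u. \<forall>Z\<in>Obj C. u \<in> homs C Z Y \<longrightarrow> \<chi> u \<in> characters (Hom C Z Y) \<and>
      (\<forall>v. N Z v \<longrightarrow> \<chi> u v = 0) \<and> (\<not> N Z u \<longrightarrow> \<chi> u u \<noteq> 0)"
    by (intro choice) blast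
  then obtain \<chi> where \<chi>: "\<And>u Z. \<lbrakk>Z \<in> Obj C; u \<in> homs C Z Y\<rbrakk> \<Longrightarrow> \<chi> u \<in> characters (Hom C Z Y)"
    "\<And>u Z v. \<lbrakk>Z \<in> Obj C; u \<in> homs C Z Y; N Z v\<rbrakk> \<Longrightarrow> \<chi> u v = 0"
    "\<And>u Z. \<lbrakk>Z \<in> Obj C; u \<in> homs C Z Y; \<not> N Z u\<rbrakk> \<Longrightarrow> \<chi> u u \<noteq> 0"
    by blast
  define \<mu> where "\<mu> v = (\<lambda>u w. if \<exists>Z\<in>Obj C. \<exists>X\<in>Obj C. u \<in> homs C Z Y \<and> w \<in> homs C Z X \<and>
    v \<in> homs C X Y then \<chi> u (v \<cdot>\<^bsub>C\<^esub> w) else 0)" for v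
  have \<mu>_apply: "\<mu> v u w = (if S = Y then \<chi> u (v \<cdot>\<^bsub>C\<^esub> w) else 0)"
    if "X \<in> Obj C" "v \<in> homs C X Y" "Z \<in> Obj C" "S \<in> Obj C" "u \<in> homs C Z S" "w \<in> homs C Z X"
    for X v Z S u w
  proof -
    have "(\<exists>Z\<in>Obj C. \<exists>X\<in>Obj C. u \<in> homs C Z Y \<and> w \<in> homs C Z X \<and> v \<in> homs C X Y) \<longleftrightarrow> S = Y"
      using that hom_disjoint[OF that(3,4) _ Y that(5)] by blast
    then show ?thesis by (simp add: \<mu>_def)
  qed
  have \<mu>_0: "\<mu> v u w = 0" if "X \<in> Obj C" "v \<in> homs C X Y" "\<not> span_pair X u w" for X v u w
  proof -
    have "\<not> (\<exists>Z\<in>Obj C. \<exists>X\<in>Obj C. u \<in> homs C Z Y \<and> w \<in> homs C Z X \<and> v \<in> homs C X Y)"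
      using that Y hom_disjoint[OF that(1) Y _ Y that(2)] unfolding span_pair_def by blast
    then show ?thesis unfolding \<mu>_def by (rule if_not_P)
  qed
  show ?thesis
  proof (rule that)
    fix X v assume v: "X \<in> Obj C" "v \<in> homs C X Y"
    show "(X, \<mu> v) \<in> char_prod"
    proof (rule char_prodI[OF v(1)])
      show "\<mu> v u (w \<oplus>\<^bsub>Hom C Z X\<^esub> w') = \<mu> v u w + \<mu> v u w'"
        if u: "Z \<in> Obj C" "S \<in> Obj C" "u \<in> homs C Z S" and w: "w \<in> homs C Z X" "w' \<in> homs C Z X"
        for Z S u w w'
      proof (cases "S = Y")
        case True
        then show ?thesis
          using characters_add[OF \<chi>(1) comp_closed[OF u(1) v(1) Y w(1) v(2)]
              comp_closed[OF u(1) v(1) Y w(2) v(2)], of u] u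
            comp_add_right[OF u(1) v(1) Y w v(2)]
          by (simp add: \<mu>_apply[OF v u] w hom_add_closed[OF u(1) v(1) w])
      next
        case False
        then show ?thesis by (simp add: \<mu>_apply[OF v u] w hom_add_closed[OF u(1) v(1) w])
      qed
    qed (rule \<mu>_0[OF v])
    show "\<mu> v = 0 \<longleftrightarrow> N X v"
    proof
      assume "\<mu> v = 0"
      then have "\<mu> v v (Ident C X) = 0" by simp
      then have "\<chi> v v = 0"
        using \<mu>_apply[OF v v(1) Y v(2) ident_closed[OF v(1)]] comp_ident_right[OF v(1) Y v(2)] by simp
      then show "N X v" using \<chi>(3)[OF v] by blast
    next
      assume n: "N X v"
      show "\<mu> v = 0"
      proof (rule char_prod_eqI[OF v(1)])
        fix Z S u w assume u: "Z \<in> Obj C" "S \<in> Obj C" "u \<in> homs C Z S" and w: "w \<in> homs C Z X"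
        have "N Z (v \<cdot>\<^bsub>C\<^esub> w)" by (rule N(5)[OF u(1) v(1) n w])
        then show "\<mu> v u w = 0 u w" using \<mu>_apply[OF v u w] \<chi>(2)[OF u(1)] u(3) by auto
      qed (simp add: \<mu>_0[OF v])
    qed
    fix v' assume v': "v' \<in> homs C X Y"
    show "\<mu> (v \<oplus>\<^bsub>Hom C X Y\<^esub> v') = \<mu> v + \<mu> v'"
    proof (rule char_prod_eqI[OF v(1)])
      note vv' = hom_add_closed[OF v(1) Y v(2) v']
      show "\<mu> (v \<oplus>\<^bsub>Hom C X Y\<^esub> v') u w = (\<mu> v + \<mu> v') u w" if "\<not> span_pair X u w" for u w
        using that by (simp add: \<mu>_0[OF v(1) vv'] \<mu>_0[OF v] \<mu>_0[OF v(1) v'])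
      fix Z S u w assume u: "Z \<in> Obj C" "S \<in> Obj C" "u \<in> homs C Z S" and w: "w \<in> homs C Z X"
      have "\<chi> u ((v \<oplus>\<^bsub>Hom C X Y\<^esub> v') \<cdot>\<^bsub>C\<^esub> w) = \<chi> u (v \<cdot>\<^bsub>C\<^esub> w) + \<chi> u (v' \<cdot>\<^bsub>C\<^esub> w)" if "S = Y"
        using characters_add[OF \<chi>(1)[OF u(1)] comp_closed[OF u(1) v(1) Y w v(2)]
            comp_closed[OF u(1) v(1) Y w v']] u(3) that comp_add_left[OF u(1) v(1) Y w v(2) v'] by simp
      then show "\<mu> (v \<oplus>\<^bsub>Hom C X Y\<^esub> v') u w = (\<mu> v + \<mu> v') u w"
        by (simp add: \<mu>_apply[OF v(1) vv' u w] \<mu>_apply[OF v u w] \<mu>_apply[OF v(1) v' u w])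
    qed
  next
    fix W X v h assume obj: "W \<in> Obj C" "X \<in> Obj C" and v: "v \<in> homs C X Y" and h: "h \<in> homs C W X"
    note vh = comp_closed[OF obj Y h v]
    show "\<mu> (v \<cdot>\<^bsub>C\<^esub> h) = char_act h (\<mu> v)"
    proof (rule char_prod_eqI[OF obj(1)])
      show "\<mu> (v \<cdot>\<^bsub>C\<^esub> h) u w = char_act h (\<mu> v) u w" if "\<not> span_pair W u w" for u w
        using that by (simp add: \<mu>_0[OF obj(1) vh] char_act_apply[OF obj h])
      fix Z S u w assume u: "Z \<in> Obj C" "S \<in> Obj C" "u \<in> homs C Z S" and w: "w \<in> homs C Z W"
      show "\<mu> (v \<cdot>\<^bsub>C\<^esub> h) u w = char_act h (\<mu> v) u w"
        using w comp_assoc[OF u(1) obj Y w h v]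
        by (simp add: char_act_apply[OF obj h] span_pair_iff[OF u(1,2) obj(1) u(3)]
            \<mu>_apply[OF obj(1) vh u w] \<mu>_apply[OF obj(2) v u comp_closed[OF u(1) obj w h]])
    qed
  qed
qed

end

section \<open>Cohomological functors from summands\<close>

text \<open>
  A subfunctor, carried over to any type that \<open>'g\<close> embeds into. A scalar \<open>r\<close> has to act as the arrow
  \<open>r \<odot> id\<close>, since the functor is to be linear; so the additive structure determines the module
  structure.
\<close>

definition module_functor ::
    "('r, 'o, 'm, 'z) lin_cat_scheme \<Rightarrow> ('m \<Rightarrow> 'g \<Rightarrow> 'g) \<Rightarrow> ('o \<times> 'g::ab_group_add) set \<Rightarrow> ('g \<Rightarrow> 'v)
      \<Rightarrow> ('r, 'o, 'm, 'v) mod_functor" where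
  "module_functor C act K \<rho> =
     \<lparr>FO = \<lambda>X. \<lparr>carrier = \<rho> ` {p. (X, p) \<in> K}, mult = \<lambda>a b. a, one = \<rho> 0, zero = \<rho> 0,
        add = \<lambda>a b. \<rho> (inv_into UNIV \<rho> a + inv_into UNIV \<rho> b),
        smult = \<lambda>r a. \<rho> (act (r \<odot>\<^bsub>Hom C X X\<^esub> Ident C X) (inv_into UNIV \<rho> a))\<rparr>,
      FA = \<lambda>f a. \<rho> (act f (inv_into UNIV \<rho> a))\<rparr>"

lemma module_functor_simps:
  assumes "inj \<rho>"
  shows "carrier (FO (module_functor C act K \<rho>) X) = \<rho> ` {p. (X, p) \<in> K}"
    and "\<zero>\<^bsub>FO (module_functor C act K \<rho>) X\<^esub> = \<rho> 0"
    and "\<rho> p \<oplus>\<^bsub>FO (module_functor C act K \<rho>) X\<^esub> \<rho> q = \<rho> (p + q)"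
    and "r \<odot>\<^bsub>FO (module_functor C act K \<rho>) X\<^esub> \<rho> p = \<rho> (act (r \<odot>\<^bsub>Hom C X X\<^esub> Ident C X) p)"
    and "FA (module_functor C act K \<rho>) f (\<rho> p) = \<rho> (act f p)"
  using assms by (simp_all add: module_functor_def)

context additive_functor
begin

lemma scalar_closed:
  assumes "X \<in> Obj C" "r \<in> carrier R"
  shows "r \<odot>\<^bsub>Hom C X X\<^esub> Ident C X \<in> homs C X X"
  using module.smult_closed[OF hom_module[OF assms(1,1)] assms(2) ident_closed[OF assms(1)]] .

lemma comp_scalar:
  assumes "X \<in> Obj C" "Y \<in> Obj C" "r \<in> carrier R" "f \<in> homs C X Y"
  shows "f \<cdot>\<^bsub>C\<^esub> (r \<odot>\<^bsub>Hom C X X\<^esub> Ident C X) = r \<odot>\<^bsub>Hom C X Y\<^esub> f"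
    and "(r \<odot>\<^bsub>Hom C Y Y\<^esub> Ident C Y) \<cdot>\<^bsub>C\<^esub> f = r \<odot>\<^bsub>Hom C X Y\<^esub> f"
  using comp_smult_right[OF assms(1,1,2,3) ident_closed[OF assms(1)] assms(4)]
    comp_smult_left[OF assms(1,2,2,3,4) ident_closed[OF assms(2)]]
    comp_ident_right[OF assms(1,2,4)] comp_ident_left[OF assms(1,2,4)] by simp_all

lemma module_functor_module:
  assumes K: "subfunctor K" and \<rho>: "inj \<rho>" and X: "X \<in> Obj C"
  shows "module R (FO (module_functor C act K \<rho>) X)" (is "module R ?M")
proof -
  note S = module_functor_simps[OF \<rho>, of C act K]
  note id = ident_closed[OF X] and Hom = hom_module[OF X X]
  note s = scalar_closed[OF X]
  have KP: "(X, p) \<in> P" if "(X, p) \<in> K" for p using that subfunctorD(1)[OF K] by blast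
  have memE: "\<exists>p. a = \<rho> p \<and> (X, p) \<in> K" if "a \<in> carrier ?M" for a using that by (auto simp: S)
  have memI: "\<rho> p \<in> carrier ?M" if "(X, p) \<in> K" for p using that by (auto simp: S)
  have sK: "(X, act (r \<odot>\<^bsub>Hom C X X\<^esub> Ident C X) p) \<in> K" if "r \<in> carrier R" "(X, p) \<in> K" for r p
    using subfunctorD(7)[OF K X X s] that by blast
  have "abelian_group ?M"
  proof (rule abelian_groupI)
    fix a b assume "a \<in> carrier ?M" "b \<in> carrier ?M"
    then obtain p q where p: "a = \<rho> p" "(X, p) \<in> K" and q: "b = \<rho> q" "(X, q) \<in> K" using memE by blast
    show "a \<oplus>\<^bsub>?M\<^esub> b \<in> carrier ?M" unfolding p q S(3) by (rule memI[OF subfunctorD(4)[OF K p(2) q(2)]])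
    show "a \<oplus>\<^bsub>?M\<^esub> b = b \<oplus>\<^bsub>?M\<^esub> a" by (simp add: p q S ac_simps)
  next
    show "\<zero>\<^bsub>?M\<^esub> \<in> carrier ?M" unfolding S(2) by (rule memI[OF subfunctorD(3)[OF K X]])
  next
    fix a assume "a \<in> carrier ?M"
    then obtain p where p: "a = \<rho> p" "(X, p) \<in> K" using memE by blast
    show "\<zero>\<^bsub>?M\<^esub> \<oplus>\<^bsub>?M\<^esub> a = a" unfolding p S(2,3) by simp
    show "\<exists>b\<in>carrier ?M. b \<oplus>\<^bsub>?M\<^esub> a = \<zero>\<^bsub>?M\<^esub>"
      using memI[OF subfunctorD(5)[OF K p(2)]] by (intro bexI[of _ "\<rho> (- p)"]) (simp_all add: p S)
    fix b c assume "b \<in> carrier ?M" "c \<in> carrier ?M"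
    then obtain q r where "b = \<rho> q" "c = \<rho> r" using memE by blast
    then show "a \<oplus>\<^bsub>?M\<^esub> b \<oplus>\<^bsub>?M\<^esub> c = a \<oplus>\<^bsub>?M\<^esub> (b \<oplus>\<^bsub>?M\<^esub> c)" by (simp add: p S ac_simps)
  qed
  then show ?thesis
  proof (rule moduleI[OF is_cring])
    fix r a assume r: "r \<in> carrier R" and "a \<in> carrier ?M"
    then obtain p where p: "a = \<rho> p" "(X, p) \<in> K" using memE by blast
    show "r \<odot>\<^bsub>?M\<^esub> a \<in> carrier ?M" unfolding p S(4) by (rule memI[OF sK[OF r p(2)]])
    fix b assume "b \<in> carrier ?M"
    then obtain q where q: "b = \<rho> q" "(X, q) \<in> K" using memE by blast
    show "r \<odot>\<^bsub>?M\<^esub> (a \<oplus>\<^bsub>?M\<^esub> b) = r \<odot>\<^bsub>?M\<^esub> a \<oplus>\<^bsub>?M\<^esub> r \<odot>\<^bsub>?M\<^esub> b"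
      unfolding p q S(3,4) using act_add[OF X X s[OF r] KP[OF p(2)] KP[OF q(2)]] by simp
  next
    fix r t a assume r: "r \<in> carrier R" "t \<in> carrier R" and "a \<in> carrier ?M"
    then obtain p where p: "a = \<rho> p" "(X, p) \<in> K" using memE by blast
    show "(r \<oplus> t) \<odot>\<^bsub>?M\<^esub> a = r \<odot>\<^bsub>?M\<^esub> a \<oplus>\<^bsub>?M\<^esub> t \<odot>\<^bsub>?M\<^esub> a"
      unfolding p S(3,4) module.smult_l_distr[OF Hom r id]
      using act_hom_add[OF X X s[OF r(1)] s[OF r(2)] KP[OF p(2)]] by simp
    show "(r \<otimes> t) \<odot>\<^bsub>?M\<^esub> a = r \<odot>\<^bsub>?M\<^esub> (t \<odot>\<^bsub>?M\<^esub> a)"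
    proof -
      have "(r \<otimes> t) \<odot>\<^bsub>Hom C X X\<^esub> Ident C X
          = (t \<odot>\<^bsub>Hom C X X\<^esub> Ident C X) \<cdot>\<^bsub>C\<^esub> (r \<odot>\<^bsub>Hom C X X\<^esub> Ident C X)"
        using comp_scalar(1)[OF X X r(1) s[OF r(2)]] module.smult_assoc1[OF Hom r id] by simp
      then show ?thesis
        unfolding p S(4) using act_comp[OF X X X s[OF r(1)] s[OF r(2)] KP[OF p(2)]] by simp
    qed
  next
    fix a assume "a \<in> carrier ?M"
    then obtain p where p: "a = \<rho> p" "(X, p) \<in> K" using memE by blast
    show "\<one> \<odot>\<^bsub>?M\<^esub> a = a"
      unfolding p S(4) using module.smult_one[OF Hom id] act_ident[OF KP[OF p(2)]] by simp
  qed
qed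

lemma module_functor_linear:
  assumes K: "subfunctor K" and \<rho>: "inj \<rho>"
  shows "linear_contravariant_functor R C (module_functor C act K \<rho>)" (is "linear_contravariant_functor R C ?F")
proof (intro linear_contravariant_functor.intro linear_contravariant_functor_axioms.intro
    linear_category_axioms)
  note S = module_functor_simps[OF \<rho>, of C act K]
  have memE: "\<exists>p. a = \<rho> p \<and> (X, p) \<in> K \<and> (X, p) \<in> P" if "a \<in> carrier (FO ?F X)" for X a
    using that subfunctorD(1)[OF K] by (auto simp: S)
  show "module R (FO ?F X)" if "X \<in> Obj C" for X by (rule module_functor_module[OF K \<rho> that])
  have FA_smult: "FA ?F (r \<odot>\<^bsub>Hom C X Y\<^esub> f) a = r \<odot>\<^bsub>FO ?F X\<^esub> FA ?F f a"
    "FA ?F (r \<odot>\<^bsub>Hom C X Y\<^esub> f) a = FA ?F f (r \<odot>\<^bsub>FO ?F Y\<^esub> a)"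
    if X: "X \<in> Obj C" and Y: "Y \<in> Obj C" and r: "r \<in> carrier R" and f: "f \<in> homs C X Y"
      and a: "a \<in> carrier (FO ?F Y)" for X Y r f a
  proof -
    obtain p where p: "a = \<rho> p" "(Y, p) \<in> P" using memE a by blast
    show "FA ?F (r \<odot>\<^bsub>Hom C X Y\<^esub> f) a = r \<odot>\<^bsub>FO ?F X\<^esub> FA ?F f a"
      using act_comp[OF X X Y scalar_closed[OF X r] f p(2)] comp_scalar(1)[OF X Y r f]
      by (simp add: p S)
    show "FA ?F (r \<odot>\<^bsub>Hom C X Y\<^esub> f) a = FA ?F f (r \<odot>\<^bsub>FO ?F Y\<^esub> a)"
      using act_comp[OF X Y Y f scalar_closed[OF Y r] p(2)] comp_scalar(2)[OF X Y r f]
      by (simp add: p S)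
  qed
  show "FA ?F (r \<odot>\<^bsub>Hom C X Y\<^esub> f) a = r \<odot>\<^bsub>FO ?F X\<^esub> FA ?F f a"
    if "X \<in> Obj C" "Y \<in> Obj C" "r \<in> carrier R" "f \<in> homs C X Y" "a \<in> carrier (FO ?F Y)" for X Y r f a
    by (rule FA_smult(1)[OF that])
  show "FA ?F f \<in> linear_maps R (FO ?F Y) (FO ?F X)"
    if f: "X \<in> Obj C" "Y \<in> Obj C" "f \<in> homs C X Y" for X Y f
    unfolding linear_maps_def
  proof (intro CollectI conjI ballI funcsetI)
    fix a assume "a \<in> carrier (FO ?F Y)"
    then obtain p where p: "a = \<rho> p" "(Y, p) \<in> K" "(Y, p) \<in> P" using memE by blast
    show "FA ?F f a \<in> carrier (FO ?F X)"
      using subfunctorD(7)[OF K f p(2)] by (simp add: p S)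
    fix b assume "b \<in> carrier (FO ?F Y)"
    then obtain q where q: "b = \<rho> q" "(Y, q) \<in> P" using memE by blast
    show "FA ?F f (a \<oplus>\<^bsub>FO ?F Y\<^esub> b) = FA ?F f a \<oplus>\<^bsub>FO ?F X\<^esub> FA ?F f b"
      using act_add[OF f p(3) q(2)] by (simp add: p q S)
  next
    fix r a assume "r \<in> carrier R" "a \<in> carrier (FO ?F Y)"
    then show "FA ?F f (r \<odot>\<^bsub>FO ?F Y\<^esub> a) = r \<odot>\<^bsub>FO ?F X\<^esub> FA ?F f a"
      using FA_smult[OF f(1,2) _ f(3)] by metis
  qed
  show "FA ?F (Ident C X) a = a" if "X \<in> Obj C" and a: "a \<in> carrier (FO ?F X)" for X a
    using memE[OF a] act_ident by (auto simp: S)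
  show "FA ?F (g \<cdot>\<^bsub>C\<^esub> f) a = FA ?F f (FA ?F g a)"
    if f: "X \<in> Obj C" "Y \<in> Obj C" "Z \<in> Obj C" "f \<in> homs C X Y" "g \<in> homs C Y Z"
      and a: "a \<in> carrier (FO ?F Z)" for X Y Z f g a
    using memE[OF a] act_comp[OF f] by (auto simp: S)
  show "FA ?F (f \<oplus>\<^bsub>Hom C X Y\<^esub> g) a = FA ?F f a \<oplus>\<^bsub>FO ?F X\<^esub> FA ?F g a"
    if f: "X \<in> Obj C" "Y \<in> Obj C" "f \<in> homs C X Y" "g \<in> homs C X Y"
      and a: "a \<in> carrier (FO ?F Y)" for X Y f g a
    using memE[OF a] act_hom_add[OF f] by (auto simp: S)
qed

text \<open>Exactness passes to the summand: correct a preimage by the retraction \<open>\<pi>\<close>.\<close>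

lemma module_functor_exact:
  assumes K: "subfunctor K" and \<rho>: "inj \<rho>"
    and \<pi>: "natural P \<pi>" "\<And>X p. (X, p) \<in> P \<Longrightarrow> (X, \<pi> X p) \<in> K" "\<And>X k. (X, k) \<in> K \<Longrightarrow> \<pi> X k = k"
    and ex: "hom_exact X Y Z f g"
    and exact: "\<And>p. \<lbrakk>(Y, p) \<in> P; act f p = 0\<rbrakk> \<Longrightarrow> \<exists>q. (Z, q) \<in> P \<and> p = act g q"
  shows "exact_at (FO (module_functor C act K \<rho>) Z) (FA (module_functor C act K \<rho>) g)
    (FO (module_functor C act K \<rho>) Y) (FA (module_functor C act K \<rho>) f)
    (FO (module_functor C act K \<rho>) X)"
proof -
  note S = module_functor_simps[OF \<rho>, of C act K]
  have obj: "X \<in> Obj C" "Y \<in> Obj C" "Z \<in> Obj C" and f: "f \<in> homs C X Y" and g: "g \<in> homs C Y Z"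
    and gf: "g \<cdot>\<^bsub>C\<^esub> f = \<zero>\<^bsub>Hom C X Z\<^esub>"
    using ex unfolding hom_exact_def by blast+
  have gK: "(Y, act g q) \<in> K \<and> act f (act g q) = 0" if q: "(Z, q) \<in> K" for q
  proof
    show "(Y, act g q) \<in> K" by (rule subfunctorD(7)[OF K obj(2,3) g q])
    show "act f (act g q) = 0"
      using act_comp[OF obj f g subfunctorD(1)[OF K q]] gf
        act_hom_zero[OF obj(1) subfunctorD(1)[OF K q]] by simp
  qed
  have lift: "\<exists>q. (Z, q) \<in> K \<and> p = act g q" if p: "(Y, p) \<in> K" "act f p = 0" for p
  proof -
    obtain q where q: "(Z, q) \<in> P" "p = act g q"
      using exact[OF subfunctorD(1)[OF K p(1)] p(2)] by blast
    have "p = act g (\<pi> Z q)"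
      using naturalD(3)[OF \<pi>(1) obj(2,3) g q(1)] \<pi>(3)[OF p(1)] q(2) by simp
    then show ?thesis using \<pi>(2)[OF q(1)] by blast
  qed
  have \<rho>0: "\<rho> p = \<rho> 0 \<longleftrightarrow> p = 0" for p using \<rho> by (auto dest: injD)
  show ?thesis
    unfolding exact_at_def a_kernel_def' S
  proof (intro equalityI subsetI)
    fix a assume "a \<in> FA (module_functor C act K \<rho>) g ` \<rho> ` {p. (Z, p) \<in> K}"
    then obtain q where q: "(Z, q) \<in> K" "a = \<rho> (act g q)" by (auto simp: S)
    then show "a \<in> {r \<in> \<rho> ` {p. (Y, p) \<in> K}. FA (module_functor C act K \<rho>) f r = \<rho> 0}"
      using gK[OF q(1)] by (auto simp: S)
  next
    fix a assume "a \<in> {r \<in> \<rho> ` {p. (Y, p) \<in> K}. FA (module_functor C act K \<rho>) f r = \<rho> 0}"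
    then obtain p where p: "(Y, p) \<in> K" "a = \<rho> p" "act f p = 0" by (auto simp: S \<rho>0)
    then obtain q where "(Z, q) \<in> K" "a = FA (module_functor C act K \<rho>) g (\<rho> q)"
      using lift by (auto simp: S)
    then show "a \<in> FA (module_functor C act K \<rho>) g ` \<rho> ` {p. (Z, p) \<in> K}" by blast
  qed
qed

end

context linear_triangulated_category
begin

lemma cohomological_if_exact:
  assumes F: "linear_contravariant_functor R C F"
    and exact: "\<And>X Y Z f g. hom_exact X Y Z f g
      \<Longrightarrow> exact_at (FO F Z) (FA F g) (FO F Y) (FA F f) (FO F X)"
  shows "linear_cohomological_functor R C F"
proof (intro linear_cohomological_functor.intro linear_cohomological_functor_axioms.intro F
    linear_triangulated_category_axioms)
  fix X Y Z f g h n assume t: "dist_triangle C X Y Z f g h"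
  note d = dist_triangleD[OF t]
  show "exact_at (FO F (ShO C (n + 1) X)) (FA F (ShA C n h))
      (FO F (ShO C n Z)) (FA F (ShA C n g)) (FO F (ShO C n Y))"
    using exact[OF hom_exact_shift[OF dist_triangle_hom_exact[OF rotate[OF t]], of n]]
    by (simp add: ShO_add[OF d(1)])
  show "exact_at (FO F (ShO C n Z)) (FA F (ShA C n g))
      (FO F (ShO C n Y)) (FA F (ShA C n f)) (FO F (ShO C n X))"
    by (rule exact[OF hom_exact_shift[OF dist_triangle_hom_exact[OF t]]])
  have "ShO C (n - 1) (ShO C 1 X) = ShO C n X" "ShO C (n - 1) (ShO C 1 Y) = ShO C n Y"
    "ShA C (n - 1) (ShA C 1 f) = ShA C n f"
    using ShO_add[OF d(1), of "n - 1" 1] ShO_add[OF d(2), of "n - 1" 1]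
      ShA_add[OF d(1,2,5), of "n - 1" 1] by simp_all
  then show "exact_at (FO F (ShO C n Y)) (FA F (ShA C n f))
      (FO F (ShO C n X)) (FA F (ShA C (n - 1) h)) (FO F (ShO C (n - 1) Z))"
    using exact[OF hom_exact_shift[OF dist_triangle_hom_exact_connecting[OF t], of "n - 1"]] by simp
qed

end

section \<open>The separating functor\<close>

lemma inj_pointwise_rep_circle: "inj (\<lambda>(p :: 'a \<Rightarrow> 'b \<Rightarrow> circle) u w. rep_circle (p u w))"
  by (rule injI) (metis abs_circle_rep_circle ext)

theorem theorem0p1:
  fixes R :: "('r, 'a) ring_scheme"
    and C :: "('r, 'o, 'm, 'z) tri_cat_scheme"
    and E :: "'o set"
    and Y :: 'o
  assumes "cring R"
    and "linear_triangulated_category R C"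
    and "E \<subseteq> Obj C"
    and "extension_closed C E"
    and "karoubi_closed C E"
    and "Y \<in> Obj C - E"
  shows "\<exists>F :: ('r, 'o, 'm, 'm \<Rightarrow> 'm \<Rightarrow> real) mod_functor.
           linear_cohomological_functor R C F \<and>
           (\<forall>e\<in>E. carrier (FO F e) = {\<zero>\<^bsub>FO F e\<^esub>}) \<and>
           carrier (FO F Y) \<noteq> {\<zero>\<^bsub>FO F Y\<^esub>}"
proof -
  interpret C: linear_triangulated_category R C by fact
  interpret P: injective_functor R C C.char_prod C.char_act by (rule C.char_prod_injective_functor)
  note E = assms(3,4)
  have Y: "Y \<in> Obj C" "Y \<notin> E" using assms(6) by simp_all
  obtain \<mu> where \<mu>: "\<And>X v. \<lbrakk>X \<in> Obj C; v \<in> homs C X Y\<rbrakk> \<Longrightarrow> (X, \<mu> v) \<in> C.char_prod"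
    "\<And>X v w. \<lbrakk>X \<in> Obj C; v \<in> homs C X Y; w \<in> homs C X Y\<rbrakk> \<Longrightarrow> \<mu> (v \<oplus>\<^bsub>Hom C X Y\<^esub> w) = \<mu> v + \<mu> w"
    "\<And>W X v w. \<lbrakk>W \<in> Obj C; X \<in> Obj C; v \<in> homs C X Y; w \<in> homs C W X\<rbrakk>
      \<Longrightarrow> \<mu> (v \<cdot>\<^bsub>C\<^esub> w) = C.char_act w (\<mu> v)"
    "\<And>X v. \<lbrakk>X \<in> Obj C; v \<in> homs C X Y\<rbrakk> \<Longrightarrow> \<mu> v = 0 \<longleftrightarrow> factors_through C E X Y v"
  proof (rule C.representable_quotient_embeds[OF Y(1)])
    show "\<And>X v. \<lbrakk>X \<in> Obj C; factors_through C E X Y v\<rbrakk> \<Longrightarrow> v \<in> homs C X Y"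
      using C.factors_through_closed[OF E(1) _ Y(1)] by blast
    show "\<And>X. X \<in> Obj C \<Longrightarrow> factors_through C E X Y \<zero>\<^bsub>Hom C X Y\<^esub>"
      using C.factors_through_zero[OF E _ Y(1)] by blast
    show "\<And>X v w. \<lbrakk>X \<in> Obj C; factors_through C E X Y v; factors_through C E X Y w\<rbrakk>
        \<Longrightarrow> factors_through C E X Y (v \<oplus>\<^bsub>Hom C X Y\<^esub> w)"
      using C.factors_through_add[OF E _ Y(1)] by blast
    show "\<And>X v. \<lbrakk>X \<in> Obj C; factors_through C E X Y v\<rbrakk>
        \<Longrightarrow> factors_through C E X Y (\<ominus>\<^bsub>Hom C X Y\<^esub> v)"
      using C.factors_through_neg[OF E(1) _ Y(1)] by blast
    show "\<And>W X v w. \<lbrakk>W \<in> Obj C; X \<in> Obj C; factors_through C E X Y v; w \<in> homs C W X\<rbrakk>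
        \<Longrightarrow> factors_through C E W Y (v \<cdot>\<^bsub>C\<^esub> w)"
      using C.factors_through_comp[OF E(1) _ _ Y(1)] by blast
  qed (rule that)
  define M where "M = {(X, \<mu> v) | X v. X \<in> Obj C \<and> v \<in> homs C X Y}"
  have M: "P.subfunctor M"
  proof (rule P.subfunctorI)
    show "(X, p) \<in> C.char_prod" if "(X, p) \<in> M" for X p using that \<mu>(1) by (auto simp: M_def)
    show "(X, 0) \<in> M" if X: "X \<in> Obj C" for X
    proof -
      note z = C.hom_zero_closed[OF X Y(1)]
      have "\<mu> \<zero>\<^bsub>Hom C X Y\<^esub> = 0" using \<mu>(4)[OF X z] C.factors_through_zero[OF E X Y(1)] by simp
      then show ?thesis unfolding M_def using X z by (metis (mono_tags, lifting) mem_Collect_eq)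
    qed
    show "(X, p + q) \<in> M" if "(X, p) \<in> M" "(X, q) \<in> M" for X p q
    proof -
      have "\<exists>v w. X \<in> Obj C \<and> v \<in> homs C X Y \<and> w \<in> homs C X Y \<and> p = \<mu> v \<and> q = \<mu> w"
        using that by (auto simp: M_def)
      then obtain v w where v: "X \<in> Obj C" "v \<in> homs C X Y" "w \<in> homs C X Y" "p = \<mu> v" "q = \<mu> w"
        by blast
      have "p + q = \<mu> (v \<oplus>\<^bsub>Hom C X Y\<^esub> w)" using \<mu>(2)[OF v(1-3)] v(4,5) by simp
      then show ?thesis unfolding M_def using v(1) C.hom_add_closed[OF v(1) Y(1) v(2,3)] by blast
    qed
    show "(X, - p) \<in> M" if "(X, p) \<in> M" for X p
    proof -
      have "\<exists>v. X \<in> Obj C \<and> v \<in> homs C X Y \<and> p = \<mu> v" using that by (auto simp: M_def)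
      then obtain v where v: "X \<in> Obj C" "v \<in> homs C X Y" "p = \<mu> v" by blast
      note nv = C.hom_neg_closed[OF v(1) Y(1) v(2)] and z = C.hom_zero_closed[OF v(1) Y(1)]
      have "\<mu> v + \<mu> (\<ominus>\<^bsub>Hom C X Y\<^esub> v) = 0"
        using \<mu>(2)[OF v(1,2) nv] C.hom_add_neg[OF v(1) Y(1) v(2)]
          \<mu>(4)[OF v(1) z] C.factors_through_zero[OF E v(1) Y(1)] by simp
      then have "- p = \<mu> (\<ominus>\<^bsub>Hom C X Y\<^esub> v)" using v(3) by (metis neg_eq_iff_add_eq_0)
      then show ?thesis unfolding M_def using v(1) nv by blast
    qed
    show "(X, C.char_act f p) \<in> M"
      if f: "X \<in> Obj C" "X' \<in> Obj C" "f \<in> homs C X X'" and p: "(X', p) \<in> M" for X X' f p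
    proof -
      obtain v where v: "v \<in> homs C X' Y" "p = \<mu> v" using p by (auto simp: M_def)
      have "C.char_act f p = \<mu> (v \<cdot>\<^bsub>C\<^esub> f)" using \<mu>(3)[OF f(1,2) v(1) f(3)] v(2) by simp
      then show ?thesis unfolding M_def using f(1) C.comp_closed[OF f(1,2) Y(1) f(3) v(1)] by blast
    qed
  qed
  obtain K \<pi> where K: "P.subfunctor K" and MK: "M \<subseteq> K" and \<pi>: "P.natural C.char_prod \<pi>"
    "\<And>X p. (X, p) \<in> C.char_prod \<Longrightarrow> (X, \<pi> X p) \<in> K" "\<And>X k. (X, k) \<in> K \<Longrightarrow> \<pi> X k = k"
    and ess: "\<And>X k. \<lbrakk>(X, k) \<in> K; k \<noteq> 0\<rbrakk>
      \<Longrightarrow> \<exists>W\<in>Obj C. \<exists>h\<in>homs C W X. (W, C.char_act h k) \<in> M \<and> C.char_act h k \<noteq> 0"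
    by (rule P.essential_summand[OF M]) (rule that)

  \<comment> \<open>A nonzero value at \<open>e\<close> in \<open>E\<close> has a nonzero multiple \<open>k \<cdot> h = \<mu> v\<close>. But \<open>v \<cdot> w\<close> has class
    \<open>k \<cdot> (h \<cdot> w) = 0\<close> whenever \<open>h \<cdot> w = 0\<close>, which forces \<open>v\<close> to factor through \<open>E\<close>.\<close>
  have vanish: "k = 0" if e: "e \<in> E" and k: "(e, k) \<in> K" for e k
  proof (rule ccontr)
    assume "k \<noteq> 0"
    then obtain X h where X: "X \<in> Obj C" and h: "h \<in> homs C X e"
      and hk: "(X, C.char_act h k) \<in> M" "C.char_act h k \<noteq> 0" using ess[OF k] by blast
    obtain v where v: "v \<in> homs C X Y" "C.char_act h k = \<mu> v" using hk(1) by (auto simp: M_def)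
    have eO: "e \<in> Obj C" using e E(1) by blast
    note kP = P.subfunctorD(1)[OF K k]
    have "factors_through C E W Y (v \<cdot>\<^bsub>C\<^esub> w)"
      if W: "W \<in> Obj C" and w: "w \<in> homs C W X" and hw: "h \<cdot>\<^bsub>C\<^esub> w = \<zero>\<^bsub>Hom C W e\<^esub>" for W w
    proof -
      have "\<mu> (v \<cdot>\<^bsub>C\<^esub> w) = C.char_act (h \<cdot>\<^bsub>C\<^esub> w) k"
        using \<mu>(3)[OF W X v(1) w] v(2) P.act_comp[OF W X eO w h kP] by simp
      also have "\<dots> = 0" unfolding hw by (rule P.act_hom_zero[OF W kP])
      finally show ?thesis using \<mu>(4)[OF W C.comp_closed[OF W X Y(1) w v(1)]] by simp
    qed
    then have "factors_through C E X Y v"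
      by (rule C.factors_through_extension[OF E X Y(1) v(1) e h])
    then show False using \<mu>(4)[OF X v(1)] v(2) hk(2) by simp
  qed

  define \<rho> :: "('m \<Rightarrow> 'm \<Rightarrow> circle) \<Rightarrow> 'm \<Rightarrow> 'm \<Rightarrow> real" where "\<rho> p u w = rep_circle (p u w)" for p u w
  have \<rho>: "inj \<rho>" using inj_pointwise_rep_circle unfolding \<rho>_def .
  define F where "F = module_functor C C.char_act K \<rho>"
  note S = module_functor_simps[OF \<rho>, of C C.char_act K, folded F_def]
  have "linear_cohomological_functor R C F"
  proof (rule C.cohomological_if_exact)
    show "linear_contravariant_functor R C F"
      unfolding F_def by (rule P.module_functor_linear[OF K \<rho>])
    show "exact_at (FO F Z) (FA F g) (FO F X') (FA F f) (FO F X)"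
      if ex: "C.hom_exact X X' Z f g" for X X' Z f g
      unfolding F_def
      using C.char_prod_exact[OF ex] by (intro P.module_functor_exact[OF K \<rho> \<pi> ex]) metis+
  qed
  moreover have "carrier (FO F e) = {\<zero>\<^bsub>FO F e\<^esub>}" if e: "e \<in> E" for e
  proof -
    have "{p. (e, p) \<in> K} = {0}" using vanish[OF e] P.subfunctorD(3)[OF K] e E(1) by blast
    then show ?thesis by (simp add: S)
  qed
  moreover have "carrier (FO F Y) \<noteq> {\<zero>\<^bsub>FO F Y\<^esub>}"
  proof -
    note id = C.ident_closed[OF Y(1)]
    have "\<mu> (Ident C Y) \<noteq> 0"
      using \<mu>(4)[OF Y(1) id] factors_through_ident_iff[OF assms(5) E(1) C.linear_category_axioms Y(1)] Y(2)
      by simp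
    then have "\<rho> (\<mu> (Ident C Y)) \<noteq> \<rho> 0" using \<rho> by (auto dest: injD)
    moreover have "(Y, \<mu> (Ident C Y)) \<in> K" using MK Y(1) id by (auto simp: M_def)
    ultimately show ?thesis by (auto simp: S)
  qed
  ultimately show ?thesis by blast
qed

end
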